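(* (Coefficient Theorem.) Let $\mathsf P$ be a piece with basic move set $\mathcal M$ and $\mathcal B$ a rational convex polygon. For $q\ge1$ write $u_{\mathsf P}(q;n)=\sum_{i=0}^{2q}\gamma_i(n)\,n^{2q-i}$ with periodic coefficients $\gamma_i(n)$. Then for every $i\ge 0$, $$ q!\gamma_i=\operatorname{Coeff}_{2q-i}(N^q)+\sum_{\kappa=\max(2,\lceil i/2\rceil)}^{2i}(q)_\kappa\sum_{\nu=\lceil\kappa/2\rceil}^{\min(i,2\kappa-2)}\ \sum_{[\mathcal U_\kappa^\nu]}\mu(\hat0,\mathcal U_\kappa^\nu)\frac{1}{|\operatorname{Aut}(\mathcal U_\kappa^\nu)|}\operatorname{Coeff}_{2q-i}\Big(\sum_{k=\lceil\nu/2\rceil}^{\kappa}\bar\Gamma_{k-\lceil\nu/2\rceil}(\mathcal U_\kappa^\nu)N^{q-k}\Big), $$ and, with $n$ held fixed, the coefficient $q!\gamma_i$ of $n^{2q-i}$ in each constituent of $o_{\mathsf P}(q;n)$ is a polynomial in $q$ of degree $2i$. In particular $\gamma_0=(\operatorname{vol}\mathcal B)^q/q!$ is constant, and $\gamma_1$ is constant if the vertices of $\mathcal B$ are integral points.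
   Context: Setting: a piece $\mathsf P$ has a nonempty finite set $\mathcal M$ of basic moves, nonzero vectors $m=(c,d)\in\mathbb Z^2$ with $\gcd(c,d)=1$, no two parallel; $m^\perp=(d,-c)$. $\mathcal B\subset\mathbb R^2$ is a closed two-dimensional convex polygon with rational vertices, interior $\mathcal B^\circ$, area $\operatorname{vol}\mathcal B$. For $t=n+1$ a positive integer, a labelled configuration is $\mathbf z=(z_1,\dots,z_q)$, $z_i\in t\mathcal B^\circ\cap\mathbb Z^2$, nonattacking if $(z_j-z_i)\cdot m^\perp\ne0$ for all $i\ne j$, $m\in\mathcal M$; $o_{\mathsf P}(q;n)$ counts nonattacking labelled configurations and $u_{\mathsf P}(q;n)=o_{\mathsf P}(q;n)/q!$. Move arrangement: in $\mathbb R^{2q}$ with coordinates $(z_1,\dots,z_q)$, $z_i\in\mathbb R^2$, the move hyperplanes are $\mathcal H^m_{ij}=\{(z_j-z_i)\cdot m^\perp=0\}$ for $i<j$, $m\in\mathcal M$. $\mathcal L(\mathcal A_{\mathsf P}^q)$ is the set of all intersections of sets of move hyperplanes (including $\hat0=\mathbb R^{2q}$), ordered by reverse inclusion, and $\mu$ is its Möbius function. A subspace $\mathcal U$ in this lattice involves piece $i$ if it is contained in some move hyperplane $\mathcal H^m_{ij}$ or $\mathcal H^m_{ji}$; if it involves exactly $\kappa$ pieces then, up to ordering coordinates, $\mathcal U=\tilde{\mathcal U}\times\mathbb R^{2(q-\kappa)}$ where $\tilde{\mathcal U}\subseteq\mathbb R^{2\kappa}$ (the essential part) lives in the coordinates of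 the involved pieces. $\mathcal U_\kappa^\nu$ denotes a subspace of codimension $\nu$ involving exactly $\kappa$ pieces. Two such subspaces (possibly in different $\mathbb R^{2q},\mathbb R^{2q'}$) are isomorphic (same type) if a bijection between their involved pieces carries the defining move-hyperplane equations of one to those of the other; $[\mathcal U_\kappa^\nu]$ denotes the type, and the sum over $[\mathcal U_\kappa^\nu]$ runs over all such types (one representative each). $\operatorname{Aut}(\mathcal U)$ is the group of permutations of the involved pieces leaving $\mathcal U$ invariant. $\mu(\hat0,\cdot)$ and $\operatorname{Aut}$ depend only on the type. Counting functions: $N=N(n)$ is the number of points of $(n+1)\mathcal B^\circ\cap\mathbb Z^2$ (a quadratic quasipolynomial in $n$ with leading term $(\operatorname{vol}\mathcal B)n^2$). $\alpha(\mathcal U_\kappa^\nu;n)$ is the number of integer points in $((n+1)\mathcal B^\circ)^\kappa\cap\tilde{\mathcal U}$. Expand $\alpha(\mathcal U_\kappa^\nu;n)=\sum_{j=0}^{\kappa-\lceil\nu/2\rceil}\bar\Gamma_j(\mathcal U_\kappa^\nu)N^{\kappa-\lceil\nu/2\rceil-j}$, where each $\bar\Gamma_j=n\bar\Gamma_{j1}+\bar\Gamma_{j0}$ is a quasipolynomial in $n$ of degree at most $1$. $(q)_\kappa=q(q-1)\cdots(q-\kappa+1)$. For a quasipolynomial $f(n)=\sum_j c_j(n)n^j$ with periodic $c_j$, $\operatorname{Coeff}_k(f)=c_k(n)$.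
   Formalization: The sum over κ starts at 2, as the printed lower limit max(2,⌈i/2⌉) fails in general (it is proved when N = vol(B)n² for all n); and q!γ_i is shown to be (vol B)^q times a polynomial in q of degree 2i, as q!γ_0 = (vol B)^q is not a polynomial unless vol B = 1. *)

theory Defs
  imports
    "HOL-Analysis.Analysis"
    "HOL-Analysis.Finite_Function_Topology"
    "HOL-Computational_Algebra.Polynomial"
begin

section \<open>Pieces, boards and nonattacking configurations\<close>

definition basic_moves :: "(int \<times> int) set \<Rightarrow> bool" where
  "basic_moves M \<longleftrightarrow> finite M \<and> M \<noteq> {} \<and>
     (\<forall>(c, d)\<in>M. (c, d) \<noteq> (0, 0) \<and> gcd c d = 1) \<and>
     (\<forall>(c, d)\<in>M. \<forall>(c', d')\<in>M. (c, d) \<noteq> (c', d') \<longrightarrow> c * d' - d * c' \<noteq> 0)"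

definition perp :: "int \<times> int \<Rightarrow> real \<times> real" where
  "perp m = (real_of_int (snd m), - real_of_int (fst m))"

definition integral_point :: "real \<times> real \<Rightarrow> bool" where
  "integral_point p \<longleftrightarrow> fst p \<in> \<int> \<and> snd p \<in> \<int>"

definition rational_polygon :: "(real \<times> real) set \<Rightarrow> bool" where
  "rational_polygon B \<longleftrightarrow> polytope B \<and> interior B \<noteq> {} \<and>
     (\<forall>v. v extreme_point_of B \<longrightarrow> fst v \<in> \<rat> \<and> snd v \<in> \<rat>)"

definition vol :: "(real \<times> real) set \<Rightarrow> real" where
  "vol B = measure lebesgue B"

definition board_points :: "(real \<times> real) set \<Rightarrow> nat \<Rightarrow> (real \<times> real) set" where
  "board_points B n = {p \<in> (\<lambda>x. real (n + 1) *\<^sub>R x) ` interior B. integral_point p}"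

definition num_points :: "(real \<times> real) set \<Rightarrow> nat \<Rightarrow> real" where
  "num_points B n = real (card (board_points B n))"

text \<open>
  The space of \<open>(z\<^sub>1, \<dots>, z\<^sub>q)\<close> with \<open>z\<^sub>i\<close> in the plane is realised, for all \<open>q\<close> at once,
  inside the real vector space of finitely supported maps from \<open>nat\<close> to the plane: it consists
  of the maps supported on \<open>{1..q}\<close>.
\<close>

type_synonym config = "nat \<Rightarrow>\<^sub>0 real \<times> real"

abbreviation pos :: "config \<Rightarrow> nat \<Rightarrow> real \<times> real" where
  "pos \<equiv> Poly_Mapping.lookup"

definition config_space :: "nat \<Rightarrow> config set" where
  "config_space q = {z. \<forall>i. i \<notin> {1..q} \<longrightarrow> pos z i = 0}"

definition nonattacking :: "(int \<times> int) set \<Rightarrow> nat \<Rightarrow> config \<Rightarrow> bool" where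
  "nonattacking M q z \<longleftrightarrow>
     (\<forall>i\<in>{1..q}. \<forall>j\<in>{1..q}. i \<noteq> j \<longrightarrow> (\<forall>m\<in>M. (pos z j - pos z i) \<bullet> perp m \<noteq> 0))"

definition labelled_count :: "(int \<times> int) set \<Rightarrow> (real \<times> real) set \<Rightarrow> nat \<Rightarrow> nat \<Rightarrow> nat" where
  "labelled_count M B q n =
     card {z \<in> config_space q. (\<forall>i\<in>{1..q}. pos z i \<in> board_points B n) \<and> nonattacking M q z}"

definition unlabelled_count :: "(int \<times> int) set \<Rightarrow> (real \<times> real) set \<Rightarrow> nat \<Rightarrow> nat \<Rightarrow> real" where
  "unlabelled_count M B q n = real (labelled_count M B q n) / fact q"


section \<open>The move arrangement and its intersection lattice\<close>

definition move_hyperplane :: "nat \<Rightarrow> int \<times> int \<Rightarrow> nat \<Rightarrow> nat \<Rightarrow> config set" where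
  "move_hyperplane q m i j = {z \<in> config_space q. (pos z j - pos z i) \<bullet> perp m = 0}"

definition move_hyperplanes :: "(int \<times> int) set \<Rightarrow> nat \<Rightarrow> config set set" where
  "move_hyperplanes M q = {move_hyperplane q m i j | m i j. m \<in> M \<and> 1 \<le> i \<and> i < j \<and> j \<le> q}"

definition intersection_lattice :: "(int \<times> int) set \<Rightarrow> nat \<Rightarrow> config set set" where
  "intersection_lattice M q = {config_space q \<inter> \<Inter>S | S. S \<subseteq> move_hyperplanes M q}"

text \<open>
  Moebius function of a finite family of sets \<open>L\<close> ordered by reverse inclusion, so that
  \<open>V \<le> U\<close> means \<open>U \<subseteq> V\<close>. The guard on finiteness only serves termination.
\<close>

function moebius :: "'a set set \<Rightarrow> 'a set \<Rightarrow> 'a set \<Rightarrow> int" where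
  "moebius L V U =
     (if V = U then 1
      else if finite L \<and> U \<subset> V then - (\<Sum>W\<in>{W \<in> L. U \<subset> W \<and> W \<subseteq> V}. moebius L V W)
      else 0)"
  by pat_completeness auto
termination
proof (relation "Wellfounded.measure (\<lambda>(L, V, U). card {W \<in> L. U \<subset> W})")
  fix L :: "'a set set" and V U W
  assume "\<not> V = U" and fin: "finite L \<and> U \<subset> V" and W: "W \<in> {W \<in> L. U \<subset> W \<and> W \<subseteq> V}"
  have "{X \<in> L. W \<subset> X} \<subset> {X \<in> L. U \<subset> X}"
    using W by auto
  moreover have "finite {X \<in> L. U \<subset> X}"
    using fin by simp
  ultimately show "((L, V, W), (L, V, U)) \<in> Wellfounded.measure (\<lambda>(L, V, U). card {W \<in> L. U \<subset> W})"
    by (simp add: psubset_card_mono)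
qed simp

declare moebius.simps [simp del]

definition mu0 :: "(int \<times> int) set \<Rightarrow> nat \<Rightarrow> config set \<Rightarrow> int" where
  "mu0 M q U = moebius (intersection_lattice M q) (config_space q) U"

definition involved :: "(int \<times> int) set \<Rightarrow> nat \<Rightarrow> config set \<Rightarrow> nat set" where
  "involved M q U =
     {i \<in> {1..q}. \<exists>j\<in>{1..q}. \<exists>m\<in>M. j \<noteq> i \<and> U \<subseteq> move_hyperplane q m i j}"

definition codim :: "nat \<Rightarrow> config set \<Rightarrow> nat" where
  "codim q U = 2 * q - dim U"

text \<open>
  Since \<open>U\<close> imposes no condition on the pieces that are not involved, its essential part is
  its section by the subspace where those pieces are at the origin.
\<close>

definition essential_part :: "(int \<times> int) set \<Rightarrow> nat \<Rightarrow> config set \<Rightarrow> config set" where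
  "essential_part M q U = {z \<in> U. \<forall>i. i \<notin> involved M q U \<longrightarrow> pos z i = 0}"

definition subspace_count ::
    "(int \<times> int) set \<Rightarrow> (real \<times> real) set \<Rightarrow> nat \<Rightarrow> config set \<Rightarrow> nat \<Rightarrow> nat" where
  "subspace_count M B q U n =
     card {z \<in> essential_part M q U. \<forall>i\<in>involved M q U. pos z i \<in> board_points B n}"

text \<open>
  For a permutation \<open>\<sigma>\<close>, \<open>Poly_Mapping.map_key \<sigma> z\<close> is the configuration \<open>i \<mapsto> z (\<sigma> i)\<close>.
\<close>

definition automorphisms :: "(int \<times> int) set \<Rightarrow> nat \<Rightarrow> config set \<Rightarrow> (nat \<Rightarrow> nat) set" where
  "automorphisms M q U =
     {\<sigma>. \<sigma> permutes involved M q U \<and> Poly_Mapping.map_key \<sigma> ` U = U}"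

text \<open>
  A subspace is kept together with the number \<open>q\<close> of pieces of its ambient space, so that
  subspaces of different ambient spaces can have the same type.
\<close>

definition move_subspaces :: "(int \<times> int) set \<Rightarrow> (nat \<times> config set) set" where
  "move_subspaces M = {(q, U). 1 \<le> q \<and> U \<in> intersection_lattice M q}"

definition same_type :: "(int \<times> int) set \<Rightarrow> ((nat \<times> config set) \<times> (nat \<times> config set)) set" where
  "same_type M = {((q, U), (q', U')).
     (q, U) \<in> move_subspaces M \<and> (q', U') \<in> move_subspaces M \<and>
     (\<exists>\<sigma>. bij_betw \<sigma> (involved M q U) (involved M q' U') \<and>
        (\<forall>i\<in>involved M q U. \<forall>j\<in>involved M q U. i \<noteq> j \<longrightarrow>
           (\<forall>m\<in>M. U \<subseteq> move_hyperplane q m i j \<longleftrightarrow> U' \<subseteq> move_hyperplane q' m (\<sigma> i) (\<sigma> j))))}"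

definition subspace_types :: "(int \<times> int) set \<Rightarrow> nat \<Rightarrow> nat \<Rightarrow> (nat \<times> config set) set set" where
  "subspace_types M \<kappa> \<nu> =
     {(q, U) \<in> move_subspaces M. card (involved M q U) = \<kappa> \<and> codim q U = \<nu>} // same_type M"


section \<open>Quasipolynomials\<close>

definition periodic :: "(nat \<Rightarrow> 'a) \<Rightarrow> bool" where
  "periodic f \<longleftrightarrow> (\<exists>p>0. \<forall>n. f (n + p) = f n)"

text \<open>
  \<open>c n\<close> is the constituent of \<open>f\<close> on the residue class of \<open>n\<close>; its coefficients are the values
  at \<open>n\<close> of the periodic coefficient functions of \<open>f\<close>. The family \<open>c\<close> is unique if it exists.
\<close>

definition has_constituents :: "(nat \<Rightarrow> real) \<Rightarrow> (nat \<Rightarrow> real poly) \<Rightarrow> bool" where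
  "has_constituents f c \<longleftrightarrow> periodic c \<and> (\<forall>n. f n = poly (c n) (real n))"

definition Coeff :: "int \<Rightarrow> (nat \<Rightarrow> real) \<Rightarrow> nat \<Rightarrow> real" where
  "Coeff k f n = (if k < 0 then 0 else coeff ((THE c. has_constituents f c) n) (nat k))"

definition linear_quasipolynomial :: "(nat \<Rightarrow> real) \<Rightarrow> bool" where
  "linear_quasipolynomial f \<longleftrightarrow>
     (\<exists>a b. periodic a \<and> periodic b \<and> (\<forall>n. f n = real n * a n + b n))"

abbreviation half_up :: "nat \<Rightarrow> nat" where
  "half_up k \<equiv> nat \<lceil>real k / 2\<rceil>"


section \<open>Data of the coefficient formula\<close>

text \<open>
  \<open>\<gamma> q i\<close> are the coefficients of the quasipolynomial counting unlabelled placements of \<open>q\<close>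
  pieces, with \<open>\<gamma> q i = 0\<close> for \<open>i > 2q\<close>.
\<close>

definition count_coefficients ::
    "(int \<times> int) set \<Rightarrow> (real \<times> real) set \<Rightarrow> (nat \<Rightarrow> nat \<Rightarrow> nat \<Rightarrow> real) \<Rightarrow> bool" where
  "count_coefficients M B \<gamma> \<longleftrightarrow>
     (\<forall>q\<ge>1. (\<forall>i. periodic (\<gamma> q i)) \<and> (\<forall>i>2 * q. \<forall>n. \<gamma> q i n = 0) \<and>
        (\<forall>n. unlabelled_count M B q n = (\<Sum>i = 0..2 * q. \<gamma> q i n * real n ^ (2 * q - i))))"

definition count_expansions ::
    "(int \<times> int) set \<Rightarrow> (real \<times> real) set \<Rightarrow> (nat \<Rightarrow> config set \<Rightarrow> nat \<Rightarrow> nat \<Rightarrow> real) \<Rightarrow> bool" where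
  "count_expansions M B \<Gamma> \<longleftrightarrow>
     (\<forall>(q, U)\<in>move_subspaces M.
        (\<forall>j. linear_quasipolynomial (\<Gamma> q U j)) \<and>
        (let r = card (involved M q U) - half_up (codim q U)
         in \<forall>n. real (subspace_count M B q U n) =
              (\<Sum>j = 0..r. \<Gamma> q U j n * num_points B n ^ (r - j))))"

text \<open>
  The right-hand side of the coefficient formula, with the sum over \<open>\<kappa>\<close> starting at \<open>\<kappa>\<^sub>0\<close>, and
  \<open>rep T\<close> the representative chosen for the type \<open>T\<close>. The truncated exponent \<open>q - k\<close> is
  harmless: if \<open>k > q\<close> then \<open>\<kappa> > q\<close>, and the falling factorial of \<open>q\<close> vanishes.
\<close>

definition coefficient_formula ::
    "(int \<times> int) set \<Rightarrow> (real \<times> real) set \<Rightarrow> (nat \<Rightarrow> config set \<Rightarrow> nat \<Rightarrow> nat \<Rightarrow> real) \<Rightarrow>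
     ((nat \<times> config set) set \<Rightarrow> nat \<times> config set) \<Rightarrow> nat \<Rightarrow> nat \<Rightarrow> nat \<Rightarrow> nat \<Rightarrow> real" where
  "coefficient_formula M B \<Gamma> rep \<kappa>\<^sub>0 q i n =
     Coeff (2 * int q - int i) (\<lambda>n. num_points B n ^ q) n +
     (\<Sum>\<kappa> = \<kappa>\<^sub>0..2 * i. (\<Prod>l<\<kappa>. real q - real l) *
        (\<Sum>\<nu> = half_up \<kappa>..min i (2 * \<kappa> - 2).
           \<Sum>T\<in>subspace_types M \<kappa> \<nu>. case rep T of (q', U) \<Rightarrow>
             real_of_int (mu0 M q' U) * (1 / real (card (automorphisms M q' U))) *
             Coeff (2 * int q - int i)
               (\<lambda>n. \<Sum>k = half_up \<nu>..\<kappa>. \<Gamma> q' U (k - half_up \<nu>) n * num_points B n ^ (q - k)) n))"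

end

(*
  Whitney's formula and inclusion-exclusion express the number of nonattacking labelled
  configurations as the sum of mu(0, U) alpha(U; n) N^(q - kappa) over all lattice elements U, and
  (q)_kappa / |Aut U| of these have the type of U. A subspace with nu > i does not contribute to
  the coefficient of n^(2q - i), since alpha(U; n) = O(n^(2 kappa - nu)); moreover kappa <= 2 nu and
  nu <= 2 kappa - 2. That N is a quasipolynomial is the case q = 1 of the hypothesis on the counts.

  On a constituent, the coefficient of n^(2r - j) in N^r is vol(B)^r times a polynomial of degree at
  most j in r, so U contributes a polynomial in q of degree at most kappa + i - nu <= 2i. Equality
  forces kappa = 2i and nu = i. Then the hyperplanes of U involve disjoint pairs of pieces,
  mu(0, U) = (-1)^i, and the leading coefficient of alpha(U; n) is positive by the Cauchy-Schwarz
  inequality, so these contributions do not cancel.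

  For gamma_1 only the coefficient of n in N and the leading coefficients of the alpha(U; n) with
  nu = 1 matter. The latter are volumes. The former is constant for a lattice polygon because
  (N(n + 1) - N(n)) / n converges: the added points lie on finitely many line segments of linearly
  growing length, in number independent of n.
*)

theory Submission
  imports Defs
begin

subsection \<open>Quasipolynomials\<close>

text \<open>Types compare subspaces of different ambient spaces, so nothing attached to
  \<open>U\<close> may depend on \<open>q\<close>. A lattice element is therefore replaced by its
  flat, the set of all labels (a move and an unordered pair of pieces) whose equations hold on it. A
  type is then a class of flats under injective renaming of pieces, and the Moebius value, the
  codimension and \<open>\<alpha>\<close> are read off from the flat. Test configurations that
  displace one or two pieces show which labels a flat can contain.

  The obstacle in the formula is the lower limit of \<open>\<kappa>\<close>. If
  \<open>2 \<kappa> < i\<close>, then \<open>\<alpha>\<close> alone cannot lower the degree by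
  \<open>i\<close>, but lower terms of the power of \<open>N\<close> can supply the rest. The sum is
  therefore proved with a variable lower limit: 2 in general, and the larger value when
  \<open>N\<close> is the pure term \<open>vol B * n^2\<close>.

  All coefficients are indexed by their distance from the top degree. In this indexing neither the
  coefficients of \<open>\<alpha>\<close> nor the range of the convolution depends on
  \<open>q\<close>, and the dependence on \<open>q\<close> is confined to a power of
  \<open>N\<close> and a falling factorial.\<close>

lemma periodic_multiple:
  assumes "periodic f"
  shows "\<exists>p>0. \<forall>n k. f (n + k * p) = f n"
proof -
  from assms obtain p where p: "p > 0" "\<And>n. f (n + p) = f n"
    unfolding periodic_def by auto
  have "f (n + k * p) = f n" for n k
  proof (induction k)
    case (Suc k)
    have "f (n + Suc k * p) = f ((n + k * p) + p)" by (simp add: algebra_simps)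
    with Suc p show ?case by simp
  qed simp
  with p show ?thesis by blast
qed

lemma periodic_const [simp]: "periodic (\<lambda>n. a)"
  unfolding periodic_def by (auto intro: exI[of _ 1])

lemma periodic_map: "periodic f \<Longrightarrow> periodic (\<lambda>n. g (f n))"
  unfolding periodic_def by metis

lemma periodic_map2:
  assumes "periodic f" "periodic g"
  shows "periodic (\<lambda>n. h (f n) (g n))"
proof -
  obtain p where p: "p > 0" "\<And>n k. f (n + k * p) = f n" using periodic_multiple[OF assms(1)] by auto
  obtain r where r: "r > 0" "\<And>n k. g (n + k * r) = g n" using periodic_multiple[OF assms(2)] by auto
  have "f (n + p * r) = f n \<and> g (n + p * r) = g n" for n
    using p(2)[of n r] r(2)[of n p] by (simp add: mult.commute)
  with p(1) r(1) show ?thesis unfolding periodic_def by (intro exI[of _ "p * r"]) auto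
qed

lemma has_constituents_add:
  "has_constituents f c \<Longrightarrow> has_constituents g d \<Longrightarrow> has_constituents (\<lambda>n. f n + g n) (\<lambda>n. c n + d n)"
  unfolding has_constituents_def by (auto intro: periodic_map2)

lemma has_constituents_mult:
  "has_constituents f c \<Longrightarrow> has_constituents g d \<Longrightarrow> has_constituents (\<lambda>n. f n * g n) (\<lambda>n. c n * d n)"
  unfolding has_constituents_def by (auto intro: periodic_map2)

lemma has_constituents_power:
  "has_constituents f c \<Longrightarrow> has_constituents (\<lambda>n. f n ^ k) (\<lambda>n. c n ^ k)"
  unfolding has_constituents_def by (auto intro: periodic_map simp: poly_power)

lemma has_constituents_const [simp]: "has_constituents (\<lambda>n. a) (\<lambda>n. [:a:])"
  unfolding has_constituents_def by auto

lemma has_constituents_cmult: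
  "has_constituents f c \<Longrightarrow> has_constituents (\<lambda>n. a * f n) (\<lambda>n. smult a (c n))"
  unfolding has_constituents_def by (auto intro: periodic_map)

lemma has_constituents_monom:
  "periodic g \<Longrightarrow> has_constituents (\<lambda>n. g n * real n ^ k) (\<lambda>n. monom (g n) k)"
  unfolding has_constituents_def by (auto intro: periodic_map simp: poly_monom)

lemma has_constituents_sum:
  assumes "finite A" "\<And>x. x \<in> A \<Longrightarrow> has_constituents (f x) (c x)"
  shows "has_constituents (\<lambda>n. \<Sum>x\<in>A. f x n) (\<lambda>n. \<Sum>x\<in>A. c x n)"
  using assms
proof (induction A rule: finite_induct)
  case empty
  show ?case using has_constituents_const[of 0] by simp
next
  case (insert x A)
  then show ?case by (auto intro: has_constituents_add)
qed

lemma linear_quasipolynomial_constituents: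
  assumes "linear_quasipolynomial f"
  obtains c where "has_constituents f c"
proof -
  obtain a b where "periodic a" "periodic b" "\<And>n. f n = real n * a n + b n"
    using assms unfolding linear_quasipolynomial_def by auto
  then have "has_constituents f (\<lambda>n. [:b n, a n:])"
    unfolding has_constituents_def by (auto intro: periodic_map2)
  with that show ?thesis by blast
qed

lemma filterlim_real_progression:
  assumes "p > 0"
  shows "filterlim (\<lambda>k. real (n + k * p)) at_top sequentially"
proof (rule filterlim_at_top_mono[OF filterlim_real_sequentially])
  show "\<forall>\<^sub>F k in sequentially. real k \<le> real (n + k * p)"
    using assms by (intro always_eventually allI) (metis le_add2 le_trans mult.right_neutral
        mult_le_mono2 of_nat_mono One_nat_def Suc_leI)
qed

lemma filterlim_progression:
  assumes "p > 0"
  shows "filterlim (\<lambda>k. n + k * p) at_top sequentially"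
  using filterlim_real_progression[OF assms, of n]
  by (simp add: filterlim_sequentially_iff_filterlim_real)

lemma poly_eqI_progression:
  fixes P Q :: "real poly"
  assumes "p > 0" "\<And>k. poly P (real (n + k * p)) = poly Q (real (n + k * p))"
  shows "P = Q"
proof (rule ccontr)
  assume "P \<noteq> Q"
  then have "finite {x. poly (P - Q) x = 0}" by (intro poly_roots_finite) simp
  moreover have "range (\<lambda>k. real (n + k * p)) \<subseteq> {x. poly (P - Q) x = 0}"
    using assms(2) by auto
  moreover have "inj (\<lambda>k. real (n + k * p))"
    using assms(1) by (auto simp: inj_on_def)
  ultimately show False
    by (meson finite_imageD finite_subset infinite_UNIV_nat)
qed

text \<open>On a residue class of a common period both polynomials take the values of
  \<open>f\<close> at infinitely many points. This gives meaning to the definite description in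
  \<open>Coeff\<close>.\<close>

lemma has_constituents_unique:
  assumes "has_constituents f c" "has_constituents f d"
  shows "c = d"
proof
  fix n
  \<comment> \<open>Pairing the two families yields one period for both.\<close>
  have "periodic (\<lambda>n. (c n, d n))"
    using assms unfolding has_constituents_def by (auto intro: periodic_map2)
  then obtain p where p: "p > 0" "\<And>n k. (c (n + k * p), d (n + k * p)) = (c n, d n)"
    using periodic_multiple by blast
  have "poly (c n) (real (n + k * p)) = poly (d n) (real (n + k * p))" for k
    using assms p(2)[of n k] unfolding has_constituents_def by (metis prod.inject)
  then show "c n = d n" by (rule poly_eqI_progression[OF p(1)])
qed

lemma Coeff_eq:
  assumes "has_constituents f c"
  shows "Coeff k f n = (if k < 0 then 0 else coeff (c n) (nat k))"
proof -
  have "(THE c. has_constituents f c) = c"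
    using assms has_constituents_unique by (intro the_equality) auto
  then show ?thesis by (simp add: Coeff_def)
qed

definition quasipolynomial :: "(nat \<Rightarrow> real) \<Rightarrow> bool" where
  "quasipolynomial f \<longleftrightarrow> (\<exists>c. has_constituents f c)"

definition constituents :: "(nat \<Rightarrow> real) \<Rightarrow> nat \<Rightarrow> real poly" where
  "constituents f = (THE c. has_constituents f c)"

lemma constituents_eqI: "has_constituents f c \<Longrightarrow> constituents f = c"
  unfolding constituents_def using has_constituents_unique by (intro the_equality) auto

lemma has_constituents_constituents: "quasipolynomial f \<Longrightarrow> has_constituents f (constituents f)"
  unfolding quasipolynomial_def using constituents_eqI by metis

lemma quasipolynomialI: "has_constituents f c \<Longrightarrow> quasipolynomial f"
  unfolding quasipolynomial_def by blast

lemma quasipolynomial_mult: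
  "quasipolynomial f \<Longrightarrow> quasipolynomial g \<Longrightarrow> quasipolynomial (\<lambda>n. f n * g n)"
  unfolding quasipolynomial_def using has_constituents_mult by blast

lemma quasipolynomial_power: "quasipolynomial f \<Longrightarrow> quasipolynomial (\<lambda>n. f n ^ k)"
  unfolding quasipolynomial_def using has_constituents_power by blast

lemma quasipolynomial_cmult: "quasipolynomial f \<Longrightarrow> quasipolynomial (\<lambda>n. a * f n)"
  unfolding quasipolynomial_def using has_constituents_cmult by blast

lemma quasipolynomial_sum:
  assumes "finite A" "\<And>x. x \<in> A \<Longrightarrow> quasipolynomial (f x)"
  shows "quasipolynomial (\<lambda>n. \<Sum>x\<in>A. f x n)"
proof (rule quasipolynomialI)
  show "has_constituents (\<lambda>n. \<Sum>x\<in>A. f x n) (\<lambda>n. \<Sum>x\<in>A. constituents (f x) n)"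
    using assms by (intro has_constituents_sum has_constituents_constituents)
qed

lemma linear_quasipolynomial_imp: "linear_quasipolynomial f \<Longrightarrow> quasipolynomial f"
  by (meson linear_quasipolynomial_constituents quasipolynomialI)

lemma Coeff_cmult:
  "quasipolynomial f \<Longrightarrow> Coeff k (\<lambda>n. a * f n) n = a * Coeff k f n"
  using Coeff_eq[OF has_constituents_cmult[OF has_constituents_constituents]]
    Coeff_eq[OF has_constituents_constituents] by simp

lemma Coeff_sum:
  assumes "finite A" "\<And>x. x \<in> A \<Longrightarrow> quasipolynomial (f x)"
  shows "Coeff k (\<lambda>n. \<Sum>x\<in>A. f x n) n = (\<Sum>x\<in>A. Coeff k (f x) n)"
proof -
  have *: "has_constituents (\<lambda>n. \<Sum>x\<in>A. f x n) (\<lambda>n. \<Sum>x\<in>A. constituents (f x) n)"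
    using assms by (intro has_constituents_sum has_constituents_constituents)
  have "(\<Sum>x\<in>A. Coeff k (f x) n) = (\<Sum>x\<in>A. if k < 0 then 0 else coeff (constituents (f x) n) (nat k))"
    by (intro sum.cong refl Coeff_eq has_constituents_constituents assms(2))
  also have "\<dots> = Coeff k (\<lambda>n. \<Sum>x\<in>A. f x n) n"
    unfolding Coeff_eq[OF *] by (simp add: coeff_sum)
  finally show ?thesis by simp
qed

text \<open>\<open>d\<close> may exceed the degree: the quotient then tends to 0, which is also the
  value of \<open>coeff P d\<close>. So an upper bound for the degree is enough to identify a
  coefficient by a limit.\<close>

lemma poly_over_power_tendsto:
  fixes P :: "real poly"
  assumes "degree P \<le> d"
  shows "((\<lambda>x. poly P x / x ^ d) \<longlongrightarrow> coeff P d) at_top"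
proof -
  have "((\<lambda>x. poly P x / x ^ degree P) \<longlongrightarrow> lead_coeff P) at_top"
    using poly_divide_tendsto_aux[of P] at_top_le_at_infinity tendsto_mono by blast
  moreover have "((\<lambda>x::real. 1 / x ^ (d - degree P)) \<longlongrightarrow> (if d = degree P then 1 else 0)) at_top"
  proof (cases "d = degree P")
    case False
    then have "filterlim (\<lambda>x::real. x ^ (d - degree P)) at_top at_top"
      using assms by (intro filterlim_pow_at_top filterlim_ident) auto
    then show ?thesis
      using False tendsto_divide_0[OF tendsto_const filterlim_at_top_imp_at_infinity] by auto
  qed auto
  ultimately have "((\<lambda>x. poly P x / x ^ degree P * (1 / x ^ (d - degree P)))
      \<longlongrightarrow> lead_coeff P * (if d = degree P then 1 else 0)) at_top"
    by (rule tendsto_mult)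
  moreover have "lead_coeff P * (if d = degree P then 1 else 0) = coeff P d"
    using assms by (auto simp: coeff_eq_0)
  moreover have "poly P x / x ^ degree P * (1 / x ^ (d - degree P)) = poly P x / x ^ d" for x
    using assms by (simp flip: power_add)
  ultimately show ?thesis by (simp only:)
qed

text \<open>After division by the power with exponent \<open>degree P\<close>, the bound would tend
  to 0 but the polynomial to its leading coefficient. The \<open>+ 1\<close> keeps the bound usable
  at argument 0.\<close>

lemma degree_le_of_growth:
  fixes P :: "real poly"
  assumes "p > 0" "\<And>k. \<bar>poly P (real (n + k * p))\<bar> \<le> C * (real (n + k * p) + 1) ^ d"
  shows "degree P \<le> d"
proof (rule ccontr)
  assume "\<not> degree P \<le> d"
  then have d: "d < degree P" by simp
  let ?x = "\<lambda>k. real (n + k * p)"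
  have C: "degree (smult C ([:1, 1:] ^ d)) < degree P"
    using degree_power_le[of "[:1,1::real:]" d] degree_smult_le[of C "[:1,1:] ^ d"] d by simp
  have "((\<lambda>k. poly (smult C ([:1, 1:] ^ d)) (?x k) / ?x k ^ degree P) \<longlongrightarrow> 0) sequentially"
    using filterlim_compose[OF poly_over_power_tendsto filterlim_real_progression[OF assms(1)],
        of "smult C ([:1, 1:] ^ d)" "degree P" n] C coeff_eq_0[OF C] by (simp only: less_imp_le)
  moreover have "((\<lambda>k. poly P (?x k) / ?x k ^ degree P) \<longlongrightarrow> lead_coeff P) sequentially"
    using filterlim_compose[OF poly_over_power_tendsto filterlim_real_progression[OF assms(1)],
        of P "degree P" n] by simp
  then have "((\<lambda>k. \<bar>poly P (?x k) / ?x k ^ degree P\<bar>) \<longlongrightarrow> \<bar>lead_coeff P\<bar>) sequentially"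
    by (rule tendsto_rabs)
  moreover have "\<bar>poly P (?x k) / ?x k ^ degree P\<bar>
      \<le> poly (smult C ([:1, 1:] ^ d)) (?x k) / ?x k ^ degree P" for k
    using assms(2)[of k] by (auto simp: abs_divide poly_power add.commute intro!: divide_right_mono)
  ultimately have "\<bar>lead_coeff P\<bar> \<le> 0"
    by (intro LIMSEQ_le) auto
  with d show False by auto
qed

lemma constituents_degree_le:
  assumes "has_constituents f c" "\<And>n. \<bar>f n\<bar> \<le> C * (real n + 1) ^ d"
  shows "degree (c n) \<le> d"
proof -
  obtain p where p: "p > 0" "\<And>n k. c (n + k * p) = c n"
    using assms(1) periodic_multiple unfolding has_constituents_def by blast
  have "poly (c n) (real (n + k * p)) = f (n + k * p)" for k
    using assms(1) p(2)[of n k] unfolding has_constituents_def by metis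
  with assms(2) show ?thesis by (intro degree_le_of_growth[OF p(1), of _ n C]) metis
qed

text \<open>The limit is taken inside one residue class, because different constituents may have
  different coefficients.\<close>

lemma constituents_progression_tendsto:
  assumes "has_constituents f c" "degree (c n) \<le> d"
  obtains p where "p > 0" "(\<lambda>k. f (n + k * p) / real (n + k * p) ^ d) \<longlonglongrightarrow> coeff (c n) d"
proof -
  obtain p where p: "p > 0" "\<And>n k. c (n + k * p) = c n"
    using assms(1) periodic_multiple unfolding has_constituents_def by blast
  have "poly (c n) (real (n + k * p)) = f (n + k * p)" for k
    using assms(1) p(2)[of n k] unfolding has_constituents_def by metis
  then have "(\<lambda>k. f (n + k * p) / real (n + k * p) ^ d) \<longlonglongrightarrow> coeff (c n) d"
    using filterlim_compose[OF poly_over_power_tendsto[OF assms(2)] filterlim_real_progression[OF p(1), of n]]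
    by simp
  with p(1) that show ?thesis by blast
qed

text \<open>A limit over all \<open>n\<close> restricts to every residue class, so it forces all
  constituents to share the coefficient. Constancy of a coefficient is obtained in this way.\<close>

lemma constituents_coeff_eq_limit:
  assumes "has_constituents f c" "degree (c n) \<le> d" "(\<lambda>n. f n / real n ^ d) \<longlonglongrightarrow> L"
  shows "coeff (c n) d = L"
proof -
  obtain p where p: "p > 0" "(\<lambda>k. f (n + k * p) / real (n + k * p) ^ d) \<longlonglongrightarrow> coeff (c n) d"
    using constituents_progression_tendsto[OF assms(1,2)] .
  moreover have "(\<lambda>k. f (n + k * p) / real (n + k * p) ^ d) \<longlonglongrightarrow> L"
    using filterlim_compose[OF assms(3) filterlim_progression[OF p(1), of n]] .
  ultimately show ?thesis using LIMSEQ_unique by blast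
qed

text \<open>For the extremal counts only a lower bound of the right order is at hand, and it
  suffices for positivity.\<close>

lemma constituents_coeff_pos:
  assumes "has_constituents f c" "degree (c n) \<le> d"
    and "a > 0" "\<forall>\<^sub>F n in sequentially. f n \<ge> a * real n ^ d"
  shows "coeff (c n) d > 0"
proof -
  obtain p where p: "p > 0" "(\<lambda>k. f (n + k * p) / real (n + k * p) ^ d) \<longlonglongrightarrow> coeff (c n) d"
    using constituents_progression_tendsto[OF assms(1,2)] .
  have "\<forall>\<^sub>F n in sequentially. f n \<ge> a * real n ^ d \<and> n \<ge> 1"
    using assms(4) eventually_ge_at_top[of 1] by eventually_elim auto
  then have "\<forall>\<^sub>F n in sequentially. f n / real n ^ d \<ge> a"
    by eventually_elim (auto simp: field_simps)
  then have "\<forall>\<^sub>F k in sequentially. f (n + k * p) / real (n + k * p) ^ d \<ge> a"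
    using filterlim_progression[OF p(1), of n] unfolding filterlim_iff by blast
  then have "a \<le> coeff (c n) d"
    using p(2) tendsto_lowerbound by (metis trivial_limit_sequentially)
  with assms(3) show ?thesis by simp
qed

subsection \<open>Coefficients of powers of a quadratic polynomial\<close>

definition falling_poly :: "nat \<Rightarrow> real poly" where
  "falling_poly k = (\<Prod>l<k. [:- real l, 1:])"

lemma poly_falling_poly: "poly (falling_poly k) x = (\<Prod>l<k. x - real l)"
  by (simp add: falling_poly_def poly_prod)

lemma monic_falling_poly: "degree (falling_poly k) = k" "lead_coeff (falling_poly k) = 1"
proof -
  show "degree (falling_poly k) = k"
    unfolding falling_poly_def by (subst degree_prod_eq_sum_degree) auto
  show "lead_coeff (falling_poly k) = 1"
    unfolding falling_poly_def by (subst lead_coeff_prod) auto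
qed

lemma falling_eq_0: "q < k \<Longrightarrow> (\<Prod>l<k. real q - real l) = 0"
  by (auto intro!: prod_zero)

lemma falling_eq_choose: "(\<Prod>l<k. real q - real l) = real (q choose k) * fact k"
  by (simp add: binomial_gbinomial gbinomial_prod_rev atLeast0LessThan)

text \<open>The coefficient of \<open>x^j\<close> in \<open>(1 + u x + w x^2)^r\<close> as a
  polynomial in \<open>r\<close>: expand in powers of \<open>u x + w x^2\<close> and read
  \<open>r choose k\<close> as \<open>falling_poly k\<close> divided by \<open>k!\<close>. Powers
  with \<open>k > j\<close> have no term of degree \<open>j\<close>, which bounds the degree in
  \<open>r\<close> by \<open>j\<close>.\<close>

definition trinomial_poly :: "real \<Rightarrow> real \<Rightarrow> nat \<Rightarrow> real poly" where
  "trinomial_poly u w j = (\<Sum>k\<le>j. smult (coeff ([:0, u, w:] ^ k) j / fact k) (falling_poly k))"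

lemma degree_trinomial_poly: "degree (trinomial_poly u w j) \<le> j"
  unfolding trinomial_poly_def
  by (intro degree_sum_le) (auto intro: order.trans[OF degree_smult_le] simp: monic_falling_poly)

lemma trinomial_poly_0: "trinomial_poly u w 0 = 1"
  by (simp add: trinomial_poly_def falling_poly_def)

lemma coeff_power_eq_0: "j < k \<Longrightarrow> coeff ([:0, u, w::real:] ^ k) j = 0"
proof -
  assume "j < k"
  have "[:0, u, w:] = monom 1 1 * [:u, w:]" by (simp add: monom_altdef)
  then have "[:0, u, w:] ^ k = monom 1 k * [:u, w:] ^ k"
    by (simp only: power_mult_distrib monom_power) simp
  with \<open>j < k\<close> show ?thesis by (simp add: coeff_monom_mult)
qed

lemma coeff_trinomial_power:
  "coeff ([:v, v * u, v * w:] ^ r) j = v ^ r * poly (trinomial_poly u w j) (real r)"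
proof -
  have "[:v, v * u, v * w:] = smult v ([:0, u, w:] + 1)" by (simp add: one_pCons)
  then have "[:v, v * u, v * w:] ^ r = smult (v ^ r) (([:0, u, w:] + 1) ^ r)"
    by (simp only: smult_power)
  also have "([:0, u, w:] + 1) ^ r = (\<Sum>k\<le>r. of_nat (r choose k) * [:0, u, w:] ^ k)"
    by (subst binomial_ring) simp
  finally have "coeff ([:v, v * u, v * w:] ^ r) j
      = v ^ r * (\<Sum>k\<le>r. real (r choose k) * coeff ([:0, u, w:] ^ k) j)"
    by (simp add: coeff_sum of_nat_poly)
  \<comment> \<open>Terms with \<open>k > r\<close> vanish by the binomial coefficient, those with
    \<open>k > j\<close> by \<open>coeff_power_eq_0\<close>. Going through \<open>max r j\<close>
    changes the upper limit from \<open>r\<close> to \<open>j\<close>.\<close>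
  also have "(\<Sum>k\<le>r. real (r choose k) * coeff ([:0, u, w:] ^ k) j)
      = (\<Sum>k\<le>max r j. real (r choose k) * coeff ([:0, u, w:] ^ k) j)"
    by (rule sum.mono_neutral_left) (auto simp: binomial_eq_0)
  also have "\<dots> = (\<Sum>k\<le>j. real (r choose k) * coeff ([:0, u, w:] ^ k) j)"
    by (rule sum.mono_neutral_right) (auto simp: coeff_power_eq_0)
  also have "\<dots> = poly (trinomial_poly u w j) (real r)"
    by (simp add: trinomial_poly_def poly_sum poly_falling_poly falling_eq_choose mult.commute)
  finally show ?thesis .
qed

lemma coeff_quadratic_power_eq_0:
  fixes a b v :: real
  assumes "k > 2 * r"
  shows "coeff ([:b, a, v:] ^ r) k = 0"
proof (rule coeff_eq_0)
  have "degree ([:b, a, v:] ^ r) \<le> degree [:b, a, v:] * r" by (rule degree_power_le)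
  also have "\<dots> \<le> 2 * r" by (intro mult_right_mono) auto
  finally show "degree ([:b, a, v:] ^ r) < k" using assms by simp
qed

text \<open>Reversing the order of the coefficients commutes with taking powers. The reversal is
  taken with respect to the formal degree \<open>2 * r\<close>, so vanishing outer coefficients do
  no harm.\<close>

lemma coeff_quadratic_power:
  fixes a b v :: real
  shows "coeff ([:b, a, v:] ^ r) k = (if k \<le> 2 * r then coeff ([:v, a, b:] ^ r) (2 * r - k) else 0)"
proof -
  have "coeff ([:b, a, v:] ^ r) k = coeff ([:v, a, b:] ^ r) (2 * r - k)" if "k \<le> 2 * r"
    using that
  proof (induction r arbitrary: k)
    case (Suc r)
    have step: "coeff ([:x, y, z:] ^ Suc r) m = x * coeff ([:x, y, z:] ^ r) m
        + (if m \<ge> 1 then y * coeff ([:x, y, z:] ^ r) (m - 1) else 0)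
        + (if m \<ge> 2 then z * coeff ([:x, y, z:] ^ r) (m - 2) else 0)" for x y z :: real and m
      by (cases m; cases "m - 1") (auto simp: coeff_pCons)
    \<comment> \<open>Near both ends of the range some of the three terms of \<open>step\<close>
      refer to coefficients outside \<open>0..2 * r\<close> and vanish; these indices are treated
      one by one.\<close>
    consider "k = 0" | "k = 1" | "k \<ge> 2" "k < 2 * r" | "k \<ge> 2" "k = 2 * r" | "k \<ge> 2" "k = 2 * r + 1" | "k = 2 * r + 2"
      using Suc.prems by fastforce
    then show ?case
    proof cases
      case 1
      then show ?thesis unfolding step using Suc.IH[of 0] by (simp add: coeff_quadratic_power_eq_0)
    next
      case 2
      then show ?thesis unfolding step using Suc.IH[of 0] Suc.IH[of 1]
        by (cases "r = 0") (auto simp: coeff_quadratic_power_eq_0 numeral_2_eq_2)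
    next
      case 3
      moreover have "2 * Suc r - k - 1 = 2 * r - (k - 1)" "2 * Suc r - k - 2 = 2 * r - k"
        "2 * Suc r - k = 2 * r - (k - 2)" using 3 by auto
      ultimately show ?thesis unfolding step using Suc.IH[of k] Suc.IH[of "k - 1"] Suc.IH[of "k - 2"]
        by simp
    next
      case 4
      then show ?thesis unfolding step using Suc.IH[of "2 * r"] Suc.IH[of "2 * r - 1"] Suc.IH[of "2 * r - 2"]
        by (auto simp: numeral_2_eq_2)
    next
      case 5
      then show ?thesis unfolding step using Suc.IH[of "2 * r"] Suc.IH[of "2 * r - 1"]
        by (simp add: coeff_quadratic_power_eq_0)
    next
      case 6
      then show ?thesis unfolding step using Suc.IH[of "2 * r"]
        by (simp add: coeff_quadratic_power_eq_0)
    qed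
  qed simp
  with coeff_quadratic_power_eq_0[of r k b a v] show ?thesis by auto
qed

text \<open>A convolution counted from the top: a drop by \<open>i\<close> below the formal degree
  \<open>D + 2 * r\<close> splits into a drop by \<open>s\<close> in \<open>A\<close> and a drop by
  \<open>i - s\<close> in the power. The guards stand for the zero coefficients of negative
  degree.\<close>

lemma coeff_mult_quadratic_power:
  fixes A :: "real poly"
  assumes A: "degree A \<le> D"
  shows "(if i \<le> D + 2 * r then coeff (A * [:b, a, v:] ^ r) (D + 2 * r - i) else 0)
    = (\<Sum>s\<le>i. (if s \<le> D then coeff A (D - s) else 0) * coeff ([:v, a, b:] ^ r) (i - s))"
proof (cases "i \<le> D + 2 * r")
  case True
  let ?m = "D + 2 * r - i"
  let ?g = "\<lambda>t. coeff A t * coeff ([:b, a, v:] ^ r) (?m - t)"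
  have "coeff (A * [:b, a, v:] ^ r) ?m = (\<Sum>t\<le>?m. ?g t)"
    by (rule coeff_mult)
  also have "\<dots> = (\<Sum>t\<in>{t. t \<le> ?m \<and> t \<le> D \<and> D - t \<le> i}. ?g t)"
  proof (rule sum.mono_neutral_right)
    show "\<forall>t\<in>{..?m} - {t. t \<le> ?m \<and> t \<le> D \<and> D - t \<le> i}. ?g t = 0"
    proof
      fix t assume t: "t \<in> {..?m} - {t. t \<le> ?m \<and> t \<le> D \<and> D - t \<le> i}"
      show "?g t = 0"
      proof (cases "t \<le> D")
        case False
        then show ?thesis using A by (simp add: coeff_eq_0)
      next
        case t': True
        then have "?m - t > 2 * r" using t True by auto
        then show ?thesis by (simp add: coeff_quadratic_power)
      qed
    qed
  qed auto
  also have "\<dots> = (\<Sum>s\<in>{s. s \<le> i \<and> s \<le> D \<and> i - s \<le> 2 * r}. coeff A (D - s) * coeff ([:v, a, b:] ^ r) (i - s))"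
  proof (rule sum.reindex_bij_witness[of _ "\<lambda>s. D - s" "\<lambda>t. D - t"])
    fix t assume t: "t \<in> {t. t \<le> ?m \<and> t \<le> D \<and> D - t \<le> i}"
    then have "?m - t \<le> 2 * r" "2 * r - (?m - t) = i - (D - t)" using True by auto
    then show "coeff A (D - (D - t)) * coeff ([:v, a, b:] ^ r) (i - (D - t)) = ?g t"
      using t by (simp add: coeff_quadratic_power)
  qed (use True in auto)
  also have "\<dots> = (\<Sum>s\<le>i. (if s \<le> D then coeff A (D - s) else 0) * coeff ([:v, a, b:] ^ r) (i - s))"
  proof (rule sum.mono_neutral_cong_left)
    show "\<forall>s\<in>{..i} - {s. s \<le> i \<and> s \<le> D \<and> i - s \<le> 2 * r}.
        (if s \<le> D then coeff A (D - s) else 0) * coeff ([:v, a, b:] ^ r) (i - s) = 0"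
      using coeff_quadratic_power[of v a b r] by auto
  qed auto
  finally show ?thesis using True by simp
next
  case False
  have "(if s \<le> D then coeff A (D - s) else 0) * coeff ([:v, a, b:] ^ r) (i - s) = 0" for s
    using False by (auto simp: coeff_quadratic_power[of v a b r])
  with False show ?thesis by (simp only: if_False sum.neutral_const)
qed

subsection \<open>Dimension of a common kernel\<close>

text \<open>Every \<open>y\<close> in \<open>Y\<close> is a kernel element plus a multiple of
  \<open>v\<close>. The type of configurations is infinite-dimensional, so finiteness has to come
  from the spanning set \<open>T\<close>.\<close>

lemma dim_kernel:
  fixes Y :: "'a::real_vector set" and f :: "'a \<Rightarrow> real"
  assumes Y: "subspace Y" "Y \<subseteq> span T" "finite T" and f: "linear f" and v: "v \<in> Y" "f v \<noteq> 0"
  shows "dim {y \<in> Y. f y = 0} + 1 = dim Y"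
proof -
  let ?K = "{y \<in> Y. f y = 0}"
  have K: "subspace ?K"
    using Y(1) f unfolding subspace_def
    by (auto simp: linear_0 linear_add linear_scale)
  obtain B where B: "B \<subseteq> ?K" "independent B" "?K \<subseteq> span B" "card B = dim ?K"
    using basis_exists[of ?K] by blast
  have "finite B"
    using real_vector.independent_span_bound[OF Y(3) B(2)] B(1) Y(2) by auto
  have "span B \<subseteq> ?K"
    using span_minimal[OF B(1) K] .
  then have "v \<notin> span B" using v by auto
  then have ind: "independent (insert v B)" using B(2) by (simp add: independent_insert)
  have "Y \<subseteq> span (insert v B)"
  proof
    fix y assume "y \<in> Y"
    have "y - (f y / f v) *\<^sub>R v \<in> ?K"
      using \<open>y \<in> Y\<close> v Y(1) f by (auto simp: subspace_diff subspace_scale linear_diff linear_scale)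
    then show "y \<in> span (insert v B)"
      using B(3) by (auto simp: span_insert)
  qed
  moreover have "v \<notin> B" using B(1) v by auto
  ultimately have "dim Y = card (insert v B)"
    using real_vector.dim_unique[of "insert v B" Y] ind B(1) v by auto
  then show ?thesis using \<open>finite B\<close> \<open>v \<notin> B\<close> B(4) by simp
qed

text \<open>\<open>J\<close> is collected greedily: a form joins only if it does not vanish on the
  common kernel of the forms before it, and then it lowers the dimension by exactly one.\<close>

lemma dim_common_kernel:
  fixes X :: "'a::real_vector set" and f :: "'i \<Rightarrow> 'a \<Rightarrow> real"
  assumes X: "subspace X" "X \<subseteq> span T" "finite T" and I: "finite I" "\<And>i. i \<in> I \<Longrightarrow> linear (f i)"
  shows "\<exists>J\<subseteq>I. {x \<in> X. \<forall>i\<in>J. f i x = 0} = {x \<in> X. \<forall>i\<in>I. f i x = 0} \<and>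
    dim {x \<in> X. \<forall>i\<in>I. f i x = 0} + card J = dim X"
  using I
proof (induction I rule: finite_induct)
  case empty
  then show ?case by auto
next
  case (insert i I)
  then obtain J where J: "J \<subseteq> I" "{x \<in> X. \<forall>i\<in>J. f i x = 0} = {x \<in> X. \<forall>i\<in>I. f i x = 0}"
      "dim {x \<in> X. \<forall>i\<in>I. f i x = 0} + card J = dim X"
    by auto
  define Y where "Y = {x \<in> X. \<forall>i\<in>I. f i x = 0}"
  have ins: "{x \<in> X. \<forall>j\<in>insert i I. f j x = 0} = {y \<in> Y. f i y = 0}" by (auto simp: Y_def)
  show ?case
  proof (cases "\<forall>y\<in>Y. f i y = 0")
    case True
    then have "{y \<in> Y. f i y = 0} = Y" by auto
    then show ?thesis unfolding ins using J by (intro exI[of _ J]) (auto simp: Y_def)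
  next
    case False
    then obtain v where v: "v \<in> Y" "f i v \<noteq> 0" by auto
    have "subspace Y"
      using X(1) insert.prems unfolding Y_def subspace_def
      by (auto simp: linear_0 linear_add linear_scale)
    moreover have "Y \<subseteq> span T" using X(2) by (auto simp: Y_def)
    ultimately have "dim {y \<in> Y. f i y = 0} + 1 = dim Y"
      using dim_kernel[where Y = Y and T = T and f = "f i" and v = v] X(3) v insert.prems by auto
    moreover have "i \<notin> J" "finite J" using J(1) insert.hyps finite_subset by auto
    moreover have "{x \<in> X. \<forall>j\<in>insert i J. f j x = 0} = {y \<in> Y. f i y = 0}"
      using J(2) by (auto simp: Y_def)
    ultimately show ?thesis unfolding ins using J(1,3)
      by (intro exI[of _ "insert i J"]) (auto simp: Y_def)
  qed
qed


subsection \<open>Configurations and labels of move hyperplanes\<close>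

definition configs_on :: "nat set \<Rightarrow> config set" where
  "configs_on A = {z. \<forall>i. i \<notin> A \<longrightarrow> pos z i = 0}"

lemma config_space_eq: "config_space q = configs_on {1..q}"
  by (simp add: config_space_def configs_on_def)

definition config_of :: "nat set \<Rightarrow> (nat \<Rightarrow> real \<times> real) \<Rightarrow> config" where
  "config_of A f = (\<Sum>i\<in>A. Poly_Mapping.single i (f i))"

lemma pos_config_of: "finite A \<Longrightarrow> pos (config_of A f) i = (if i \<in> A then f i else 0)"
  unfolding config_of_def lookup_sum by (simp add: lookup_single when_def sum.delta)

lemma config_of_in [simp]: "finite A \<Longrightarrow> config_of A f \<in> configs_on A"
  by (simp add: configs_on_def pos_config_of)

lemma pos_scaleR: "pos (r *\<^sub>R z) i = r *\<^sub>R pos z i"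
proof -
  have "finite {i. r *\<^sub>R pos z i \<noteq> 0}"
    using finite_lookup[of z] by (rule finite_subset[rotated]) auto
  then show ?thesis unfolding scaleR_poly_mapping_def by (simp add: Abs_poly_mapping_inverse)
qed

lemma subspace_configs_on: "subspace (configs_on A)"
  by (auto simp: subspace_def configs_on_def lookup_add pos_scaleR)

lemma linear_pos: "linear (\<lambda>z. pos z i \<bullet> w)"
  by (rule linearI) (auto simp: lookup_add pos_scaleR inner_add_left)

definition unit_configs :: "nat set \<Rightarrow> config set" where
  "unit_configs A = (\<lambda>(i, b). Poly_Mapping.single i b) ` (A \<times> {(1, 0), (0, 1)})"

lemma finite_unit_configs: "finite A \<Longrightarrow> finite (unit_configs A)"
  by (simp add: unit_configs_def)

lemma single_scaleR: "Poly_Mapping.single i (r *\<^sub>R b) = r *\<^sub>R (Poly_Mapping.single i b :: config)"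
  by (rule poly_mapping_eqI) (simp add: pos_scaleR lookup_single when_def)

lemma configs_on_span:
  assumes "finite A" shows "configs_on A \<subseteq> span (unit_configs A)"
proof
  fix z assume z: "z \<in> configs_on A"
  have "z = config_of A (pos z)"
    using z assms by (intro poly_mapping_eqI) (auto simp: pos_config_of configs_on_def)
  also have "\<dots> \<in> span (unit_configs A)"
    unfolding config_of_def
  proof (rule span_sum)
    fix i assume "i \<in> A"
    have "Poly_Mapping.single i (pos z i) = fst (pos z i) *\<^sub>R Poly_Mapping.single i (1, 0)
        + snd (pos z i) *\<^sub>R (Poly_Mapping.single i (0, 1) :: config)"
      unfolding single_scaleR[symmetric] single_add[symmetric] by simp
    also have "\<dots> \<in> span (unit_configs A)"
      using \<open>i \<in> A\<close> by (intro span_add span_scale span_base) (auto simp: unit_configs_def)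
    finally show "Poly_Mapping.single i (pos z i) \<in> span (unit_configs A)" .
  qed
  finally show "z \<in> span (unit_configs A)" .
qed

lemma dim_configs_on: "finite A \<Longrightarrow> dim (configs_on A) = 2 * card A"
proof (induction A rule: finite_induct)
  case empty
  have "configs_on {} = {0}"
    by (auto simp: configs_on_def intro: poly_mapping_eqI)
  then show ?case using real_vector.dim_eq_card_independent[of "{}"] by (metis card.empty
        real_vector.dim_span real_vector.independent_empty real_vector.span_empty mult_0_right)
next
  case (insert i A)
  let ?X = "configs_on (insert i A)"
  let ?Y = "{z \<in> ?X. pos z i \<bullet> (1, 0) = 0}"
  have sp: "?X \<subseteq> span (unit_configs (insert i A))" "finite (unit_configs (insert i A))"
    using insert.hyps configs_on_span[of "insert i A"] finite_unit_configs by auto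
  have "dim ?Y + 1 = dim ?X"
    by (rule dim_kernel[OF subspace_configs_on sp linear_pos, where v = "Poly_Mapping.single i (1, 0)"])
      (auto simp: configs_on_def lookup_single when_def)
  moreover have "dim {z \<in> ?Y. pos z i \<bullet> (0, 1) = 0} + 1 = dim ?Y"
  proof (rule dim_kernel[OF _ _ sp(2) linear_pos, where v = "Poly_Mapping.single i (0, 1)"])
    show "subspace ?Y"
      by (auto simp: subspace_def configs_on_def lookup_add pos_scaleR inner_add_left)
    show "?Y \<subseteq> span (unit_configs (insert i A))" using sp(1) by auto
  qed (auto simp: configs_on_def lookup_single when_def)
  moreover have "{z \<in> ?Y. pos z i \<bullet> (0, 1) = 0} = configs_on A"
    using insert.hyps by (auto simp: configs_on_def prod_eq_iff inner_prod_def)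
  ultimately show ?case using insert by simp
qed

text \<open>
  The label \<open>(m, {i, j})\<close> stands for the hyperplane of the move \<open>m\<close> and the pieces \<open>i\<close>, \<open>j\<close>. Its
  equation is symmetric in \<open>i\<close> and \<open>j\<close>, and it makes sense in the ambient space of any number of pieces.
\<close>

type_synonym label = "(int \<times> int) \<times> nat set"

definition labels :: "(int \<times> int) set \<Rightarrow> nat set \<Rightarrow> label set" where
  "labels M A = {(m, e). m \<in> M \<and> e \<subseteq> A \<and> card e = 2}"

definition sat :: "config \<Rightarrow> label \<Rightarrow> bool" where
  "sat z l \<longleftrightarrow> (\<forall>i\<in>snd l. \<forall>j\<in>snd l. (pos z j - pos z i) \<bullet> perp (fst l) = 0)"

definition solutions :: "label set \<Rightarrow> config set" where
  "solutions F = {z. \<forall>l\<in>F. sat z l}"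

definition touched :: "label set \<Rightarrow> nat set" where
  "touched F = \<Union> (snd ` F)"

lemma finite_labels: "finite M \<Longrightarrow> finite A \<Longrightarrow> finite (labels M A)"
  by (rule finite_subset[of _ "M \<times> Pow A"]) (auto simp: labels_def)

lemma touched_labels:
  assumes "F \<subseteq> labels M A"
  shows "touched F \<subseteq> A"
proof
  fix i assume "i \<in> touched F"
  then obtain l where "l \<in> F" "i \<in> snd l" by (auto simp: touched_def)
  with assms show "i \<in> A" by (cases l) (auto simp: labels_def)
qed

lemma labels_touched:
  assumes "F \<subseteq> labels M A" "touched F \<subseteq> B"
  shows "F \<subseteq> labels M B"
proof
  fix l assume l: "l \<in> F"
  then have "snd l \<subseteq> B" using assms(2) by (auto simp: touched_def)
  with l assms(1) show "l \<in> labels M B" by (cases l) (auto simp: labels_def)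
qed

lemma finite_touched:
  assumes "F \<subseteq> labels M A" "finite F"
  shows "finite (touched F)"
proof -
  have "finite (snd l)" if "l \<in> F" for l
  proof -
    have "card (snd l) = 2" using that assms(1) by (auto simp: labels_def)
    then show ?thesis using card.infinite by fastforce
  qed
  with assms(2) show ?thesis unfolding touched_def by blast
qed

lemma touched_mono: "F \<subseteq> G \<Longrightarrow> touched F \<subseteq> touched G"
  by (auto simp: touched_def)

lemma solutions_mono: "F \<subseteq> G \<Longrightarrow> solutions G \<subseteq> solutions F"
  by (auto simp: solutions_def)

lemma sat_doubleton: "sat z (m, {i, j}) \<longleftrightarrow> (pos z j - pos z i) \<bullet> perp m = 0"
  by (auto simp: sat_def inner_diff_left)

lemma sat_cong: "(\<And>i. i \<in> snd l \<Longrightarrow> pos z i = pos z' i) \<Longrightarrow> sat z l \<longleftrightarrow> sat z' l"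
  by (simp add: sat_def)

lemma solutions_cong:
  "(\<And>i. i \<in> touched F \<Longrightarrow> pos z i = pos z' i) \<Longrightarrow> z \<in> solutions F \<longleftrightarrow> z' \<in> solutions F"
proof -
  assume *: "\<And>i. i \<in> touched F \<Longrightarrow> pos z i = pos z' i"
  have "sat z l \<longleftrightarrow> sat z' l" if "l \<in> F" for l
    using that by (intro sat_cong *) (auto simp: touched_def)
  then show ?thesis by (simp add: solutions_def)
qed

text \<open>A label sees only its own two pieces, so cutting a configuration off outside
  \<open>A\<close> changes nothing. Comparisons of lattice elements thus become comparisons of label
  sets without an ambient space.\<close>

lemma solutions_subset_iff:
  assumes "finite A" "touched F \<subseteq> A" "touched G \<subseteq> A"
  shows "configs_on A \<inter> solutions F \<subseteq> solutions G \<longleftrightarrow> solutions F \<subseteq> solutions G"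
proof
  assume *: "configs_on A \<inter> solutions F \<subseteq> solutions G"
  show "solutions F \<subseteq> solutions G"
  proof
    fix z assume z: "z \<in> solutions F"
    let ?z = "config_of A (pos z)"
    have eq: "pos ?z i = pos z i" if "i \<in> A" for i using that assms(1) by (simp add: pos_config_of)
    have "?z \<in> solutions F" using z solutions_cong[of F ?z z] eq assms(2) by auto
    then have "?z \<in> solutions G" using * assms(1) by auto
    then show "z \<in> solutions G" using solutions_cong[of G ?z z] eq assms(3) by auto
  qed
qed auto

lemma solutions_eq_iff:
  assumes "finite A" "touched F \<subseteq> A" "touched G \<subseteq> A"
  shows "configs_on A \<inter> solutions F = configs_on A \<inter> solutions G \<longleftrightarrow> solutions F = solutions G"
proof
  assume *: "configs_on A \<inter> solutions F = configs_on A \<inter> solutions G"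
  then have "configs_on A \<inter> solutions F \<subseteq> solutions G" "configs_on A \<inter> solutions G \<subseteq> solutions F"
    by auto
  then show "solutions F = solutions G"
    using solutions_subset_iff[OF assms] solutions_subset_iff[OF assms(1,3,2)] by auto
qed auto

text \<open>\<open>Max\<close> and \<open>Min\<close> merely order the two pieces, so that each
  label has one linear form; the choice affects only the sign.\<close>

definition label_form :: "label \<Rightarrow> config \<Rightarrow> real" where
  "label_form l z = (pos z (Max (snd l)) - pos z (Min (snd l))) \<bullet> perp (fst l)"

lemma label_form_eq_0:
  assumes "l \<in> labels M A" shows "label_form l z = 0 \<longleftrightarrow> sat z l"
proof -
  obtain m i j where l: "l = (m, {i, j})" "i < j"
    using assms by (auto simp: labels_def card_2_iff) (metis insert_commute linorder_neqE_nat)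
  then show ?thesis by (simp add: label_form_def sat_doubleton)
qed

lemma linear_label_form: "linear (label_form l)"
  unfolding label_form_def
  by (rule linearI) (auto simp: lookup_add pos_scaleR inner_add_left inner_diff_left algebra_simps)

text \<open>\<open>G\<close> is a maximal independent subfamily of the linear forms, so its size is
  the codimension. Choosing it inside \<open>F\<close> yields generating sets of minimal
  size.\<close>

lemma solutions_rank:
  assumes F: "F \<subseteq> labels M A" "finite F" and A: "finite A"
  shows "\<exists>G\<subseteq>F. solutions G = solutions F \<and> dim (configs_on A \<inter> solutions F) + card G = 2 * card A"
proof -
  obtain G where G: "G \<subseteq> F"
    "{x \<in> configs_on A. \<forall>l\<in>G. label_form l x = 0} = {x \<in> configs_on A. \<forall>l\<in>F. label_form l x = 0}"
    "dim {x \<in> configs_on A. \<forall>l\<in>F. label_form l x = 0} + card G = dim (configs_on A)"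
    using dim_common_kernel[OF subspace_configs_on configs_on_span[OF A] finite_unit_configs[OF A] F(2),
        of label_form] linear_label_form by auto
  have *: "{x \<in> configs_on A. \<forall>l\<in>H. label_form l x = 0} = configs_on A \<inter> solutions H" if "H \<subseteq> F" for H
    using label_form_eq_0[of _ M A] that F(1) unfolding solutions_def by blast
  have "solutions G = solutions F"
    using G(2) unfolding *[OF G(1)] *[OF order_refl]
    using solutions_eq_iff[OF A, of G F] touched_labels[OF F(1)] touched_mono[OF G(1)] by auto
  then show ?thesis using G(1,3) unfolding *[OF order_refl] dim_configs_on[OF A] by auto
qed

text \<open>If \<open>F\<close> does not touch the piece \<open>i\<close>, then displacing only
  \<open>i\<close> by \<open>perp m\<close> respects all of \<open>F\<close> but violates the label,
  since \<open>perp m\<close> is not orthogonal to itself.\<close>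

lemma touched_of_implied:
  assumes "solutions F \<subseteq> solutions {(m, e)}" "card e = 2" "m \<noteq> (0, 0)"
  shows "e \<subseteq> touched F"
proof
  fix i assume i: "i \<in> e"
  show "i \<in> touched F"
  proof (rule ccontr)
    assume n: "i \<notin> touched F"
    obtain j where j: "e = {i, j}" "i \<noteq> j"
      using i assms(2) by (auto simp: card_2_iff)
    let ?z = "Poly_Mapping.single i (perp m)"
    have "?z \<in> solutions F"
      using n by (auto simp: solutions_def sat_def lookup_single when_def touched_def)
    with assms(1) have "sat ?z (m, {i, j})" by (auto simp: solutions_def j)
    then have "perp m \<bullet> perp m = 0"
      using j(2) by (simp add: sat_doubleton lookup_single)
    then show False using assms(3) by (cases m) (auto simp: perp_def zero_prod_def)
  qed
qed

text \<open>Hence the involved pieces can be read off from any label set that cuts out the subspace,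
  in particular from one of minimal size.\<close>

lemma touched_eq:
  assumes "solutions F = solutions G" "F \<subseteq> labels M A" "G \<subseteq> labels M A" "(0, 0) \<notin> M"
  shows "touched F = touched G"
proof -
  have "touched G \<subseteq> touched F" if "solutions F = solutions G" "G \<subseteq> labels M A" for F G
  proof
    fix i assume "i \<in> touched G"
    then obtain m e where l: "(m, e) \<in> G" "i \<in> e" by (auto simp: touched_def)
    then have "solutions F \<subseteq> solutions {(m, e)}" unfolding that(1) by (intro solutions_mono) auto
    moreover have "card e = 2" "m \<noteq> (0, 0)" using l(1) that(2) assms(4) by (auto simp: labels_def)
    ultimately show "i \<in> touched F" using touched_of_implied l(2) by blast
  qed
  with assms show ?thesis by blast
qed

lemma card_touched_le:
  assumes "F \<subseteq> labels M A" "finite F"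
  shows "card (touched F) \<le> 2 * card F"
proof -
  have "card (touched F) \<le> (\<Sum>l\<in>F. card (snd l))"
    unfolding touched_def by (rule card_UN_le[OF assms(2)])
  also have "\<dots> = (\<Sum>l\<in>F. 2)" using assms(1) by (intro sum.cong) (auto simp: labels_def)
  finally show ?thesis by simp
qed

text \<open>Two labels with the same pair and different moves are excluded as well, since their
  pairs intersect.\<close>

definition matching :: "label set \<Rightarrow> bool" where
  "matching F \<longleftrightarrow> (\<forall>l\<in>F. \<forall>l'\<in>F. l \<noteq> l' \<longrightarrow> snd l \<inter> snd l' = {})"

text \<open>Two labels with a common piece touch at most three pieces together, one less than is
  needed for equality in \<open>card_touched_le\<close>.\<close>

lemma matching_of_card:
  assumes "F \<subseteq> labels M A" "finite F" "card (touched F) = 2 * card F"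
  shows "matching F"
  unfolding matching_def
proof (intro ballI impI, rule ccontr)
  fix l l' assume l: "l \<in> F" "l' \<in> F" "l \<noteq> l'" "snd l \<inter> snd l' \<noteq> {}"
  have c: "card (snd l) = 2" "card (snd l') = 2" using l assms(1) by (auto simp: labels_def)
  then have f: "finite (snd l)" "finite (snd l')" using card.infinite by fastforce+
  have "card (snd l \<union> snd l') + card (snd l \<inter> snd l') = 4"
    using card_Un_Int[OF f] c by simp
  moreover have "card (snd l \<inter> snd l') > 0" using l(4) f by (simp add: card_gt_0_iff)
  ultimately have u: "card (snd l \<union> snd l') \<le> 3" by simp
  have "touched F = (snd l \<union> snd l') \<union> touched (F - {l, l'})"
    using l by (auto simp: touched_def)
  then have "card (touched F) \<le> 3 + card (touched (F - {l, l'}))"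
    using card_Un_le[of "snd l \<union> snd l'" "touched (F - {l, l'})"] u by simp
  also have "card (touched (F - {l, l'})) \<le> 2 * card (F - {l, l'})"
    using assms by (intro card_touched_le[of _ M A]) auto
  also have "card (F - {l, l'}) = card F - 2"
    using l assms(2) by (subst card_Diff_subset) auto
  finally have "card (touched F) \<le> 3 + 2 * (card F - 2)" by simp
  moreover have "card F \<ge> 2"
    using card_mono[OF assms(2), of "{l, l'}"] l by simp
  ultimately show False using assms(3) by linarith
qed

text \<open>Two test configurations that satisfy \<open>F\<close> do the work: one shows that the
  implied label has the pair of a label in \<open>F\<close>, the other that it has the same
  move.\<close>

lemma matching_closed:
  assumes M: "basic_moves M" and F: "F \<subseteq> labels M A" "finite F" "matching F"
    and l: "(m, e) \<in> labels M A" "solutions F \<subseteq> solutions {(m, e)}"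
  shows "(m, e) \<in> F"
proof -
  have m: "m \<in> M" "card e = 2" using l(1) by (auto simp: labels_def)
  have m0: "m \<noteq> (0, 0)" using M m(1) by (auto simp: basic_moves_def)
  have "e \<subseteq> touched F" using touched_of_implied[OF l(2) m(2) m0] .
  obtain i j where e: "e = {i, j}" "i \<noteq> j" using m(2) by (auto simp: card_2_iff)
  obtain m1 e1 where l1: "(m1, e1) \<in> F" "i \<in> e1"
    using \<open>e \<subseteq> touched F\<close> e by (auto simp: touched_def)
  have "m1 \<in> M" "card e1 = 2" using l1 F(1) by (auto simp: labels_def)
  then have "finite e1" using card.infinite by fastforce
  have disj: "snd l \<inter> e1 = {}" if "l \<in> F" "l \<noteq> (m1, e1)" for l
    using F(3) l1(1) that by (force simp: matching_def)
  have "j \<in> e1"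
  proof (rule ccontr)
    assume "j \<notin> e1"
    \<comment> \<open>Both pieces of \<open>e1\<close> are displaced by the same vector, so every
      label of \<open>F\<close> still holds; the label \<open>(m, {i, j})\<close> sees only the
      displacement of \<open>i\<close>.\<close>
    let ?z = "config_of e1 (\<lambda>_. perp m)"
    have "sat ?z l" if "l \<in> F" for l
    proof (cases "l = (m1, e1)")
      case True
      then show ?thesis using \<open>finite e1\<close> by (simp add: sat_def pos_config_of)
    next
      case False
      then show ?thesis using disj[OF that False] \<open>finite e1\<close>
        by (auto simp: sat_def pos_config_of disjoint_iff)
    qed
    then have "?z \<in> solutions F" by (simp add: solutions_def)
    then have "sat ?z (m, {i, j})" using l(2) e by (auto simp: solutions_def)
    then have "perp m \<bullet> perp m = 0"
      using \<open>j \<notin> e1\<close> l1(2) \<open>finite e1\<close> by (simp add: sat_doubleton pos_config_of)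
    then show False using m0 by (cases m) (auto simp: perp_def zero_prod_def)
  qed
  then have "e \<subseteq> e1" using e l1 by auto
  then have "e = e1" using \<open>card e1 = 2\<close> m(2) \<open>finite e1\<close> by (simp add: card_subset_eq)
  have "m = m1"
  proof (rule ccontr)
    assume "m \<noteq> m1"
    \<comment> \<open>Displacing \<open>i\<close> along the move \<open>m1\<close> keeps
      \<open>(m1, e1)\<close>, but breaks \<open>(m, e)\<close> because different moves are not
      parallel.\<close>
    let ?w = "(real_of_int (fst m1), real_of_int (snd m1))"
    let ?z = "Poly_Mapping.single i ?w"
    have "sat ?z l" if "l \<in> F" for l
    proof (cases "l = (m1, e1)")
      case True
      then show ?thesis using e(2) unfolding True \<open>e = e1\<close>[symmetric] e(1)
        by (simp add: sat_doubleton lookup_single perp_def)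
    next
      case False
      then show ?thesis using disj[OF that False] l1(2)
        by (auto simp: sat_def lookup_single when_def disjoint_iff)
    qed
    then have "?z \<in> solutions F" by (simp add: solutions_def)
    then have "sat ?z (m, {i, j})" using l(2) e by (auto simp: solutions_def)
    then have "fst m1 * snd m - snd m1 * fst m = 0"
      using e(2) by (simp add: sat_doubleton lookup_single perp_def flip: of_int_mult)
    moreover have "fst m1 * snd m - snd m1 * fst m \<noteq> 0"
      using M m(1) \<open>m1 \<in> M\<close> \<open>m \<noteq> m1\<close> unfolding basic_moves_def
      by (cases m; cases m1) auto
    ultimately show False by simp
  qed
  with l1 \<open>e = e1\<close> show ?thesis by simp
qed

text \<open>\<open>G\<close> lies in \<open>F\<close> by closedness. Conversely \<open>G\<close>
  touches every piece of \<open>F\<close>, and in a matching only one label touches a given piece.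
  So the Whitney sum of a matching has a single term.\<close>

lemma matching_unique:
  assumes M: "basic_moves M" and F: "F \<subseteq> labels M A" "finite F" "matching F"
    and G: "G \<subseteq> labels M A" "solutions G = solutions F"
  shows "G = F"
proof
  show GF: "G \<subseteq> F"
  proof
    fix l assume l: "l \<in> G"
    obtain m e where "l = (m, e)" by (cases l)
    moreover have "solutions F \<subseteq> solutions {l}" unfolding G(2)[symmetric] using l by (intro solutions_mono) auto
    ultimately show "l \<in> F" using matching_closed[OF M F, of m e] l G(1) by auto
  qed
  show "F \<subseteq> G"
  proof
    fix l assume l: "l \<in> F"
    have "(0, 0) \<notin> M" using M by (auto simp: basic_moves_def)
    then have "touched G = touched F" using touched_eq[OF G(2) G(1) F(1)] by simp
    moreover obtain i where i: "i \<in> snd l" using l F(1) by (force simp: labels_def card_2_iff)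
    ultimately obtain l' where "l' \<in> G" "i \<in> snd l'" using l unfolding touched_def by blast
    moreover have "l' = l" using F(3) l i calculation GF unfolding matching_def by blast
    ultimately show "l \<in> G" by simp
  qed
qed

subsection \<open>Relabelling the pieces\<close>

definition relabel :: "(nat \<Rightarrow> nat) \<Rightarrow> label \<Rightarrow> label" where
  "relabel \<sigma> l = (fst l, \<sigma> ` snd l)"

lemma touched_relabel: "touched (relabel \<sigma> ` F) = \<sigma> ` touched F"
  by (auto simp: touched_def relabel_def)

lemma inj_on_relabel:
  assumes "inj_on \<sigma> A"
  shows "inj_on (relabel \<sigma>) {l. snd l \<subseteq> A}"
proof (rule inj_onI)
  fix l l' assume "l \<in> {l. snd l \<subseteq> A}" "l' \<in> {l. snd l \<subseteq> A}" "relabel \<sigma> l = relabel \<sigma> l'"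
  then show "l = l'"
    using inj_on_image_eq_iff[OF assms, of "snd l" "snd l'"] by (simp add: relabel_def prod_eq_iff)
qed

lemma inj_on_relabel_labels:
  assumes "inj_on \<sigma> (touched F)"
  shows "inj_on (relabel \<sigma>) F"
  by (rule inj_on_subset[OF inj_on_relabel[OF assms]]) (auto simp: touched_def)

lemma relabel_labels:
  assumes "F \<subseteq> labels M A" "inj_on \<sigma> (touched F)" "\<sigma> ` touched F \<subseteq> B"
  shows "relabel \<sigma> ` F \<subseteq> labels M B"
proof
  fix l' assume "l' \<in> relabel \<sigma> ` F"
  then obtain m e where l: "(m, e) \<in> F" "l' = (m, \<sigma> ` e)" by (auto simp: relabel_def)
  have "e \<subseteq> touched F" using l(1) by (force simp: touched_def)
  then have "card (\<sigma> ` e) = card e" "\<sigma> ` e \<subseteq> B"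
    using assms(2,3) by (auto intro!: card_image dest: inj_on_subset)
  then show "l' \<in> labels M B" using l assms(1) by (auto simp: labels_def)
qed

lemma relabel_cong:
  "(\<And>i. i \<in> touched F \<Longrightarrow> \<sigma> i = \<tau> i) \<Longrightarrow> relabel \<sigma> ` F = relabel \<tau> ` F"
  by (intro image_cong refl) (auto simp: relabel_def touched_def intro!: image_cong)

lemma relabel_relabel: "relabel \<sigma> ` relabel \<tau> ` F = relabel (\<sigma> \<circ> \<tau>) ` F"
  by (simp add: image_image relabel_def image_comp)

lemma relabel_id: "relabel id ` F = F" "relabel (\<lambda>x. x) ` F = F"
  by (auto simp: relabel_def)

lemma sat_relabel:
  assumes "\<And>i. i \<in> snd l \<Longrightarrow> pos z' i = pos z (\<sigma> i)"
  shows "sat z' l \<longleftrightarrow> sat z (relabel \<sigma> l)"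
  using assms by (simp add: sat_def relabel_def)

lemma solutions_relabel:
  assumes "\<And>i. i \<in> touched F \<Longrightarrow> pos z' i = pos z (\<sigma> i)"
  shows "z' \<in> solutions F \<longleftrightarrow> z \<in> solutions (relabel \<sigma> ` F)"
proof -
  have "sat z' l \<longleftrightarrow> sat z (relabel \<sigma> l)" if "l \<in> F" for l
    using that by (intro sat_relabel assms) (auto simp: touched_def)
  then show ?thesis by (simp add: solutions_def)
qed

text \<open>Pulling a configuration back along the renaming turns the relabelled labels into the
  original ones.\<close>

lemma solutions_relabel_mono:
  assumes A: "finite A" "touched F \<subseteq> A" "touched G \<subseteq> A"
    and "solutions F \<subseteq> solutions G"
  shows "solutions (relabel \<sigma> ` F) \<subseteq> solutions (relabel \<sigma> ` G)"
proof
  fix z assume z: "z \<in> solutions (relabel \<sigma> ` F)"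
  let ?z = "config_of A (\<lambda>i. pos z (\<sigma> i))"
  have "pos ?z i = pos z (\<sigma> i)" if "i \<in> A" for i using that A(1) by (simp add: pos_config_of)
  with z A assms(4) show "z \<in> solutions (relabel \<sigma> ` G)"
    using solutions_relabel[of F ?z z \<sigma>] solutions_relabel[of G ?z z \<sigma>] by blast
qed

lemma solutions_relabel_subset_iff:
  assumes A: "finite A" "touched F \<subseteq> A" "touched G \<subseteq> A" and \<sigma>: "inj_on \<sigma> A"
  shows "solutions (relabel \<sigma> ` F) \<subseteq> solutions (relabel \<sigma> ` G) \<longleftrightarrow> solutions F \<subseteq> solutions G"
proof
  let ?\<tau> = "inv_into A \<sigma>"
  have "relabel ?\<tau> ` relabel \<sigma> ` H = H" if "touched H \<subseteq> A" for H
  proof -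
    have "relabel (?\<tau> \<circ> \<sigma>) ` H = relabel id ` H"
      using that \<sigma> by (intro relabel_cong) auto
    then show ?thesis by (simp add: relabel_relabel relabel_id)
  qed
  moreover assume "solutions (relabel \<sigma> ` F) \<subseteq> solutions (relabel \<sigma> ` G)"
  then have "solutions (relabel ?\<tau> ` relabel \<sigma> ` F) \<subseteq> solutions (relabel ?\<tau> ` relabel \<sigma> ` G)"
    by (rule solutions_relabel_mono[of "\<sigma> ` A", rotated -1])
      (simp_all only: touched_relabel finite_imageI image_mono A)
  ultimately show "solutions F \<subseteq> solutions G" using A by simp
qed (rule solutions_relabel_mono[OF A])

lemma solutions_relabel_eq_iff:
  assumes A: "finite A" "touched F \<subseteq> A" "touched G \<subseteq> A" and \<sigma>: "inj_on \<sigma> A"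
  shows "solutions (relabel \<sigma> ` F) = solutions (relabel \<sigma> ` G) \<longleftrightarrow> solutions F = solutions G"
  using solutions_relabel_subset_iff[OF A \<sigma>] solutions_relabel_subset_iff[OF A(1,3,2) \<sigma>] by auto


subsection \<open>Lattice elements and their closed label sets\<close>

text \<open>The flat of \<open>U\<close>: for a lattice element, the largest label set that cuts it
  out. Together with \<open>q\<close> it determines \<open>U\<close>, but its labels carry no
  reference to the ambient space.\<close>

definition implied :: "(int \<times> int) set \<Rightarrow> nat \<Rightarrow> config set \<Rightarrow> label set" where
  "implied M q U = {l \<in> labels M {1..q}. U \<subseteq> solutions {l}}"

lemma implied_labels: "implied M q U \<subseteq> labels M {1..q}"
  by (auto simp: implied_def)

lemma touched_implied: "touched (implied M q U) \<subseteq> {1..q}"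
  by (rule touched_labels[OF implied_labels])

lemma finite_implied: "finite M \<Longrightarrow> finite (implied M q U)"
  by (rule finite_subset[OF implied_labels]) (simp add: finite_labels)

lemma move_hyperplane_eq: "move_hyperplane q m i j = configs_on {1..q} \<inter> solutions {(m, {i, j})}"
  by (auto simp: move_hyperplane_def config_space_eq solutions_def sat_doubleton)

lemma move_hyperplanes_eq:
  "move_hyperplanes M q = (\<lambda>l. configs_on {1..q} \<inter> solutions {l}) ` labels M {1..q}"
proof (intro equalityI subsetI)
  fix H assume "H \<in> move_hyperplanes M q"
  then obtain m i j where "H = move_hyperplane q m i j" "m \<in> M" "1 \<le> i" "i < j" "j \<le> q"
    by (auto simp: move_hyperplanes_def)
  then show "H \<in> (\<lambda>l. configs_on {1..q} \<inter> solutions {l}) ` labels M {1..q}"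
    by (intro image_eqI[of _ _ "(m, {i, j})"]) (auto simp: move_hyperplane_eq labels_def)
next
  fix H assume "H \<in> (\<lambda>l. configs_on {1..q} \<inter> solutions {l}) ` labels M {1..q}"
  then obtain m e where H: "H = configs_on {1..q} \<inter> solutions {(m, e)}" "m \<in> M" "e \<subseteq> {1..q}" "card e = 2"
    by (auto simp: labels_def)
  obtain i j where ij: "e = {i, j}" "i < j"
    using H(4) by (auto simp: card_2_iff) (metis insert_commute linorder_neqE_nat)
  show "H \<in> move_hyperplanes M q"
    unfolding move_hyperplanes_def mem_Collect_eq
    using H ij by (intro exI[of _ m] exI[of _ i] exI[of _ j]) (auto simp: move_hyperplane_eq)
qed

lemma solutions_Inter: "configs_on A \<inter> solutions F = configs_on A \<inter> \<Inter>((\<lambda>l. configs_on A \<inter> solutions {l}) ` F)"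
  by (auto simp: solutions_def)

lemma intersection_lattice_eq:
  "intersection_lattice M q = (\<lambda>F. configs_on {1..q} \<inter> solutions F) ` Pow (labels M {1..q})"
proof -
  have "intersection_lattice M q = (\<lambda>S. configs_on {1..q} \<inter> \<Inter>S) ` Pow (move_hyperplanes M q)"
    by (auto simp: intersection_lattice_def config_space_eq)
  also have "\<dots> = (\<lambda>F. configs_on {1..q} \<inter> solutions F) ` Pow (labels M {1..q})"
    unfolding move_hyperplanes_eq image_Pow_surj[OF refl, symmetric] image_image solutions_Inter[symmetric] ..
  finally show ?thesis .
qed

lemma finite_intersection_lattice: "finite M \<Longrightarrow> finite (intersection_lattice M q)"
  unfolding intersection_lattice_eq by (simp add: finite_labels)

lemma lattice_elt_eq:
  assumes "U \<in> intersection_lattice M q"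
  shows "U = configs_on {1..q} \<inter> solutions (implied M q U)"
proof -
  obtain F where F: "F \<subseteq> labels M {1..q}" "U = configs_on {1..q} \<inter> solutions F"
    using assms by (auto simp: intersection_lattice_eq)
  then have "F \<subseteq> implied M q U" by (auto simp: implied_def solutions_def)
  then have "configs_on {1..q} \<inter> solutions (implied M q U) \<subseteq> U"
    using F(2) solutions_mono by blast
  moreover have "U \<subseteq> solutions (implied M q U)" by (auto simp: implied_def solutions_def)
  ultimately show ?thesis using F(2) by blast
qed

lemma implied_eq:
  assumes "F \<subseteq> labels M {1..q}"
  shows "implied M q (configs_on {1..q} \<inter> solutions F) = {l \<in> labels M {1..q}. solutions F \<subseteq> solutions {l}}"
proof -
  have "configs_on {1..q} \<inter> solutions F \<subseteq> solutions {l} \<longleftrightarrow> solutions F \<subseteq> solutions {l}"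
    if "l \<in> labels M {1..q}" for l
    using that assms touched_labels[OF assms] touched_labels[of "{l}" M "{1..q}"]
    by (intro solutions_subset_iff) auto
  then show ?thesis by (auto simp: implied_def)
qed

lemma implied_iff:
  assumes "U \<in> intersection_lattice M q"
  shows "l \<in> implied M q U \<longleftrightarrow> l \<in> labels M {1..q} \<and> solutions (implied M q U) \<subseteq> solutions {l}"
proof -
  have "implied M q U = {l \<in> labels M {1..q}. solutions (implied M q U) \<subseteq> solutions {l}}"
    by (subst (1) lattice_elt_eq[OF assms]) (rule implied_eq[OF implied_labels])
  then show ?thesis by auto
qed

lemma implied_doubleton:
  assumes "U \<subseteq> configs_on {1..q}" "i \<noteq> j"
  shows "(m, {i, j}) \<in> implied M q U \<longleftrightarrow>
    m \<in> M \<and> i \<in> {1..q} \<and> j \<in> {1..q} \<and> U \<subseteq> move_hyperplane q m i j"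
  using assms by (auto simp: implied_def labels_def move_hyperplane_eq)

lemma lattice_subset_space: "U \<in> intersection_lattice M q \<Longrightarrow> U \<subseteq> configs_on {1..q}"
  by (auto simp: intersection_lattice_eq)

lemma involved_eq:
  assumes "U \<subseteq> configs_on {1..q}"
  shows "involved M q U = touched (implied M q U)"
proof (intro equalityI subsetI)
  fix i assume "i \<in> involved M q U"
  then obtain j m where "i \<in> {1..q}" "j \<in> {1..q}" "m \<in> M" "j \<noteq> i" "U \<subseteq> move_hyperplane q m i j"
    by (auto simp: involved_def)
  then have "(m, {i, j}) \<in> implied M q U" by (simp add: implied_doubleton[OF assms])
  then show "i \<in> touched (implied M q U)" by (force simp: touched_def)
next
  fix i assume "i \<in> touched (implied M q U)"
  then obtain m e where l: "(m, e) \<in> implied M q U" "i \<in> e" by (auto simp: touched_def)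
  then have "card e = 2" by (auto simp: implied_def labels_def)
  then obtain j where "e = {i, j}" "i \<noteq> j" using l(2) by (auto simp: card_2_iff)
  then show "i \<in> involved M q U"
    using l implied_doubleton[OF assms, of i j m M] not_sym[OF \<open>i \<noteq> j\<close>] unfolding involved_def by blast
qed

text \<open>The conditions on all pairs of pieces become one equation between flats. That the
  renaming is onto the pieces of the other subspace is contained in this equation, by
  \<open>touched_relabel\<close>.\<close>

lemma same_type_iff:
  "((q, U), (q', U')) \<in> same_type M \<longleftrightarrow>
    (q, U) \<in> move_subspaces M \<and> (q', U') \<in> move_subspaces M \<and>
    (\<exists>\<sigma>. inj_on \<sigma> (touched (implied M q U)) \<and> relabel \<sigma> ` implied M q U = implied M q' U')"
proof (cases "(q, U) \<in> move_subspaces M \<and> (q', U') \<in> move_subspaces M")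
  case True
  then have U: "U \<subseteq> configs_on {1..q}" "U' \<subseteq> configs_on {1..q'}"
    using lattice_subset_space by (auto simp: move_subspaces_def)
  let ?C = "implied M q U" and ?C' = "implied M q' U'"
  have "bij_betw \<sigma> (touched ?C) (touched ?C') \<and>
        (\<forall>i\<in>touched ?C. \<forall>j\<in>touched ?C. i \<noteq> j \<longrightarrow>
           (\<forall>m\<in>M. U \<subseteq> move_hyperplane q m i j \<longleftrightarrow> U' \<subseteq> move_hyperplane q' m (\<sigma> i) (\<sigma> j)))
      \<longleftrightarrow> inj_on \<sigma> (touched ?C) \<and> relabel \<sigma> ` ?C = ?C'" for \<sigma>
  proof
    assume *: "bij_betw \<sigma> (touched ?C) (touched ?C') \<and>
        (\<forall>i\<in>touched ?C. \<forall>j\<in>touched ?C. i \<noteq> j \<longrightarrow>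
           (\<forall>m\<in>M. U \<subseteq> move_hyperplane q m i j \<longleftrightarrow> U' \<subseteq> move_hyperplane q' m (\<sigma> i) (\<sigma> j)))"
    then have inj: "inj_on \<sigma> (touched ?C)" and img: "\<sigma> ` touched ?C = touched ?C'"
      by (auto simp: bij_betw_def)
    have key: "(m, {i, j}) \<in> ?C \<longleftrightarrow> (m, {\<sigma> i, \<sigma> j}) \<in> ?C'"
      if "i \<in> touched ?C" "j \<in> touched ?C" "i \<noteq> j" for m i j
    proof -
      have "\<sigma> i \<noteq> \<sigma> j" using that inj by (auto simp: inj_on_def)
      moreover have "i \<in> {1..q}" "j \<in> {1..q}" "\<sigma> i \<in> {1..q'}" "\<sigma> j \<in> {1..q'}"
        using that img touched_implied[of M q U] touched_implied[of M q' U'] by blast+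
      ultimately show ?thesis
        using that * implied_doubleton[OF U(1)] implied_doubleton[OF U(2)] by metis
    qed
    have "relabel \<sigma> ` ?C \<subseteq> ?C'"
    proof
      fix l' assume "l' \<in> relabel \<sigma> ` ?C"
      then obtain m e where l: "(m, e) \<in> ?C" "l' = (m, \<sigma> ` e)" by (auto simp: relabel_def)
      then have "card e = 2" by (auto simp: implied_def labels_def)
      then obtain i j where e: "e = {i, j}" "i \<noteq> j" by (auto simp: card_2_iff)
      then have "i \<in> touched ?C" "j \<in> touched ?C" using l(1) by (force simp: touched_def)+
      then show "l' \<in> ?C'" using key e l by auto
    qed
    moreover have "?C' \<subseteq> relabel \<sigma> ` ?C"
    proof
      fix l' assume l': "l' \<in> ?C'"
      obtain m e where e0: "l' = (m, e)" by (cases l')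
      then have "card e = 2" using l' by (auto simp: implied_def labels_def)
      then obtain i j where e: "e = {i, j}" "i \<noteq> j" by (auto simp: card_2_iff)
      then have "i \<in> touched ?C'" "j \<in> touched ?C'" using l' e0 by (force simp: touched_def)+
      then have "i \<in> \<sigma> ` touched ?C" "j \<in> \<sigma> ` touched ?C" using img by auto
      then obtain i0 j0 where "i0 \<in> touched ?C" "j0 \<in> touched ?C" "\<sigma> i0 = i" "\<sigma> j0 = j"
        by auto
      moreover have "i0 \<noteq> j0" using calculation e(2) by auto
      ultimately have "(m, {i0, j0}) \<in> ?C" "relabel \<sigma> (m, {i0, j0}) = l'"
        using key[of i0 j0 m] l' e0 e(1) by (auto simp: relabel_def)
      then show "l' \<in> relabel \<sigma> ` ?C" by (metis imageI)
    qed
    ultimately show "inj_on \<sigma> (touched ?C) \<and> relabel \<sigma> ` ?C = ?C'" using inj by auto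
  next
    assume *: "inj_on \<sigma> (touched ?C) \<and> relabel \<sigma> ` ?C = ?C'"
    then have img: "\<sigma> ` touched ?C = touched ?C'" by (simp flip: touched_relabel)
    have "U \<subseteq> move_hyperplane q m i j \<longleftrightarrow> U' \<subseteq> move_hyperplane q' m (\<sigma> i) (\<sigma> j)"
      if "i \<in> touched ?C" "j \<in> touched ?C" "i \<noteq> j" "m \<in> M" for m i j
    proof -
      have ne: "\<sigma> i \<noteq> \<sigma> j" using that * by (auto simp: inj_on_def)
      have mem: "i \<in> {1..q}" "j \<in> {1..q}" "\<sigma> i \<in> {1..q'}" "\<sigma> j \<in> {1..q'}"
        using that img touched_implied[of M q U] touched_implied[of M q' U'] by blast+
      have "(m, {i, j}) \<in> ?C \<longleftrightarrow> (m, {\<sigma> i, \<sigma> j}) \<in> relabel \<sigma> ` ?C"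
      proof
        assume "(m, {i, j}) \<in> ?C"
        then show "(m, {\<sigma> i, \<sigma> j}) \<in> relabel \<sigma> ` ?C"
          by (intro image_eqI[of _ _ "(m, {i, j})"]) (auto simp: relabel_def)
      next
        assume "(m, {\<sigma> i, \<sigma> j}) \<in> relabel \<sigma> ` ?C"
        then obtain e where e: "(m, e) \<in> ?C" "\<sigma> ` e = \<sigma> ` {i, j}" by (auto simp: relabel_def)
        then have "e \<subseteq> touched ?C" by (force simp: touched_def)
        then have "e = {i, j}"
          using e(2) that * inj_on_image_eq_iff[of \<sigma> "touched ?C" e "{i, j}"] by auto
        with e show "(m, {i, j}) \<in> ?C" by simp
      qed
      then show ?thesis
        using * mem ne that implied_doubleton[OF U(1)] implied_doubleton[OF U(2)] by metis
    qed
    then show "bij_betw \<sigma> (touched ?C) (touched ?C') \<and>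
        (\<forall>i\<in>touched ?C. \<forall>j\<in>touched ?C. i \<noteq> j \<longrightarrow>
           (\<forall>m\<in>M. U \<subseteq> move_hyperplane q m i j \<longleftrightarrow> U' \<subseteq> move_hyperplane q' m (\<sigma> i) (\<sigma> j)))"
      using * img by (auto simp: bij_betw_def)
  qed
  then show ?thesis
    using True by (simp add: same_type_def involved_eq[OF U(1)] involved_eq[OF U(2)])
qed (auto simp: same_type_def)

lemma equiv_same_type: "equiv (move_subspaces M) (same_type M)"
proof (rule equivI)
  show "same_type M \<subseteq> move_subspaces M \<times> move_subspaces M"
    by (auto simp: same_type_def)
  show "refl_on (move_subspaces M) (same_type M)"
  proof (rule refl_onI)
    fix x assume x: "x \<in> move_subspaces M"
    obtain q U where "x = (q, U)" by (cases x)
    with x show "(x, x) \<in> same_type M"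
      by (simp add: same_type_iff) (metis inj_on_id relabel_id(1))
  qed
  show "sym (same_type M)"
  proof (rule symI)
    fix x y assume xy: "(x, y) \<in> same_type M"
    obtain q U q' U' where e: "x = (q, U)" "y = (q', U')" by (cases x, cases y)
    obtain \<sigma> where \<sigma>: "inj_on \<sigma> (touched (implied M q U))" "relabel \<sigma> ` implied M q U = implied M q' U'"
      using xy e by (auto simp: same_type_iff)
    let ?\<tau> = "inv_into (touched (implied M q U)) \<sigma>"
    have "relabel ?\<tau> ` relabel \<sigma> ` implied M q U = relabel id ` implied M q U"
      unfolding relabel_relabel using \<sigma>(1) by (intro relabel_cong) auto
    then have "relabel ?\<tau> ` implied M q' U' = implied M q U" by (simp add: \<sigma>(2) relabel_id)
    moreover have "inj_on ?\<tau> (touched (implied M q' U'))"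
      unfolding \<sigma>(2)[symmetric] touched_relabel by (rule inj_on_inv_into) simp
    ultimately show "(y, x) \<in> same_type M" using xy e by (auto simp: same_type_iff)
  qed
  show "trans (same_type M)"
  proof (rule transI)
    fix x y z assume xy: "(x, y) \<in> same_type M" "(y, z) \<in> same_type M"
    obtain q U q' U' q'' U'' where e: "x = (q, U)" "y = (q', U')" "z = (q'', U'')"
      by (cases x, cases y, cases z)
    obtain \<sigma> where \<sigma>: "inj_on \<sigma> (touched (implied M q U))" "relabel \<sigma> ` implied M q U = implied M q' U'"
      using xy e by (auto simp: same_type_iff)
    obtain \<tau> where \<tau>: "inj_on \<tau> (touched (implied M q' U'))" "relabel \<tau> ` implied M q' U' = implied M q'' U''"
      using xy e by (auto simp: same_type_iff)
    have "inj_on (\<tau> \<circ> \<sigma>) (touched (implied M q U))"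
      using \<sigma> \<tau>(1) by (intro comp_inj_on) (auto simp flip: touched_relabel)
    moreover have "relabel (\<tau> \<circ> \<sigma>) ` implied M q U = implied M q'' U''"
      by (simp flip: relabel_relabel add: \<sigma>(2) \<tau>(2))
    ultimately show "(x, z) \<in> same_type M" using xy e by (auto simp: same_type_iff)
  qed
qed

subsection \<open>The Moebius function\<close>

lemma sum_alternating_Pow:
  assumes "finite C"
  shows "(\<Sum>F\<in>Pow C. (-1) ^ card F) = (if C = {} then 1 else 0 :: int)"
proof -
  have "(\<Prod>x\<in>C. (-1) + (1::int)) = (\<Sum>F\<in>Pow C. (\<Prod>x\<in>F. -1) * (\<Prod>x\<in>C - F. 1))"
    by (rule prod_add[OF assms])
  also have "\<dots> = (\<Sum>F\<in>Pow C. (-1) ^ card F)"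
    by simp
  finally have "(\<Sum>F\<in>Pow C. (-1) ^ card F) = (0::int) ^ card C" by simp
  then show ?thesis using assms by (simp add: power_0_left)
qed

text \<open>
  Whitney's formula for the Moebius function, written with labels instead of hyperplanes. A subset
  of labels does not refer to the ambient space, so the value depends on the type only.
\<close>

definition whitney :: "label set \<Rightarrow> int" where
  "whitney C = (\<Sum>F | F \<subseteq> C \<and> solutions F = solutions C. (-1) ^ card F)"

text \<open>Makes the index set of Whitney's sum appear when label sets are grouped by the lattice
  element that they cut out.\<close>

lemma lattice_fiber:
  assumes "W \<in> intersection_lattice M q"
  shows "{F \<in> Pow (labels M {1..q}). configs_on {1..q} \<inter> solutions F = W}
    = {F. F \<subseteq> implied M q W \<and> solutions F = solutions (implied M q W)}"
proof -
  let ?C = "implied M q W"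
  have W: "W = configs_on {1..q} \<inter> solutions ?C" by (rule lattice_elt_eq[OF assms])
  have "configs_on {1..q} \<inter> solutions F = W \<longleftrightarrow> F \<subseteq> ?C \<and> solutions F = solutions ?C"
    if F: "F \<subseteq> labels M {1..q}" for F
  proof -
    have eq: "configs_on {1..q} \<inter> solutions F = configs_on {1..q} \<inter> solutions ?C \<longleftrightarrow> solutions F = solutions ?C"
      by (rule solutions_eq_iff[OF _ touched_labels[OF F] touched_implied]) simp
    have "F \<subseteq> ?C" if "configs_on {1..q} \<inter> solutions F = W"
      using that F by (auto simp: implied_def solutions_def)
    with eq W show ?thesis by metis
  qed
  moreover have "F \<subseteq> labels M {1..q}" if "F \<subseteq> ?C" for F
    using that implied_labels order_trans by metis
  ultimately show ?thesis by (intro Collect_cong) (metis PowD PowI)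
qed

lemma implied_antimono: "U \<subseteq> W \<Longrightarrow> implied M q W \<subseteq> implied M q U"
  by (auto simp: implied_def)

text \<open>Each subset of the flat of \<open>U\<close> cuts out exactly one lattice element
  containing \<open>U\<close>. So the Whitney sums add up to the alternating sum over all subsets of
  the flat, which cancels unless the flat is empty. This is the recursion that characterises the
  Moebius function.\<close>

lemma sum_whitney:
  assumes "finite M" "U \<in> intersection_lattice M q"
  shows "(\<Sum>W | W \<in> intersection_lattice M q \<and> U \<subseteq> W. whitney (implied M q W))
    = (if implied M q U = {} then 1 else 0)"
proof -
  let ?C = "implied M q U" and ?L = "{W \<in> intersection_lattice M q. U \<subseteq> W}"
  let ?g = "\<lambda>F. configs_on {1..q} \<inter> solutions F"
  have fin: "finite (Pow ?C)" "finite ?L"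
    using assms(1) finite_implied finite_intersection_lattice by auto
  have img: "?g ` Pow ?C \<subseteq> ?L"
  proof
    fix W assume "W \<in> ?g ` Pow ?C"
    then obtain F where F: "F \<subseteq> ?C" "W = ?g F" by auto
    then have "W \<in> intersection_lattice M q" using implied_labels[of M q U] unfolding intersection_lattice_eq by blast
    moreover have "U \<subseteq> W"
      using F solutions_mono[OF F(1)] lattice_elt_eq[OF assms(2)] by blast
    ultimately show "W \<in> ?L" by simp
  qed
  have "(\<Sum>W\<in>?L. whitney (implied M q W)) = (\<Sum>W\<in>?L. \<Sum>F | F \<in> Pow ?C \<and> ?g F = W. (-1) ^ card F)"
  proof (rule sum.cong[OF refl])
    fix W assume W: "W \<in> ?L"
    then have "{F \<in> Pow ?C. ?g F = W} = {F \<in> Pow (labels M {1..q}). ?g F = W}"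
      using lattice_fiber[of W M q] implied_antimono[of U W M q] implied_labels[of M q U] by blast
    then show "whitney (implied M q W) = (\<Sum>F | F \<in> Pow ?C \<and> ?g F = W. (-1) ^ card F)"
      using W lattice_fiber[of W M q] by (simp add: whitney_def)
  qed
  also have "\<dots> = (\<Sum>F\<in>Pow ?C. (-1) ^ card F)"
    by (rule sum.group[OF fin img])
  also have "\<dots> = (if ?C = {} then 1 else 0)"
    by (rule sum_alternating_Pow[OF finite_implied[OF assms(1)]])
  finally show ?thesis by simp
qed

lemma implied_empty_iff:
  assumes "(0, 0) \<notin> M" "U \<in> intersection_lattice M q"
  shows "implied M q U = {} \<longleftrightarrow> U = configs_on {1..q}"
proof
  assume "implied M q U = {}"
  then show "U = configs_on {1..q}"
    using lattice_elt_eq[OF assms(2)] by (simp add: solutions_def)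
next
  assume U: "U = configs_on {1..q}"
  show "implied M q U = {}"
  proof (rule ccontr)
    assume "implied M q U \<noteq> {}"
    then obtain m e where l: "(m, e) \<in> implied M q U" by auto
    then have me: "card e = 2" "m \<noteq> (0, 0)" "(m, e) \<in> labels M {1..q}"
      using assms(1) by (auto simp: implied_def labels_def)
    have "U = configs_on {1..q} \<inter> solutions {}" using U by (simp add: solutions_def)
    then have "solutions {} \<subseteq> solutions {(m, e)}"
      using l implied_eq[of "{}" M q] by auto
    then have "e \<subseteq> touched {}" using touched_of_implied me by blast
    with me show False by (auto simp: touched_def)
  qed
qed

text \<open>Both sides satisfy the same recursion; the induction is on the number of lattice
  elements that properly contain \<open>U\<close>.\<close>

lemma mu0_eq_whitney:
  assumes M: "finite M" "(0, 0) \<notin> M" and U: "U \<in> intersection_lattice M q"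
  shows "mu0 M q U = whitney (implied M q U)"
  using U
proof (induction "card {W \<in> intersection_lattice M q. U \<subset> W}" arbitrary: U rule: less_induct)
  case less
  let ?L = "intersection_lattice M q" and ?w = "\<lambda>W. whitney (implied M q W)"
  have fin: "finite ?L" by (rule finite_intersection_lattice[OF M(1)])
  have IH: "mu0 M q W = ?w W" if "W \<in> ?L" "U \<subset> W" for W
  proof (rule less.hyps)
    show "card {X \<in> ?L. W \<subset> X} < card {X \<in> ?L. U \<subset> X}"
      using that fin by (intro psubset_card_mono) auto
  qed fact
  have "(\<Sum>W | W \<in> ?L \<and> U \<subseteq> W. ?w W) = ?w U + (\<Sum>W | W \<in> ?L \<and> U \<subset> W. ?w W)"
  proof -
    have "{W \<in> ?L. U \<subseteq> W} = insert U {W \<in> ?L. U \<subset> W}" using less.prems by auto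
    then show ?thesis using fin by simp
  qed
  then have sum: "?w U + (\<Sum>W | W \<in> ?L \<and> U \<subset> W. ?w W) = (if U = configs_on {1..q} then 1 else 0)"
    using sum_whitney[OF M(1) less.prems] implied_empty_iff[OF M(2) less.prems] by simp
  have top: "W \<subseteq> configs_on {1..q}" if "W \<in> ?L" for W using lattice_subset_space[OF that] .
  show ?case
  proof (cases "U = configs_on {1..q}")
    case True
    then have "{W \<in> ?L. U \<subset> W} = {}" using top by auto
    then have "?w U = 1" using sum True by (simp only: sum.empty) simp
    then show ?thesis using True by (simp add: mu0_def config_space_eq moebius.simps)
  next
    case False
    then have "U \<subset> configs_on {1..q}" using top[OF less.prems] by auto
    then have "mu0 M q U = - (\<Sum>W | W \<in> ?L \<and> U \<subset> W \<and> W \<subseteq> configs_on {1..q}. moebius ?L (configs_on {1..q}) W)"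
      using fin False by (subst mu0_def, subst moebius.simps) (auto simp: config_space_eq)
    also have "{W. W \<in> ?L \<and> U \<subset> W \<and> W \<subseteq> configs_on {1..q}} = {W \<in> ?L. U \<subset> W}" using top by auto
    also have "(\<Sum>W\<in>{W \<in> ?L. U \<subset> W}. moebius ?L (configs_on {1..q}) W) = (\<Sum>W\<in>{W \<in> ?L. U \<subset> W}. ?w W)"
      using IH by (intro sum.cong) (auto simp: mu0_def config_space_eq)
    finally show ?thesis using sum False by simp
  qed
qed

lemma whitney_relabel:
  assumes "finite (touched C)" "inj_on \<sigma> (touched C)"
  shows "whitney (relabel \<sigma> ` C) = whitney C"
  unfolding whitney_def
proof (rule sum.reindex_bij_betw[where h = "image (relabel \<sigma>)", symmetric, THEN trans])
  have inj: "inj_on (relabel \<sigma>) C" by (rule inj_on_relabel_labels[OF assms(2)])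
  have iff: "solutions (relabel \<sigma> ` F) = solutions (relabel \<sigma> ` C) \<longleftrightarrow> solutions F = solutions C"
    if "F \<subseteq> C" for F
    by (rule solutions_relabel_eq_iff[OF assms(1) _ _ assms(2)]) (use that touched_mono in auto)
  show "bij_betw (image (relabel \<sigma>)) {F. F \<subseteq> C \<and> solutions F = solutions C}
      {F. F \<subseteq> relabel \<sigma> ` C \<and> solutions F = solutions (relabel \<sigma> ` C)}"
  proof (rule bij_betw_imageI)
    show "inj_on (image (relabel \<sigma>)) {F. F \<subseteq> C \<and> solutions F = solutions C}"
      by (rule inj_on_subset[OF inj_on_image_Pow[OF inj]]) auto
    show "image (relabel \<sigma>) ` {F. F \<subseteq> C \<and> solutions F = solutions C} =
        {F. F \<subseteq> relabel \<sigma> ` C \<and> solutions F = solutions (relabel \<sigma> ` C)}"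
    proof (intro equalityI subsetI)
      fix F' assume "F' \<in> {F. F \<subseteq> relabel \<sigma> ` C \<and> solutions F = solutions (relabel \<sigma> ` C)}"
      then obtain F where "F \<subseteq> C" "F' = relabel \<sigma> ` F" "solutions F' = solutions (relabel \<sigma> ` C)"
        by (auto simp: subset_image_iff)
      then show "F' \<in> image (relabel \<sigma>) ` {F. F \<subseteq> C \<and> solutions F = solutions C}" using iff by auto
    qed (use iff in auto)
  qed
  show "(\<Sum>F | F \<subseteq> C \<and> solutions F = solutions C. (-1) ^ card (relabel \<sigma> ` F))
      = (\<Sum>F | F \<subseteq> C \<and> solutions F = solutions C. (-1) ^ card F)"
    using inj by (intro sum.cong refl) (auto simp: card_image inj_on_subset)
qed


subsection \<open>Counting configurations\<close>

definition grid_configs :: "nat set \<Rightarrow> label set \<Rightarrow> (real \<times> real) set \<Rightarrow> config set" where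
  "grid_configs A F G = {z \<in> configs_on A. (\<forall>i\<in>A. pos z i \<in> G) \<and> z \<in> solutions F}"

text \<open>A piece that no label of \<open>F\<close> touches is placed freely. Iterated, this gives
  the factor \<open>N^(q - \<kappa>)\<close>.\<close>

lemma grid_configs_insert:
  assumes A: "finite A" "i \<notin> A" and F: "touched F \<subseteq> A"
  shows "bij_betw (\<lambda>(z, g). z + Poly_Mapping.single i g) (grid_configs A F G \<times> G) (grid_configs (insert i A) F G)"
proof (rule bij_betw_byWitness[where f' = "\<lambda>z. (z - Poly_Mapping.single i (pos z i), pos z i)"])
  have sol: "z + Poly_Mapping.single i g \<in> solutions F \<longleftrightarrow> z \<in> solutions F"
    "z - Poly_Mapping.single i g \<in> solutions F \<longleftrightarrow> z \<in> solutions F" for z g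
    using A(2) F by (auto intro!: solutions_cong simp: lookup_add lookup_minus lookup_single when_def)
  show "\<forall>a\<in>grid_configs A F G \<times> G. (\<lambda>z. (z - Poly_Mapping.single i (pos z i), pos z i)) ((\<lambda>(z, g). z + Poly_Mapping.single i g) a) = a"
    using A(2) by (auto simp: grid_configs_def configs_on_def lookup_add)
  show "\<forall>z\<in>grid_configs (insert i A) F G. (\<lambda>(z, g). z + Poly_Mapping.single i g) ((\<lambda>z. (z - Poly_Mapping.single i (pos z i), pos z i)) z) = z"
    by simp
  show "(\<lambda>(z, g). z + Poly_Mapping.single i g) ` (grid_configs A F G \<times> G) \<subseteq> grid_configs (insert i A) F G"
    using A(2) by (auto simp: grid_configs_def sol configs_on_def lookup_add lookup_single when_def)
  show "(\<lambda>z. (z - Poly_Mapping.single i (pos z i), pos z i)) ` grid_configs (insert i A) F G \<subseteq> grid_configs A F G \<times> G"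
    using A(2) by (auto simp: grid_configs_def sol configs_on_def lookup_minus lookup_single when_def)
qed

lemma card_grid_configs_superset:
  assumes "finite J" "finite I" "I \<inter> J = {}" "touched F \<subseteq> I"
  shows "card (grid_configs (I \<union> J) F G) = card (grid_configs I F G) * card G ^ card J"
  using assms(1,3)
proof (induction J rule: finite_induct)
  case (insert i J)
  then have "card (grid_configs (insert i (I \<union> J)) F G) = card (grid_configs (I \<union> J) F G \<times> G)"
    using assms by (intro bij_betw_same_card[symmetric, OF grid_configs_insert]) auto
  with insert show ?case by (simp add: card_cartesian_product)
qed simp

lemma finite_grid_configs:
  assumes "finite A" "finite G"
  shows "finite (grid_configs A F G)"
proof -
  have "finite (grid_configs A {} G)"
    using assms(1)
  proof (induction A rule: finite_induct)
    case empty
    have "grid_configs {} {} G \<subseteq> {0}"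
      by (auto simp: grid_configs_def configs_on_def intro: poly_mapping_eqI)
    then show ?case by (rule finite_subset) simp
  next
    case (insert i A)
    have "bij_betw (\<lambda>(z, g). z + Poly_Mapping.single i g) (grid_configs A {} G \<times> G) (grid_configs (insert i A) {} G)"
      by (rule grid_configs_insert) (use insert in \<open>auto simp: touched_def\<close>)
    then show ?case using bij_betw_finite insert.IH assms(2) by blast
  qed
  moreover have "grid_configs A F G \<subseteq> grid_configs A {} G"
    by (auto simp: grid_configs_def solutions_def)
  ultimately show ?thesis by (rule finite_subset[rotated])
qed

lemma card_grid_configs_relabel:
  assumes I: "finite I" "touched F \<subseteq> I" and \<sigma>: "inj_on \<sigma> I"
  shows "card (grid_configs (\<sigma> ` I) (relabel \<sigma> ` F) G) = card (grid_configs I F G)"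
proof (rule bij_betw_same_card)
  let ?\<tau> = "inv_into I \<sigma>"
  have p1: "pos (config_of I (\<lambda>i. pos z (\<sigma> i))) i = (if i \<in> I then pos z (\<sigma> i) else 0)" for z i
    using I(1) by (simp add: pos_config_of)
  have p2: "pos (config_of (\<sigma> ` I) (\<lambda>i. pos z (?\<tau> i))) i = (if i \<in> \<sigma> ` I then pos z (?\<tau> i) else 0)" for z i
    using I(1) by (simp add: pos_config_of)
  have s1: "config_of I (\<lambda>i. pos z (\<sigma> i)) \<in> solutions F \<longleftrightarrow> z \<in> solutions (relabel \<sigma> ` F)" for z
    by (rule solutions_relabel) (use I p1 in auto)
  have inverse: "config_of I (\<lambda>i. pos (config_of (\<sigma> ` I) (\<lambda>i. pos z (?\<tau> i))) (\<sigma> i)) = z" if "z \<in> configs_on I" for z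
    using that \<sigma> by (intro poly_mapping_eqI, simp only: p1) (auto simp: p2 configs_on_def)
  show "bij_betw (\<lambda>z. config_of I (\<lambda>i. pos z (\<sigma> i))) (grid_configs (\<sigma> ` I) (relabel \<sigma> ` F) G) (grid_configs I F G)"
  proof (rule bij_betw_byWitness[where f' = "\<lambda>z. config_of (\<sigma> ` I) (\<lambda>i. pos z (?\<tau> i))"])
    show "\<forall>z\<in>grid_configs (\<sigma> ` I) (relabel \<sigma> ` F) G.
        config_of (\<sigma> ` I) (\<lambda>i. pos (config_of I (\<lambda>i. pos z (\<sigma> i))) (?\<tau> i)) = z"
    proof (intro ballI poly_mapping_eqI)
      fix z k assume "z \<in> grid_configs (\<sigma> ` I) (relabel \<sigma> ` F) G"
      then have "pos z k = 0" if "k \<notin> \<sigma> ` I" using that by (simp add: grid_configs_def configs_on_def)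
      then show "pos (config_of (\<sigma> ` I) (\<lambda>i. pos (config_of I (\<lambda>i. pos z (\<sigma> i))) (?\<tau> i))) k = pos z k"
        unfolding p2 by (cases "k \<in> \<sigma> ` I") (simp_all only: p1 inv_into_into f_inv_into_f if_True if_False simp_thms)
    qed
    show "\<forall>z\<in>grid_configs I F G. config_of I (\<lambda>i. pos (config_of (\<sigma> ` I) (\<lambda>i. pos z (?\<tau> i))) (\<sigma> i)) = z"
      using inverse by (auto simp: grid_configs_def)
    show "(\<lambda>z. config_of I (\<lambda>i. pos z (\<sigma> i))) ` grid_configs (\<sigma> ` I) (relabel \<sigma> ` F) G \<subseteq> grid_configs I F G"
      using I(1) by (auto simp: grid_configs_def s1 p1)
    show "(\<lambda>z. config_of (\<sigma> ` I) (\<lambda>i. pos z (?\<tau> i))) ` grid_configs I F G \<subseteq> grid_configs (\<sigma> ` I) (relabel \<sigma> ` F) G"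
    proof
      fix y assume "y \<in> (\<lambda>z. config_of (\<sigma> ` I) (\<lambda>i. pos z (?\<tau> i))) ` grid_configs I F G"
      then obtain z where z: "z \<in> grid_configs I F G" "y = config_of (\<sigma> ` I) (\<lambda>i. pos z (?\<tau> i))" by auto
      then have "y \<in> solutions (relabel \<sigma> ` F)"
        using inverse[of z] s1[of y] by (simp add: grid_configs_def)
      with z show "y \<in> grid_configs (\<sigma> ` I) (relabel \<sigma> ` F) G"
        using I(1) \<sigma> by (auto simp: grid_configs_def p2)
    qed
  qed
qed

lemma card_grid_points: "finite A \<Longrightarrow> card (grid_configs A {} G) = card G ^ card A"
proof -
  assume "finite A"
  moreover have "grid_configs {} {} G = {0}"
    by (auto simp: grid_configs_def configs_on_def solutions_def intro: poly_mapping_eqI)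
  ultimately show ?thesis
    using card_grid_configs_superset[of A "{}" "{}" G] by (simp add: touched_def)
qed

text \<open>The count depends on \<open>U\<close> only through its flat, and therefore, by
  \<open>card_grid_configs_relabel\<close>, only on its type.\<close>

lemma subspace_count_eq:
  assumes "U \<in> intersection_lattice M q"
  shows "subspace_count M B q U n =
    card (grid_configs (touched (implied M q U)) (implied M q U) (board_points B n))"
proof -
  let ?C = "implied M q U"
  have "U = configs_on {1..q} \<inter> solutions ?C" by (rule lattice_elt_eq[OF assms])
  then have "z \<in> U \<longleftrightarrow> z \<in> configs_on {1..q} \<and> z \<in> solutions ?C" for z by blast
  then have "essential_part M q U = configs_on (touched ?C) \<inter> solutions ?C"
    using touched_implied[of M q U] involved_eq[OF lattice_subset_space[OF assms]]
    by (auto simp: essential_part_def configs_on_def)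
  then show ?thesis
    unfolding subspace_count_def involved_eq[OF lattice_subset_space[OF assms]]
    by (intro arg_cong[where f = card]) (auto simp: grid_configs_def)
qed

lemma nonattacking_iff: "nonattacking M q z \<longleftrightarrow> (\<forall>l\<in>labels M {1..q}. \<not> sat z l)"
proof
  assume *: "nonattacking M q z"
  show "\<forall>l\<in>labels M {1..q}. \<not> sat z l"
  proof
    fix l assume "l \<in> labels M {1..q}"
    then obtain m i j where "l = (m, {i, j})" "i \<noteq> j" "m \<in> M" "i \<in> {1..q}" "j \<in> {1..q}"
      by (auto simp: labels_def card_2_iff)
    with * show "\<not> sat z l" by (simp add: nonattacking_def sat_doubleton)
  qed
next
  assume *: "\<forall>l\<in>labels M {1..q}. \<not> sat z l"
  show "nonattacking M q z"
    unfolding nonattacking_def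
  proof (intro ballI impI)
    fix i j m assume "i \<in> {1..q}" "j \<in> {1..q}" "i \<noteq> j" "m \<in> M"
    then have "(m, {i, j}) \<in> labels M {1..q}" by (auto simp: labels_def)
    with * show "(pos z j - pos z i) \<bullet> perp m \<noteq> 0" by (metis sat_doubleton)
  qed
qed

lemma labelled_count_eq:
  assumes M: "finite M" "(0, 0) \<notin> M" and G: "finite (board_points B n)"
  shows "int (labelled_count M B q n) = (\<Sum>U\<in>intersection_lattice M q.
    mu0 M q U * int (subspace_count M B q U n * card (board_points B n) ^ (q - card (involved M q U))))"
proof -
  let ?G = "board_points B n" and ?A = "{1..q}" and ?L = "intersection_lattice M q"
  let ?E = "labels M ?A"
  let ?Z = "grid_configs ?A {} ?G"
  have finZ: "finite ?Z" by (rule finite_grid_configs) (use G in auto)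
  have finE: "finite ?E" using finite_labels[OF M(1)] by simp
  have Z: "{z \<in> ?Z. z \<in> solutions F} = grid_configs ?A F ?G" for F
    by (auto simp: grid_configs_def solutions_def)
  have "labelled_count M B q n = card {z \<in> ?Z. \<forall>l\<in>?E. \<not> sat z l}"
    unfolding labelled_count_def nonattacking_iff config_space_eq
    by (intro arg_cong[where f = card]) (auto simp: grid_configs_def solutions_def)
  also have "int \<dots> = (\<Sum>z\<in>?Z. if \<forall>l\<in>?E. \<not> sat z l then 1 else 0)"
    using finZ by (simp add: sum.If_cases Int_def)
  \<comment> \<open>The label sets satisfied by \<open>z\<close> are the subsets of one set, namely
    of all labels that \<open>z\<close> satisfies. Their signs cancel unless this set is empty,
    which means that \<open>z\<close> is nonattacking.\<close>
  also have "\<dots> = (\<Sum>z\<in>?Z. \<Sum>F\<in>Pow ?E. if z \<in> solutions F then (-1) ^ card F else 0)"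
  proof (rule sum.cong[OF refl])
    fix z
    have "(\<Sum>F\<in>Pow ?E. if z \<in> solutions F then (-1) ^ card F else 0) = (\<Sum>F\<in>Pow {l \<in> ?E. sat z l}. (-1::int) ^ card F)"
      using finE by (intro sum.mono_neutral_cong_right) (auto simp: solutions_def)
    also have "\<dots> = (if {l \<in> ?E. sat z l} = {} then 1 else 0)"
      by (rule sum_alternating_Pow) (use finE in simp)
    also have "{l \<in> ?E. sat z l} = {} \<longleftrightarrow> (\<forall>l\<in>?E. \<not> sat z l)" by blast
    finally show "(if \<forall>l\<in>?E. \<not> sat z l then 1 else 0) = (\<Sum>F\<in>Pow ?E. if z \<in> solutions F then (-1::int) ^ card F else 0)"
      by simp
  qed
  also have "\<dots> = (\<Sum>F\<in>Pow ?E. \<Sum>z\<in>?Z. if z \<in> solutions F then (-1) ^ card F else 0)"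
    by (rule sum.swap)
  also have "\<dots> = (\<Sum>F\<in>Pow ?E. (-1) ^ card F * int (card (grid_configs ?A F ?G)))"
  proof (rule sum.cong[OF refl])
    fix F
    show "(\<Sum>z\<in>?Z. if z \<in> solutions F then (-1) ^ card F else 0) = (-1) ^ card F * int (card (grid_configs ?A F ?G))"
      by (subst Z[symmetric]) (use finZ in \<open>simp add: sum.If_cases Int_def mult.commute\<close>)
  qed
  \<comment> \<open>All label sets with the same intersection admit the same placements, so each
    lattice element collects its Whitney sum as coefficient.\<close>
  also have "\<dots> = (\<Sum>U\<in>?L. \<Sum>F | F \<in> Pow ?E \<and> configs_on ?A \<inter> solutions F = U.
      (-1) ^ card F * int (card (grid_configs ?A F ?G)))"
    by (rule sum.group[symmetric])
      (use finE finite_intersection_lattice[OF M(1)] in \<open>auto simp: intersection_lattice_eq\<close>)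
  also have "\<dots> = (\<Sum>U\<in>?L. mu0 M q U * int (subspace_count M B q U n * card ?G ^ (q - card (involved M q U))))"
  proof (rule sum.cong[OF refl])
    fix U assume U: "U \<in> ?L"
    let ?C = "implied M q U"
    have "(\<Sum>F | F \<in> Pow ?E \<and> configs_on ?A \<inter> solutions F = U. (-1) ^ card F * int (card (grid_configs ?A F ?G)))
      = (\<Sum>F | F \<subseteq> ?C \<and> solutions F = solutions ?C. (-1) ^ card F * int (card (grid_configs ?A ?C ?G)))"
      unfolding lattice_fiber[OF U] by (intro sum.cong refl) (auto simp: grid_configs_def)
    also have "\<dots> = whitney ?C * int (card (grid_configs ?A ?C ?G))"
      by (simp add: whitney_def sum_distrib_right)
    also have "card (grid_configs ?A ?C ?G) = card (grid_configs (touched ?C \<union> (?A - touched ?C)) ?C ?G)"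
      using touched_implied[of M q U] by (simp add: Un_absorb1)
    also have "\<dots> = card (grid_configs (touched ?C) ?C ?G) * card ?G ^ card (?A - touched ?C)"
      using touched_implied[of M q U] by (intro card_grid_configs_superset) (auto intro: finite_subset)
    also have "card (?A - touched ?C) = q - card (touched ?C)"
      using touched_implied[of M q U] by (subst card_Diff_subset) (auto intro: finite_subset)
    also have "whitney ?C = mu0 M q U" using mu0_eq_whitney[OF M U] by simp
    finally show "(\<Sum>F | F \<in> Pow ?E \<and> configs_on ?A \<inter> solutions F = U. (-1) ^ card F * int (card (grid_configs ?A F ?G)))
      = mu0 M q U * int (subspace_count M B q U n * card ?G ^ (q - card (involved M q U)))"
      using subspace_count_eq[OF U, of B n] involved_eq[OF lattice_subset_space[OF U]] by simp
  qed
  finally show ?thesis .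
qed

subsection \<open>Codimension\<close>

lemma codim_basis:
  assumes M: "finite M" and U: "U \<in> intersection_lattice M q"
  obtains F where "F \<subseteq> implied M q U" "solutions F = solutions (implied M q U)"
    "card F = codim q U" "finite F"
proof -
  have "\<exists>F\<subseteq>implied M q U. solutions F = solutions (implied M q U) \<and>
      dim (configs_on {1..q} \<inter> solutions (implied M q U)) + card F = 2 * card {1..q}"
    by (rule solutions_rank[OF implied_labels finite_implied[OF M]]) simp
  then obtain F where F: "F \<subseteq> implied M q U" "solutions F = solutions (implied M q U)"
      "dim (configs_on {1..q} \<inter> solutions (implied M q U)) + card F = 2 * card {1..q}"
    by blast
  then have "card F = codim q U"
    unfolding lattice_elt_eq[OF U, symmetric] codim_def by simp
  moreover have "finite F" using F(1) finite_implied[OF M] by (rule finite_subset)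
  ultimately show ?thesis using F that by blast
qed

lemma codim_le_card:
  assumes M: "finite M" and F: "F \<subseteq> labels M {1..q}" "solutions F = solutions (implied M q U)"
    and U: "U \<in> intersection_lattice M q"
  shows "codim q U \<le> card F"
proof -
  have finF: "finite F" using F(1) finite_labels[OF M, of "{1..q}"] finite_subset by auto
  have "\<exists>G\<subseteq>F. solutions G = solutions F \<and> dim (configs_on {1..q} \<inter> solutions F) + card G = 2 * card {1..q}"
    by (rule solutions_rank[OF F(1) finF]) simp
  then obtain G where G: "G \<subseteq> F" "dim (configs_on {1..q} \<inter> solutions F) + card G = 2 * card {1..q}"
    by blast
  then have "codim q U = card G"
    unfolding F(2) lattice_elt_eq[OF U, symmetric] codim_def by simp
  also have "\<dots> \<le> card F" using G(1) finF by (rule card_mono[rotated])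
  finally show ?thesis .
qed

text \<open>Renaming carries a generating set of minimal size to a generating set of the other
  subspace, so the codimension cannot grow; symmetry of the type relation gives equality.\<close>

lemma codim_same_type:
  assumes M: "finite M" and "((q, U), (q', U')) \<in> same_type M"
  shows "codim q U = codim q' U'"
proof -
  have le: "codim q' U' \<le> codim q U" if st: "((q, U), (q', U')) \<in> same_type M" for q U q' U'
  proof -
    have U: "U \<in> intersection_lattice M q" "U' \<in> intersection_lattice M q'"
      using st by (auto simp: same_type_def move_subspaces_def)
    obtain \<sigma> where \<sigma>: "inj_on \<sigma> (touched (implied M q U))" "relabel \<sigma> ` implied M q U = implied M q' U'"
      using st by (auto simp: same_type_iff)
    obtain F where F: "F \<subseteq> implied M q U" "solutions F = solutions (implied M q U)"
      "card F = codim q U" "finite F" by (rule codim_basis[OF M U(1)])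
    have "solutions (relabel \<sigma> ` F) = solutions (relabel \<sigma> ` implied M q U)"
      by (subst solutions_relabel_eq_iff[OF _ _ _ \<sigma>(1)])
        (use F touched_mono[OF F(1)] finite_touched[OF implied_labels finite_implied[OF M]] in auto)
    moreover have "relabel \<sigma> ` F \<subseteq> labels M {1..q'}"
      using F(1) \<sigma>(2) implied_labels[of M q' U'] by blast
    ultimately have "codim q' U' \<le> card (relabel \<sigma> ` F)"
      using \<sigma>(2) by (intro codim_le_card[OF M _ _ U(2)]) auto
    also have "\<dots> \<le> card F" by (rule card_image_le[OF F(4)])
    finally show ?thesis using F(3) by simp
  qed
  moreover have "((q', U'), (q, U)) \<in> same_type M"
    using assms(2) equiv_same_type[of M] by (meson equivE symE)
  ultimately show ?thesis using assms(2) le by (intro antisym) auto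
qed

lemma involved_same_type:
  assumes "((q, U), (q', U')) \<in> same_type M"
  shows "card (involved M q U) = card (involved M q' U')"
proof -
  obtain \<sigma> where "bij_betw \<sigma> (involved M q U) (involved M q' U')"
    using assms by (auto simp: same_type_def)
  then show ?thesis by (rule bij_betw_same_card)
qed

lemma finite_involved [simp]: "finite (involved M q U)"
  by (rule finite_subset[of _ "{1..q}"]) (auto simp: involved_def)

lemma codim_touched:
  assumes M: "finite M" "(0, 0) \<notin> M" and U: "U \<in> intersection_lattice M q"
    and F: "F \<subseteq> implied M q U" "solutions F = solutions (implied M q U)"
  shows "touched F = involved M q U"
  unfolding involved_eq[OF lattice_subset_space[OF U]]
  by (rule touched_eq[OF F(2) order_trans[OF F(1) implied_labels] implied_labels M(2)])

text \<open>Some \<open>codim q U\<close> labels generate \<open>U\<close>; they touch all involved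
  pieces, and each of them touches two.\<close>

lemma involved_le_codim:
  assumes M: "finite M" "(0, 0) \<notin> M" and U: "U \<in> intersection_lattice M q"
  shows "card (involved M q U) \<le> 2 * codim q U"
proof -
  obtain F where F: "F \<subseteq> implied M q U" "solutions F = solutions (implied M q U)"
    "card F = codim q U" "finite F" by (rule codim_basis[OF M(1) U])
  have "F \<subseteq> labels M {1..q}" using F(1) implied_labels by (rule order_trans)
  then show ?thesis
    using card_touched_le[OF _ F(4)] codim_touched[OF M U F(1,2)] F(3) by metis
qed

text \<open>\<open>U\<close> contains all configurations in which the involved pieces coincide.
  Coincidence costs two equations for each piece other than a fixed piece \<open>a\<close>.\<close>

lemma codim_le_involved:
  assumes M: "finite M" and U: "U \<in> intersection_lattice M q" and I: "involved M q U \<noteq> {}"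
  shows "codim q U \<le> 2 * card (involved M q U) - 2"
proof -
  let ?I = "involved M q U" and ?X = "configs_on {1..q}"
  obtain a where a: "a \<in> ?I" using I by auto
  have I_eq: "?I = touched (implied M q U)" by (rule involved_eq[OF lattice_subset_space[OF U]])
  define K where "K = (?I - {a}) \<times> {(1, 0), (0, 1) :: real \<times> real}"
  define f where "f = (\<lambda>(i, b) z. (pos z i - pos z a) \<bullet> (b :: real \<times> real))"
  have lin: "linear (f k)" if "k \<in> K" for k
    unfolding f_def using linear_pos
    by (cases k) (auto simp: inner_diff_left intro: linear_compose_sub linear_pos)
  have finK: "finite K" by (simp add: K_def)
  have "\<exists>J\<subseteq>K. {x \<in> ?X. \<forall>i\<in>J. f i x = 0} = {x \<in> ?X. \<forall>i\<in>K. f i x = 0} \<and>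
      dim {x \<in> ?X. \<forall>i\<in>K. f i x = 0} + card J = dim ?X"
    by (rule dim_common_kernel[OF subspace_configs_on configs_on_span finite_unit_configs finK lin]) auto
  then obtain J where J: "J \<subseteq> K" "dim {x \<in> ?X. \<forall>i\<in>K. f i x = 0} + card J = dim ?X"
    by auto
  have sub: "{x \<in> ?X. \<forall>i\<in>K. f i x = 0} \<subseteq> U"
  proof
    fix z assume z: "z \<in> {x \<in> ?X. \<forall>i\<in>K. f i x = 0}"
    have eq: "pos z i = pos z a" if "i \<in> ?I" for i
    proof (cases "i = a")
      case False
      then have "(i, (1, 0)) \<in> K" "(i, (0, 1)) \<in> K" using that by (auto simp: K_def)
      then have "f (i, (1, 0)) z = 0" "f (i, (0, 1)) z = 0" using z by blast+
      then show ?thesis by (simp add: f_def inner_prod_def prod_eq_iff)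
    qed simp
    have "sat z l" if "l \<in> implied M q U" for l
    proof -
      have "pos z i = pos z a" if "i \<in> snd l" for i
        using that \<open>l \<in> implied M q U\<close> by (intro eq) (auto simp: I_eq touched_def)
      then show ?thesis by (simp add: sat_def)
    qed
    then have "z \<in> solutions (implied M q U)" by (simp add: solutions_def)
    with z show "z \<in> U" using lattice_elt_eq[OF U] by blast
  qed
  obtain B where B: "B \<subseteq> U" "independent B" "U \<subseteq> span B" "card B = dim U"
    using basis_exists[of U] by blast
  have "finite B"
    using real_vector.independent_span_bound[OF finite_unit_configs[of "{1..q}"] B(2)] B(1)
      lattice_subset_space[OF U] configs_on_span[of "{1..q}"] by auto
  then have "dim {x \<in> ?X. \<forall>i\<in>K. f i x = 0} \<le> dim U"
    using real_vector.dim_le_card[of "{x \<in> ?X. \<forall>i\<in>K. f i x = 0}" B] B(3,4) sub by auto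
  moreover have "card J \<le> card K" using J(1) finK by (rule card_mono[rotated])
  moreover have "card K = 2 * (card ?I - 1)"
    using a by (simp add: K_def card_cartesian_product)
  moreover have "dim ?X = 2 * q" by (simp add: dim_configs_on)
  ultimately show ?thesis using J(2) by (simp add: codim_def)
qed

lemma involved_empty_iff:
  assumes M: "(0, 0) \<notin> M" and U: "U \<in> intersection_lattice M q"
  shows "involved M q U = {} \<longleftrightarrow> U = configs_on {1..q}"
proof -
  have "touched (implied M q U) = {} \<longleftrightarrow> implied M q U = {}"
  proof
    assume *: "touched (implied M q U) = {}"
    show "implied M q U = {}"
    proof (rule ccontr)
      assume "implied M q U \<noteq> {}"
      then obtain m e where "(m, e) \<in> implied M q U" by auto
      moreover then have "card e = 2" by (auto simp: implied_def labels_def)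
      moreover then have "e \<noteq> {}" by auto
      ultimately show False using * by (force simp: touched_def)
    qed
  qed (simp add: touched_def)
  then show ?thesis
    using implied_empty_iff[OF M U] involved_eq[OF lattice_subset_space[OF U]] by simp
qed

lemma card_involved_ge_2:
  assumes M: "(0, 0) \<notin> M" and U: "U \<in> intersection_lattice M q" "U \<noteq> configs_on {1..q}"
  shows "card (involved M q U) \<ge> 2"
proof -
  have "involved M q U \<noteq> {}" using involved_empty_iff[OF M U(1)] U(2) by simp
  then obtain m e where l: "(m, e) \<in> implied M q U"
    unfolding involved_eq[OF lattice_subset_space[OF U(1)]] by (auto simp: touched_def)
  then have "card e = 2" by (auto simp: implied_def labels_def)
  moreover have "e \<subseteq> involved M q U"
    unfolding involved_eq[OF lattice_subset_space[OF U(1)]] using l by (force simp: touched_def)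
  then have "card e \<le> card (involved M q U)" by (rule card_mono[OF finite_involved])
  ultimately show ?thesis by simp
qed


subsection \<open>Counting the subspaces of a type\<close>

text \<open>A label implied by the renamed flat uses only pieces in the image of the renaming. It
  therefore has a preimage, which is implied by the original flat and so belongs to it. The flat
  keeps its shape in a space of any number \<open>r\<close> of pieces.\<close>

lemma implied_relabel:
  assumes M: "finite M" "(0, 0) \<notin> M" and U: "U \<in> intersection_lattice M q"
    and \<sigma>: "inj_on \<sigma> (touched (implied M q U))" "\<sigma> ` touched (implied M q U) \<subseteq> {1..r}"
  shows "configs_on {1..r} \<inter> solutions (relabel \<sigma> ` implied M q U) \<in> intersection_lattice M r"
    and "implied M r (configs_on {1..r} \<inter> solutions (relabel \<sigma> ` implied M q U)) = relabel \<sigma> ` implied M q U"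
proof -
  let ?C = "implied M q U"
  let ?I = "touched ?C"
  have lab: "relabel \<sigma> ` ?C \<subseteq> labels M {1..r}"
    by (rule relabel_labels[OF implied_labels \<sigma>])
  then show "configs_on {1..r} \<inter> solutions (relabel \<sigma> ` ?C) \<in> intersection_lattice M r"
    unfolding intersection_lattice_eq by blast
  have finI: "finite ?I" by (rule finite_touched[OF implied_labels finite_implied[OF M(1)]])
  show "implied M r (configs_on {1..r} \<inter> solutions (relabel \<sigma> ` ?C)) = relabel \<sigma> ` ?C"
    unfolding implied_eq[OF lab]
  proof (intro equalityI subsetI)
    fix l assume "l \<in> relabel \<sigma> ` ?C"
    then show "l \<in> {l \<in> labels M {1..r}. solutions (relabel \<sigma> ` ?C) \<subseteq> solutions {l}}"
      using lab solutions_mono[of "{l}" "relabel \<sigma> ` ?C"] by auto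
  next
    fix l assume "l \<in> {l \<in> labels M {1..r}. solutions (relabel \<sigma> ` ?C) \<subseteq> solutions {l}}"
    then have l: "l \<in> labels M {1..r}" "solutions (relabel \<sigma> ` ?C) \<subseteq> solutions {l}" by auto
    obtain m e where me: "l = (m, e)" by (cases l)
    then have m: "m \<in> M" "m \<noteq> (0, 0)" "card e = 2" using l(1) M(2) by (auto simp: labels_def)
    have e: "e \<subseteq> \<sigma> ` ?I"
      using touched_of_implied[OF _ m(3,2)] l(2) unfolding me touched_relabel[symmetric] by blast
    let ?e = "inv_into ?I \<sigma> ` e"
    have img: "\<sigma> ` ?e = e" using e by (rule image_inv_into_cancel[OF refl])
    have eI: "?e \<subseteq> ?I" using e by (auto intro: inv_into_into)
    have "card ?e = 2" using img m(3) card_image[OF inj_on_subset[OF \<sigma>(1) eI]] by simp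
    then have lab0: "(m, ?e) \<in> labels M {1..q}"
      using m(1) eI touched_implied[of M q U] by (auto simp: labels_def)
    have "solutions (relabel \<sigma> ` ?C) \<subseteq> solutions (relabel \<sigma> ` {(m, ?e)})"
      using l(2) me img by (simp add: relabel_def)
    then have "solutions ?C \<subseteq> solutions {(m, ?e)}"
      using solutions_relabel_subset_iff[OF finI order_refl _ \<sigma>(1), of "{(m, ?e)}"] eI
      by (simp add: touched_def)
    then have "(m, ?e) \<in> ?C" using lab0 implied_iff[OF U] by blast
    moreover have "l = relabel \<sigma> (m, ?e)" using img me by (simp add: relabel_def)
    ultimately show "l \<in> relabel \<sigma> ` ?C" by blast
  qed
qed

text \<open>\<open>map_key\<close> composes with the permutation, so it takes a configuration into
  \<open>U\<close> exactly when the configuration satisfies the relabelled flat. Being bijective, it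
  preserves \<open>U\<close> exactly when the relabelled flat again cuts out
  \<open>U\<close>.\<close>

lemma automorphism_iff:
  assumes M: "finite M" "(0, 0) \<notin> M" and U: "U \<in> intersection_lattice M q"
    and \<tau>: "\<tau> permutes touched (implied M q U)"
  shows "Poly_Mapping.map_key \<tau> ` U = U \<longleftrightarrow> relabel \<tau> ` implied M q U = implied M q U"
proof -
  let ?C = "implied M q U" and ?k = "Poly_Mapping.map_key \<tau>"
  have inj: "inj \<tau>" using \<tau> by (rule permutes_inj)
  have perm: "\<tau> permutes {1..q}" using \<tau> touched_implied by (rule permutes_subset)
  have pos: "pos (?k z) i = pos z (\<tau> i)" for z i
    using inj by (simp add: map_key.rep_eq)
  have sp: "?k z \<in> configs_on {1..q} \<longleftrightarrow> z \<in> configs_on {1..q}" for z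
  proof
    assume *: "?k z \<in> configs_on {1..q}"
    show "z \<in> configs_on {1..q}"
      unfolding configs_on_def mem_Collect_eq
    proof (intro allI impI)
      fix i assume i: "i \<notin> {1..q}"
      then have "pos (?k z) i = 0" using * by (simp add: configs_on_def)
      moreover have "\<tau> i = i" using permutes_not_in[OF perm i] .
      ultimately show "pos z i = 0" by (simp add: pos)
    qed
  next
    assume *: "z \<in> configs_on {1..q}"
    show "?k z \<in> configs_on {1..q}"
      unfolding configs_on_def mem_Collect_eq
    proof (intro allI impI)
      fix i assume i: "i \<notin> {1..q}"
      then have "\<tau> i = i" using permutes_not_in[OF perm i] by simp
      then show "pos (?k z) i = 0" using * i by (simp add: pos configs_on_def)
    qed
  qed
  have sol: "?k z \<in> solutions ?C \<longleftrightarrow> z \<in> solutions (relabel \<tau> ` ?C)" for z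
    by (rule solutions_relabel) (simp add: pos)
  let ?V = "configs_on {1..q} \<inter> solutions (relabel \<tau> ` ?C)"
  have mem: "?k z \<in> U \<longleftrightarrow> z \<in> ?V" for z
    using lattice_elt_eq[OF U] sp[of z] sol[of z] by blast
  have "?k ` U = U \<longleftrightarrow> U = ?V"
  proof
    assume *: "?k ` U = U"
    show "U = ?V"
    proof (intro equalityI subsetI)
      fix z assume "z \<in> U"
      then show "z \<in> ?V" using * mem by blast
    next
      fix z assume "z \<in> ?V"
      then have "?k z \<in> ?k ` U" using * mem by blast
      then obtain y where y: "y \<in> U" "?k z = ?k y" by blast
      have "z = y"
      proof (rule poly_mapping_eqI)
        fix i
        have "pos (?k z) (inv \<tau> i) = pos (?k y) (inv \<tau> i)" using y(2) by simp
        then show "pos z i = pos y i" by (simp add: pos permutes_inverses[OF \<tau>])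
      qed
      with y(1) show "z \<in> U" by simp
    qed
  next
    assume *: "U = ?V"
    show "?k ` U = U"
    proof (intro equalityI subsetI)
      fix z assume "z \<in> ?k ` U"
      then show "z \<in> U" using * mem by blast
    next
      fix z assume z: "z \<in> U"
      let ?y = "Poly_Mapping.map_key (inv \<tau>) z"
      have "inj (inv \<tau>)" using permutes_inv[OF \<tau>] by (rule permutes_inj)
      then have "?k ?y = z"
        by (intro poly_mapping_eqI) (simp add: pos map_key.rep_eq permutes_inverses[OF \<tau>])
      then show "z \<in> ?k ` U" using * mem[of ?y] z by (metis imageI)
    qed
  qed
  also have "\<dots> \<longleftrightarrow> relabel \<tau> ` ?C = ?C"
  proof
    assume "U = ?V"
    moreover have "\<tau> ` touched ?C = touched ?C" using \<tau> by (rule permutes_image)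
    ultimately show "relabel \<tau> ` ?C = ?C"
      using implied_relabel(2)[OF M U, of \<tau> q] inj_on_subset[OF inj subset_UNIV] touched_implied[of M q U] by simp
  next
    assume "relabel \<tau> ` ?C = ?C"
    then show "U = ?V" using lattice_elt_eq[OF U] by simp
  qed
  finally show ?thesis .
qed

text \<open>
  The subspaces of the type of \<open>U\<close> are the images of \<open>U\<close> under the injections of its pieces into
  \<open>{1..r}\<close>, and each image is obtained from as many injections as \<open>U\<close> has automorphisms.
\<close>

lemma card_type_members:
  assumes M: "finite M" "(0, 0) \<notin> M" and U: "(q, U) \<in> move_subspaces M" and r: "1 \<le> r"
  shows "real (card {V \<in> intersection_lattice M r. ((q, U), (r, V)) \<in> same_type M}) *
      real (card (automorphisms M q U)) = (\<Prod>l<card (involved M q U). real r - real l)"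
proof -
  have UL: "U \<in> intersection_lattice M q" using U by (simp add: move_subspaces_def)
  let ?C = "implied M q U" and ?X = "{V \<in> intersection_lattice M r. ((q, U), (r, V)) \<in> same_type M}"
  define I where "I = touched ?C"
  have inv: "involved M q U = I" unfolding I_def by (rule involved_eq[OF lattice_subset_space[OF UL]])
  have finI: "finite I" using finite_involved inv by metis
  \<comment> \<open>The maps are extensional, so that maps agreeing on \<open>I\<close> are equal
    and \<open>S\<close> can be counted.\<close>
  define S where "S = {\<sigma> \<in> I \<rightarrow>\<^sub>E {1..r}. inj_on \<sigma> I}"
  have finS: "finite S" unfolding S_def by (intro finite_subset[OF _ finite_PiE[of I "\<lambda>_. {1..r}"]]) (use finI in auto)
  define \<phi> where "\<phi> = (\<lambda>\<sigma>. configs_on {1..r} \<inter> solutions (relabel \<sigma> ` ?C))"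
  have S: "inj_on \<sigma> (touched ?C)" "\<sigma> ` touched ?C \<subseteq> {1..r}" if "\<sigma> \<in> S" for \<sigma>
    using that unfolding S_def I_def by (auto simp: PiE_def Pi_def)
  note \<phi>L = implied_relabel(1)[OF M UL S, folded \<phi>_def] and \<phi>C = implied_relabel(2)[OF M UL S, folded \<phi>_def]
  have \<phi>X: "\<phi> \<sigma> \<in> ?X" if "\<sigma> \<in> S" for \<sigma>
  proof -
    have "\<phi> \<sigma> \<in> intersection_lattice M r" "implied M r (\<phi> \<sigma>) = relabel \<sigma> ` ?C"
      using \<phi>L[OF that that] \<phi>C[OF that that] by (simp_all add: \<phi>_def)
    then show ?thesis using U r S(1)[OF that] by (auto simp: same_type_iff move_subspaces_def)
  qed
  have fiber: "card {\<sigma> \<in> S. \<phi> \<sigma> = V} = card (automorphisms M q U)" if V: "V \<in> ?X" for V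
  proof -
    have VL: "V \<in> intersection_lattice M r" using V by simp
    obtain \<rho>' where \<rho>': "inj_on \<rho>' I" "relabel \<rho>' ` ?C = implied M r V"
      using V by (auto simp: same_type_iff I_def)
    \<comment> \<open>One injection that carries \<open>U\<close> to \<open>V\<close> is fixed; the
      others are \<open>\<rho>\<close> after an automorphism of \<open>U\<close>, which determines
      the size of the fibre over \<open>V\<close>.\<close>
    define \<rho> where "\<rho> = restrict \<rho>' I"
    have \<rho>: "inj_on \<rho> I" "relabel \<rho> ` ?C = implied M r V"
      using \<rho>' relabel_cong[of ?C \<rho> \<rho>'] by (auto simp: \<rho>_def I_def)
    have img: "\<rho> ` I = touched (implied M r V)" unfolding \<rho>(2)[symmetric] touched_relabel I_def ..
    have memb: "\<sigma> \<in> S \<and> \<phi> \<sigma> = V \<longleftrightarrow> \<sigma> \<in> extensional I \<and> inj_on \<sigma> I \<and> relabel \<sigma> ` ?C = relabel \<rho> ` ?C" for \<sigma>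
    proof
      assume *: "\<sigma> \<in> S \<and> \<phi> \<sigma> = V"
      then have "implied M r V = relabel \<sigma> ` ?C" using \<phi>C[of \<sigma>] by (auto simp: \<phi>_def)
      then show "\<sigma> \<in> extensional I \<and> inj_on \<sigma> I \<and> relabel \<sigma> ` ?C = relabel \<rho> ` ?C"
        using * \<rho>(2) by (auto simp: S_def PiE_def)
    next
      assume *: "\<sigma> \<in> extensional I \<and> inj_on \<sigma> I \<and> relabel \<sigma> ` ?C = relabel \<rho> ` ?C"
      then have "\<sigma> ` I = touched (implied M r V)" unfolding I_def by (metis \<rho>(2) touched_relabel)
      then have "\<sigma> ` I \<subseteq> {1..r}" using touched_implied[of M r V] by simp
      then have "\<sigma> \<in> S" using * by (auto simp: S_def PiE_def)
      moreover have "\<phi> \<sigma> = V" using * \<rho>(2) lattice_elt_eq[OF VL] by (simp add: \<phi>_def)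
      ultimately show "\<sigma> \<in> S \<and> \<phi> \<sigma> = V" by simp
    qed
    have "bij_betw (\<lambda>\<tau>. restrict (\<rho> \<circ> \<tau>) I) (automorphisms M q U) {\<sigma> \<in> S. \<phi> \<sigma> = V}"
    proof (rule bij_betwI')
      fix \<tau> \<tau>' assume t: "\<tau> \<in> automorphisms M q U" "\<tau>' \<in> automorphisms M q U"
      show "restrict (\<rho> \<circ> \<tau>) I = restrict (\<rho> \<circ> \<tau>') I \<longleftrightarrow> \<tau> = \<tau>'"
      proof
        assume *: "restrict (\<rho> \<circ> \<tau>) I = restrict (\<rho> \<circ> \<tau>') I"
        have p: "\<tau> permutes I" "\<tau>' permutes I" using t by (auto simp: automorphisms_def inv)
        show "\<tau> = \<tau>'"
        proof
          fix x
          show "\<tau> x = \<tau>' x"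
          proof (cases "x \<in> I")
            case True
            then have "\<rho> (\<tau> x) = \<rho> (\<tau>' x)" using * by (metis comp_apply restrict_apply')
            moreover have "\<tau> x \<in> I" "\<tau>' x \<in> I" using p True permutes_in_image by metis+
            ultimately show ?thesis using \<rho>(1) by (meson inj_onD)
          next
            case False
            then show ?thesis using p by (simp add: permutes_not_in)
          qed
        qed
      qed simp
    next
      fix \<tau> assume t: "\<tau> \<in> automorphisms M q U"
      have p: "\<tau> permutes I" using t by (auto simp: automorphisms_def inv)
      have "relabel \<tau> ` ?C = ?C"
        using t automorphism_iff[OF M UL] p by (auto simp: automorphisms_def I_def)
      then have "relabel (restrict (\<rho> \<circ> \<tau>) I) ` ?C = relabel \<rho> ` ?C"
        using relabel_cong[of ?C "restrict (\<rho> \<circ> \<tau>) I" "\<rho> \<circ> \<tau>"] relabel_relabel[of \<rho> \<tau> ?C] by (simp add: I_def)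
      moreover have "inj_on (\<rho> \<circ> \<tau>) I"
        using \<rho>(1) p by (intro comp_inj_on) (auto simp: permutes_image intro: permutes_inj_on)
      then have "inj_on (restrict (\<rho> \<circ> \<tau>) I) I" by (simp add: inj_on_restrict_eq)
      ultimately show "restrict (\<rho> \<circ> \<tau>) I \<in> {\<sigma> \<in> S. \<phi> \<sigma> = V}"
        using memb by auto
    next
      fix \<sigma> assume "\<sigma> \<in> {\<sigma> \<in> S. \<phi> \<sigma> = V}"
      then have s: "\<sigma> \<in> extensional I" "inj_on \<sigma> I" "relabel \<sigma> ` ?C = relabel \<rho> ` ?C" using memb by auto
      have imgs: "\<sigma> ` I = \<rho> ` I" using s(3) unfolding I_def by (metis touched_relabel)
      define \<tau> where "\<tau> = (\<lambda>x. if x \<in> I then inv_into I \<rho> (\<sigma> x) else x)"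
      have "bij_betw (inv_into I \<rho> \<circ> \<sigma>) I I"
        using s(2) imgs \<rho>(1) by (intro bij_betw_trans[of \<sigma> I "\<rho> ` I"])
          (auto simp: bij_betw_def inj_on_inv_into)
      then have "bij_betw \<tau> I I"
        by (rule bij_betw_cong[THEN iffD1, rotated]) (simp add: \<tau>_def)
      then have p: "\<tau> permutes I" by (rule bij_imp_permutes) (simp add: \<tau>_def)
      have r\<tau>: "\<rho> (\<tau> x) = \<sigma> x" if "x \<in> I" for x
        using that imgs by (simp add: \<tau>_def f_inv_into_f[of "\<sigma> x" \<rho> I] flip: imgs)
      have "relabel \<rho> ` relabel \<tau> ` ?C = relabel \<rho> ` ?C"
        unfolding relabel_relabel using relabel_cong[of ?C "\<rho> \<circ> \<tau>" \<sigma>] r\<tau> s(3) by (simp add: I_def)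
      moreover have "touched (relabel \<tau> ` ?C) = I"
        using permutes_image[OF p] by (simp add: touched_relabel I_def)
      then have "relabel \<tau> ` ?C \<union> ?C \<subseteq> {l. snd l \<subseteq> I}" by (auto simp: touched_def I_def)
      ultimately have "relabel \<tau> ` ?C = ?C"
        using inj_on_image_eq_iff[OF inj_on_relabel[OF \<rho>(1)], of "relabel \<tau> ` ?C" ?C] by simp
      then have "\<tau> \<in> automorphisms M q U"
        using automorphism_iff[OF M UL] p by (auto simp: automorphisms_def inv I_def)
      moreover have "\<sigma> = restrict (\<rho> \<circ> \<tau>) I"
        using s(1) r\<tau> by (auto simp: fun_eq_iff extensional_def)
      ultimately show "\<exists>\<tau>\<in>automorphisms M q U. \<sigma> = restrict (\<rho> \<circ> \<tau>) I" by blast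
    qed
    then show ?thesis by (rule bij_betw_same_card[symmetric])
  qed
  have "card S = (\<Sum>\<sigma>\<in>S. 1)" by simp
  also have "\<dots> = (\<Sum>V\<in>?X. \<Sum>\<sigma> | \<sigma> \<in> S \<and> \<phi> \<sigma> = V. 1)"
    by (rule sum.group[symmetric]) (use finS finite_intersection_lattice[OF M(1)] \<phi>X in auto)
  also have "\<dots> = (\<Sum>V\<in>?X. card (automorphisms M q U))"
    using fiber by (intro sum.cong) auto
  finally have "card S = card ?X * card (automorphisms M q U)" by simp
  moreover have "real (card S) = (\<Prod>l<card I. real r - real l)"
  proof -
    have "card S = (\<Prod>l<card I. r - l)"
      unfolding S_def using card_inj_on_subset_funcset[of I "{1..r}" I] finI
      by (simp add: atLeast0LessThan)
    moreover have "(\<Prod>l<card I. real r - real l) = real (\<Prod>l<card I. r - l)"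
    proof (cases "card I \<le> r")
      case True
      then show ?thesis unfolding of_nat_prod by (intro prod.cong) (auto simp: of_nat_diff)
    next
      \<comment> \<open>With fewer than \<open>card I\<close> values there is no injection; both
        products vanish through the factor with index \<open>r\<close>.\<close>
      case False
      then have "r \<in> {..<card I}" by simp
      then have "(\<Prod>l<card I. real r - real l) = 0" "(\<Prod>l<card I. r - l) = 0"
        by (auto intro!: prod_zero)
      then show ?thesis by (simp only: of_nat_0)
    qed
    ultimately show ?thesis by simp
  qed
  ultimately show ?thesis by (simp add: inv)
qed

subsection \<open>Lattice points in dilations\<close>

definition lattice_points :: "'a::euclidean_space set \<Rightarrow> 'a set" where
  "lattice_points S = {p \<in> S. \<forall>b\<in>Basis. p \<bullet> b \<in> \<int>}"

text \<open>Rounding down to the grid of mesh \<open>1 / t\<close>. The indicator of a set,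
  evaluated after rounding, is a step function on cubes of side \<open>1 / t\<close>, so its
  integral is a scaled count of lattice points.\<close>

definition grid_floor :: "real \<Rightarrow> 'a \<Rightarrow> 'a::euclidean_space" where
  "grid_floor t x = (\<Sum>b\<in>Basis. (of_int \<lfloor>t * (x \<bullet> b)\<rfloor> / t) *\<^sub>R b)"

lemma grid_floor_inner: "b \<in> Basis \<Longrightarrow> grid_floor t x \<bullet> b = of_int \<lfloor>t * (x \<bullet> b)\<rfloor> / t"
  unfolding grid_floor_def by (subst inner_sum_left_Basis) auto

lemma grid_floor_error:
  assumes "t > 0" "b \<in> Basis"
  shows "\<bar>x \<bullet> b - grid_floor t x \<bullet> b\<bar> \<le> 1 / t"
proof -
  have "of_int \<lfloor>t * (x \<bullet> b)\<rfloor> \<le> t * (x \<bullet> b)" "t * (x \<bullet> b) < of_int \<lfloor>t * (x \<bullet> b)\<rfloor> + 1" by linarith+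
  then have "\<bar>t * (x \<bullet> b) - of_int \<lfloor>t * (x \<bullet> b)\<rfloor>\<bar> / t \<le> 1 / t"
    using assms(1) by (intro divide_right_mono) linarith+
  moreover have "x \<bullet> b - grid_floor t x \<bullet> b = (t * (x \<bullet> b) - of_int \<lfloor>t * (x \<bullet> b)\<rfloor>) / t"
    unfolding grid_floor_inner[OF assms(2)] using assms(1) by (simp add: field_simps)
  ultimately show ?thesis using assms(1) by (simp add: abs_divide)
qed

lemma grid_floor_tendsto: "(\<lambda>n. grid_floor (real (n + 1)) x) \<longlonglongrightarrow> (x :: 'a::euclidean_space)"
proof -
  have "(\<lambda>n. x \<bullet> b - grid_floor (real (n + 1)) x \<bullet> b) \<longlonglongrightarrow> 0" if "b \<in> Basis" for b
  proof (rule Lim_null_comparison)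
    show "\<forall>\<^sub>F n in sequentially. norm (x \<bullet> b - grid_floor (real (n + 1)) x \<bullet> b) \<le> 1 / real (n + 1)"
      using grid_floor_error[OF _ that] by (intro always_eventually) auto
    show "(\<lambda>n. 1 / real (n + 1)) \<longlonglongrightarrow> 0" using LIMSEQ_inverse_real_of_nat by (simp add: inverse_eq_divide)
  qed
  then have "(\<lambda>n. \<Sum>b\<in>Basis. (x \<bullet> b - grid_floor (real (n + 1)) x \<bullet> b) *\<^sub>R b) \<longlonglongrightarrow> (\<Sum>b\<in>Basis. 0 *\<^sub>R b)"
    by (intro tendsto_sum tendsto_scaleR tendsto_const)
  then have "(\<lambda>n. x - grid_floor (real (n + 1)) x) \<longlonglongrightarrow> 0"
    by (simp add: euclidean_representation flip: inner_diff_left)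
  then have "(\<lambda>n. x - (x - grid_floor (real (n + 1)) x)) \<longlonglongrightarrow> x - 0"
    by (intro tendsto_diff tendsto_const)
  then show ?thesis by simp
qed

lemma bounded_components:
  assumes "bounded (S :: 'a::euclidean_space set)"
  obtains a where "a > 0" "\<And>x b. x \<in> S \<Longrightarrow> b \<in> Basis \<Longrightarrow> \<bar>x \<bullet> b\<bar> \<le> a"
proof -
  obtain a where "\<And>x. x \<in> S \<Longrightarrow> norm x \<le> a" using assms by (auto simp: bounded_iff)
  then have "\<bar>x \<bullet> b\<bar> \<le> \<bar>a\<bar> + 1" if "x \<in> S" "b \<in> Basis" for x b
    using Basis_le_norm[OF that(2), of x] that(1) by fastforce
  then show ?thesis by (intro that[of "\<bar>a\<bar> + 1"]) auto
qed

lemma finite_lattice_points: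
  assumes "bounded (S :: 'a::euclidean_space set)"
  shows "finite (lattice_points S)"
proof -
  obtain a where a: "\<And>x b. x \<in> S \<Longrightarrow> b \<in> Basis \<Longrightarrow> \<bar>x \<bullet> b\<bar> \<le> a"
    using bounded_components[OF assms] by metis
  have fin: "finite (Basis \<rightarrow>\<^sub>E (of_int ` {-\<lceil>a\<rceil>..\<lceil>a\<rceil>} :: real set))" by (intro finite_PiE) auto
  have sub: "(\<lambda>x. restrict (\<lambda>b. x \<bullet> b) Basis) ` lattice_points S \<subseteq> Basis \<rightarrow>\<^sub>E of_int ` {-\<lceil>a\<rceil>..\<lceil>a\<rceil>}"
  proof (intro image_subsetI restrict_PiE_iff[THEN iffD2] ballI)
    fix x b assume x: "x \<in> lattice_points S" and b: "b \<in> (Basis :: 'a set)"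
    then obtain k where k: "x \<bullet> b = of_int k" by (auto simp: lattice_points_def Ints_def)
    have "\<bar>of_int k\<bar> \<le> a" using a[OF _ b, of x] x k by (auto simp: lattice_points_def)
    then have "k \<in> {-\<lceil>a\<rceil>..\<lceil>a\<rceil>}" by (auto simp: abs_le_iff) linarith+
    then show "x \<bullet> b \<in> of_int ` {-\<lceil>a\<rceil>..\<lceil>a\<rceil>}" using k by auto
  qed
  have "finite ((\<lambda>x. restrict (\<lambda>b. x \<bullet> b) Basis) ` lattice_points S)" by (rule finite_subset[OF sub fin])
  moreover have "inj_on (\<lambda>x. restrict (\<lambda>b. x \<bullet> b) Basis) (lattice_points S)"
  proof (rule inj_onI)
    fix x y :: 'a assume eq: "restrict (\<lambda>b. x \<bullet> b) Basis = restrict (\<lambda>b. y \<bullet> b) Basis"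
    show "x = y"
    proof (rule euclidean_eqI)
      fix b :: 'a assume "b \<in> Basis"
      then show "x \<bullet> b = y \<bullet> b" using fun_cong[OF eq, of b] by simp
    qed
  qed
  ultimately show ?thesis by (rule finite_imageD)
qed

text \<open>Off the frontier, rounding does not change membership from some \<open>n\<close> on, and
  a convex set has a frontier of measure zero.\<close>

lemma AE_grid_floor_tendsto:
  fixes S :: "'a::euclidean_space set"
  assumes S: "open S" "convex S"
  shows "AE x in lborel. (\<lambda>n. indicator S (grid_floor (real (n + 1)) x) :: real) \<longlonglongrightarrow> indicator S x"
proof -
  have "frontier S \<in> null_sets lborel"
    using negligible_convex_frontier[OF S(2)] unfolding negligible_iff_null_sets
    by (subst (asm) null_sets_completion_iff) (auto intro: borel_closed)
  then have "AE x in lborel. x \<notin> frontier S" by (rule AE_not_in)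
  then show ?thesis
  proof eventually_elim
    case (elim x)
    show ?case
    proof (cases "x \<in> S")
      case True
      have "\<forall>\<^sub>F n in sequentially. grid_floor (real (n + 1)) x \<in> S"
        using topological_tendstoD[OF grid_floor_tendsto S(1) True] .
      then have "\<forall>\<^sub>F n in sequentially. indicator S (grid_floor (real (n + 1)) x) = (1 :: real)"
        by eventually_elim simp
      then show ?thesis using True by (simp add: tendsto_eventually)
    next
      case False
      then have "x \<in> - closure S" using elim S(1) by (auto simp: frontier_def interior_open)
      then have "\<forall>\<^sub>F n in sequentially. grid_floor (real (n + 1)) x \<in> - closure S"
        by (intro topological_tendstoD[OF grid_floor_tendsto]) auto
      then have "\<forall>\<^sub>F n in sequentially. indicator S (grid_floor (real (n + 1)) x) = (0 :: real)"
        by eventually_elim (use closure_subset[of S] in \<open>auto simp: indicator_def\<close>)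
      then show ?thesis using False by (simp add: tendsto_eventually)
    qed
  qed
qed

text \<open>For integral \<open>p\<close> and \<open>t > 0\<close> this is the half-open cube with
  lower corner \<open>p / t\<close>. As a fibre of the rounding map it is measurable, and different
  \<open>p\<close> give disjoint cubes.\<close>

definition grid_cube :: "real \<Rightarrow> 'a \<Rightarrow> 'a::euclidean_space set" where
  "grid_cube t p = {x. grid_floor t x = p /\<^sub>R t}"

lemma grid_cube_iff:
  assumes "t > 0" "\<forall>b\<in>Basis. p \<bullet> b \<in> \<int>"
  shows "x \<in> grid_cube t p \<longleftrightarrow> (\<forall>b\<in>Basis. p \<bullet> b / t \<le> x \<bullet> b \<and> x \<bullet> b < (p \<bullet> b + 1) / t)"
proof -
  have "x \<in> grid_cube t p \<longleftrightarrow> (\<forall>b\<in>Basis. of_int \<lfloor>t * (x \<bullet> b)\<rfloor> / t = p \<bullet> b / t)"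
    unfolding grid_cube_def mem_Collect_eq euclidean_eq_iff[where 'a='a]
    by (intro ball_cong refl) (simp add: grid_floor_inner divide_inverse_commute)
  also have "\<dots> \<longleftrightarrow> (\<forall>b\<in>Basis. p \<bullet> b / t \<le> x \<bullet> b \<and> x \<bullet> b < (p \<bullet> b + 1) / t)"
  proof (intro ball_cong refl)
    fix b :: 'a assume "b \<in> Basis"
    then obtain k where k: "p \<bullet> b = of_int k" using assms(2) by (auto simp: Ints_def)
    have "of_int \<lfloor>t * (x \<bullet> b)\<rfloor> / t = p \<bullet> b / t \<longleftrightarrow> \<lfloor>t * (x \<bullet> b)\<rfloor> = k"
      using assms(1) k by (simp add: divide_cancel_right)
    also have "\<dots> \<longleftrightarrow> of_int k \<le> t * (x \<bullet> b) \<and> t * (x \<bullet> b) < of_int k + 1"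
      by (simp add: floor_eq_iff)
    also have "\<dots> \<longleftrightarrow> p \<bullet> b / t \<le> x \<bullet> b \<and> x \<bullet> b < (p \<bullet> b + 1) / t"
      using assms(1) k by (simp add: field_simps)
    finally show "of_int \<lfloor>t * (x \<bullet> b)\<rfloor> / t = p \<bullet> b / t \<longleftrightarrow> p \<bullet> b / t \<le> x \<bullet> b \<and> x \<bullet> b < (p \<bullet> b + 1) / t" .
  qed
  finally show ?thesis .
qed

lemma measurable_grid_floor: "grid_floor t \<in> borel_measurable (lborel :: 'a::euclidean_space measure)"
  unfolding grid_floor_def by measurable

text \<open>The half-open cube lies between an open and a closed box of the same volume.\<close>

lemma measure_grid_cube:
  fixes p :: "'a::euclidean_space"
  assumes "t > 0" "\<forall>b\<in>Basis. p \<bullet> b \<in> \<int>"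
  shows "grid_cube t p \<in> sets lborel" "emeasure lborel (grid_cube t p) = ennreal ((1 / t) ^ DIM('a))"
proof -
  have "grid_cube t p = grid_floor t -` {p /\<^sub>R t} \<inter> space lborel" by (auto simp: grid_cube_def)
  also have "\<dots> \<in> sets lborel" by (rule measurable_sets[OF measurable_grid_floor]) simp
  finally show meas: "grid_cube t p \<in> sets lborel" .
  let ?u = "(p + One) /\<^sub>R t" and ?l = "p /\<^sub>R t"
  have sub: "box ?l ?u \<subseteq> grid_cube t p" "grid_cube t p \<subseteq> cbox ?l ?u"
    unfolding subset_iff grid_cube_iff[OF assms]
    by (auto simp: mem_box inner_add_left inverse_eq_divide less_imp_le)
  have le: "?l \<bullet> b \<le> ?u \<bullet> b" if "b \<in> Basis" for b
    using that assms(1) by (simp add: inner_add_left mult_left_mono)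
  have "(\<Prod>b\<in>Basis. (?u - ?l) \<bullet> b) = (\<Prod>b\<in>(Basis :: 'a set). 1 / t)"
    by (intro prod.cong refl) (simp add: inner_diff_left inner_add_left field_simps)
  then have vol: "(\<Prod>b\<in>Basis. (?u - ?l) \<bullet> b) = (1 / t) ^ DIM('a)" by simp
  show "emeasure lborel (grid_cube t p) = ennreal ((1 / t) ^ DIM('a))"
  proof (rule antisym)
    show "emeasure lborel (grid_cube t p) \<le> ennreal ((1 / t) ^ DIM('a))"
      using emeasure_mono[OF sub(2), of lborel] emeasure_lborel_cbox[OF le] vol by simp
    show "ennreal ((1 / t) ^ DIM('a)) \<le> emeasure lborel (grid_cube t p)"
      using emeasure_mono[OF sub(1) meas] emeasure_lborel_box[OF le] vol by simp
  qed
qed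

lemma integral_grid_floor:
  fixes S :: "'a::euclidean_space set"
  assumes S: "bounded S" and t: "t > 0"
  shows "integral\<^sup>L lborel (\<lambda>x. indicator S (grid_floor t x) :: real)
    = real (card (lattice_points ((*\<^sub>R) t ` S))) / t ^ DIM('a)"
proof -
  let ?P = "lattice_points ((*\<^sub>R) t ` S)"
  have fin: "finite ?P" by (intro finite_lattice_points bounded_scaling S)
  have P: "\<forall>b\<in>Basis. p \<bullet> b \<in> \<int>" if "p \<in> ?P" for p using that by (auto simp: lattice_points_def)
  have "(indicator S (grid_floor t x) :: real) = (\<Sum>p\<in>?P. indicator (grid_cube t p) x)" for x
  proof (cases "grid_floor t x \<in> S")
    case True
    let ?p = "t *\<^sub>R grid_floor t x"
    have p: "?p \<in> ?P" using True t by (auto simp: lattice_points_def grid_floor_inner)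
    have "indicator (grid_cube t p) x = (if p = ?p then 1 else 0 :: real)" for p
      using t by (auto simp: grid_cube_def indicator_def)
    then show ?thesis using True p fin by simp
  next
    case False
    have "x \<notin> grid_cube t p" if "p \<in> ?P" for p
      using that False t by (auto simp: grid_cube_def lattice_points_def)
    then show ?thesis using False by simp
  qed
  then have "integral\<^sup>L lborel (\<lambda>x. indicator S (grid_floor t x) :: real)
      = integral\<^sup>L lborel (\<lambda>x. \<Sum>p\<in>?P. indicator (grid_cube t p) x)" by simp
  also have "\<dots> = (\<Sum>p\<in>?P. integral\<^sup>L lborel (indicator (grid_cube t p)))"
    using measure_grid_cube[OF t P] by (intro Bochner_Integration.integral_sum) auto
  also have "\<dots> = (\<Sum>p\<in>?P. (1 / t) ^ DIM('a))"
    using measure_grid_cube[OF t P] t by (intro sum.cong refl) (simp add: measure_def)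
  also have "\<dots> = real (card ?P) / t ^ DIM('a)" by (simp add: power_one_over)
  finally show ?thesis .
qed

text \<open>Dominated convergence for the indicator after rounding. It is stated in any dimension
  because it serves both the board in the plane and the three-dimensional
  \<open>pair_body\<close>.\<close>

theorem lattice_points_tendsto:
  fixes S :: "'a::euclidean_space set"
  assumes S: "open S" "convex S" "bounded S"
  shows "(\<lambda>n. real (card (lattice_points ((*\<^sub>R) (real (n + 1)) ` S))) / real (n + 1) ^ DIM('a))
    \<longlonglongrightarrow> measure lebesgue S"
proof -
  obtain a where a: "a > 0" "\<And>x b. x \<in> S \<Longrightarrow> b \<in> Basis \<Longrightarrow> \<bar>x \<bullet> b\<bar> \<le> a"
    using bounded_components[OF S(3)] by metis
  \<comment> \<open>A point whose rounding lies in \<open>S\<close> has coordinates of size at most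
    \<open>a + 1 / (n + 1)\<close>, so this box dominates for all \<open>n\<close>.\<close>
  let ?Q = "cbox (- ((a + 1) *\<^sub>R One)) ((a + 1) *\<^sub>R One) :: 'a set"
  have "(\<lambda>n. integral\<^sup>L lborel (\<lambda>x. indicator S (grid_floor (real (n + 1)) x) :: real))
      \<longlonglongrightarrow> integral\<^sup>L lborel (indicator S)"
  proof (rule integral_dominated_convergence[where w = "indicator ?Q"])
    show "indicator S \<in> borel_measurable (lborel :: 'a measure)"
      using S(1) by (intro borel_measurable_indicator) auto
    show "(\<lambda>x. indicator S (grid_floor (real (n + 1)) x) :: real) \<in> borel_measurable lborel" for n
      by (rule measurable_compose[OF measurable_grid_floor]) (use S(1) in \<open>intro borel_measurable_indicator; auto\<close>)
    show "integrable lborel (indicator ?Q :: 'a \<Rightarrow> real)"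
      using emeasure_lborel_cbox_finite by (intro integrable_real_indicator) auto
    show "AE x in lborel. norm (indicator S (grid_floor (real (n + 1)) x) :: real) \<le> indicator ?Q x" for n
    proof (intro AE_I2)
      fix x :: 'a
      show "norm (indicator S (grid_floor (real (n + 1)) x) :: real) \<le> indicator ?Q x"
      proof (cases "grid_floor (real (n + 1)) x \<in> S")
        case True
        have "\<bar>x \<bullet> b\<bar> \<le> a + 1" if "b \<in> Basis" for b
        proof -
          have "\<bar>x \<bullet> b - grid_floor (real (n + 1)) x \<bullet> b\<bar> \<le> 1 / real (n + 1)"
            by (rule grid_floor_error[OF _ that]) simp
          also have "\<dots> \<le> 1" by simp
          finally show ?thesis using a(2)[OF True that] by linarith
        qed
        then have "x \<in> ?Q" by (fastforce simp: mem_box abs_le_iff)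
        then show ?thesis by (simp add: indicator_def)
      qed simp
    qed
    show "AE x in lborel. (\<lambda>n. indicator S (grid_floor (real (n + 1)) x) :: real) \<longlonglongrightarrow> indicator S x"
      by (rule AE_grid_floor_tendsto[OF S(1,2)])
  qed
  moreover have "integral\<^sup>L lborel (indicator S) = measure lebesgue S"
    using S(1) by simp
  ultimately show ?thesis
    using integral_grid_floor[OF S(3)] by simp
qed

subsection \<open>Points of the board\<close>

lemma polygonD:
  assumes "rational_polygon B"
  shows "convex B" "bounded B" "open (interior B)" "convex (interior B)" "bounded (interior B)" "interior B \<noteq> {}"
proof -
  have "polytope B" "interior B \<noteq> {}" using assms by (auto simp: rational_polygon_def)
  then show "convex B" "bounded B" "open (interior B)" "convex (interior B)" "bounded (interior B)" "interior B \<noteq> {}"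
    using polytope_imp_convex polytope_imp_bounded convex_interior bounded_interior by auto
qed

lemma integral_point_iff: "integral_point p \<longleftrightarrow> (\<forall>b\<in>Basis. p \<bullet> b \<in> \<int>)"
  by (auto simp: integral_point_def Basis_prod_def inner_prod_def)

lemma board_points_eq: "board_points B n = lattice_points ((*\<^sub>R) (real (n + 1)) ` interior B)"
  by (auto simp: board_points_def lattice_points_def integral_point_iff)

lemma finite_board_points: "rational_polygon B \<Longrightarrow> finite (board_points B n)"
  unfolding board_points_eq by (intro finite_lattice_points bounded_scaling polygonD)

lemma vol_interior:
  assumes "rational_polygon B"
  shows "vol B = measure lebesgue (interior B)"
  unfolding vol_def using polygonD(1,2)[OF assms]
  by (intro measure_interior[symmetric] negligible_convex_frontier)

lemma vol_pos:
  assumes "rational_polygon B"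
  shows "vol B > 0"
proof -
  have "\<not> negligible (interior B)" using polygonD[OF assms] open_not_negligible by blast
  moreover have "interior B \<in> lmeasurable" using polygonD[OF assms] by (simp add: measurable_convex)
  ultimately have "measure lebesgue (interior B) \<noteq> 0" by (simp add: negligible_iff_measure)
  then show ?thesis unfolding vol_interior[OF assms] by (simp add: zero_less_measure_iff)
qed

text \<open>Lattice points are counted in the dilation by \<open>n + 1\<close>, whereas constituents
  are polynomials in \<open>n\<close>.\<close>

lemma tendsto_shift_power:
  assumes "(\<lambda>n. f n / real (n + 1) ^ d) \<longlonglongrightarrow> L"
  shows "(\<lambda>n. f n / real n ^ d) \<longlonglongrightarrow> L"
proof -
  have "(\<lambda>n. 1 + 1 / real n) \<longlonglongrightarrow> 1 + 0" by (intro tendsto_add tendsto_const lim_1_over_n)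
  then have "(\<lambda>n. f n / real (n + 1) ^ d * (1 + 1 / real n) ^ d) \<longlonglongrightarrow> L * (1 + 0) ^ d"
    by (intro tendsto_mult assms tendsto_power)
  moreover have "\<forall>\<^sub>F n in sequentially. f n / real (n + 1) ^ d * (1 + 1 / real n) ^ d = f n / real n ^ d"
    using eventually_gt_at_top[of 0]
  proof eventually_elim
    case (elim n)
    then have "1 + 1 / real n = real (n + 1) / real n" by (simp add: field_simps)
    then show ?case by (simp add: power_divide)
  qed
  ultimately show ?thesis by (simp add: filterlim_cong)
qed

lemma num_points_tendsto:
  assumes "rational_polygon B"
  shows "(\<lambda>n. num_points B n / real (n + 1) ^ 2) \<longlonglongrightarrow> vol B"
  using lattice_points_tendsto[OF polygonD(3,4,5)[OF assms]]
  by (simp add: vol_interior[OF assms] num_points_def board_points_eq power2_eq_square)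

lemma board_points_bound:
  assumes "rational_polygon B"
  obtains R where "R > 0" "\<And>n p. p \<in> board_points B n \<Longrightarrow> \<bar>fst p\<bar> \<le> R * real (n + 1) \<and> \<bar>snd p\<bar> \<le> R * real (n + 1)"
proof -
  obtain a where a: "a > 0" "\<And>x b. x \<in> interior B \<Longrightarrow> b \<in> Basis \<Longrightarrow> \<bar>x \<bullet> b\<bar> \<le> a"
    using bounded_components[OF polygonD(5)[OF assms]] by metis
  have "\<bar>fst p\<bar> \<le> a * real (n + 1) \<and> \<bar>snd p\<bar> \<le> a * real (n + 1)" if p: "p \<in> board_points B n" for n p
  proof -
    obtain x where x: "x \<in> interior B" "p = real (n + 1) *\<^sub>R x" using p by (auto simp: board_points_def)
    have "\<bar>fst x\<bar> \<le> a" "\<bar>snd x\<bar> \<le> a"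
      using a(2)[OF x(1), of "(1, 0)"] a(2)[OF x(1), of "(0, 1)"] by (auto simp: Basis_prod_def inner_prod_def)
    then show ?thesis unfolding x(2)
      by (auto simp: abs_mult mult.commute[of _ "1 + real n"] simp flip: of_nat_Suc intro!: mult_left_mono)
  qed
  with a(1) that show ?thesis by blast
qed

lemma board_points_Ints: "p \<in> board_points B n \<Longrightarrow> fst p \<in> \<int> \<and> snd p \<in> \<int>"
  by (simp add: board_points_def integral_point_def)

section \<open>Upper and lower bounds for the subspace counts\<close>

definition int_range :: "real \<Rightarrow> real set" where
  "int_range a = {x \<in> \<int>. \<bar>x\<bar> \<le> a}"

lemma int_range: "finite (int_range a)" "a \<ge> 0 \<Longrightarrow> real (card (int_range a)) \<le> 2 * a + 1"
proof -
  have eq: "int_range a = of_int ` {-\<lfloor>a\<rfloor>..\<lfloor>a\<rfloor>}"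
  proof (intro equalityI subsetI)
    fix x assume "x \<in> int_range a"
    then obtain k where k: "x = of_int k" "\<bar>of_int k\<bar> \<le> a" by (auto simp: int_range_def Ints_def)
    then have "k \<in> {-\<lfloor>a\<rfloor>..\<lfloor>a\<rfloor>}" by (auto simp: le_floor_iff minus_le_iff abs_le_iff)
    with k(1) show "x \<in> of_int ` {-\<lfloor>a\<rfloor>..\<lfloor>a\<rfloor>}" by blast
  next
    fix x assume "x \<in> (of_int ` {-\<lfloor>a\<rfloor>..\<lfloor>a\<rfloor>} :: real set)"
    then show "x \<in> int_range a" by (auto simp: int_range_def le_floor_iff minus_le_iff abs_le_iff)
  qed
  then show "finite (int_range a)" by simp
  assume "a \<ge> 0"
  have "card (int_range a) = card {-\<lfloor>a\<rfloor>..\<lfloor>a\<rfloor>}"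
    unfolding eq by (rule card_image) (auto simp: inj_on_def)
  then have "real (card (int_range a)) = 2 * of_int \<lfloor>a\<rfloor> + 1" using \<open>a \<ge> 0\<close> by simp
  then show "real (card (int_range a)) \<le> 2 * a + 1" by linarith
qed

text \<open>Lattice points of the essential part are determined by \<open>2 \<kappa> - \<nu>\<close> of their coordinates.\<close>

lemma subspace_count_bound:
  assumes M: "finite M" "(0, 0) \<notin> M" and U: "U \<in> intersection_lattice M q" and B: "rational_polygon B"
  shows "\<exists>K. \<forall>n. real (subspace_count M B q U n) \<le> K * (real n + 1) ^ (2 * card (involved M q U) - codim q U)"
proof -
  let ?C = "implied M q U"
  define I where "I = involved M q U"
  have I: "I = touched ?C" "finite I"
    unfolding I_def by (rule involved_eq[OF lattice_subset_space[OF U]]) simp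
  let ?X = "configs_on I \<inter> solutions ?C"
  obtain F where F: "F \<subseteq> ?C" "solutions F = solutions ?C" "card F = codim q U" "finite F"
    by (rule codim_basis[OF M(1) U])
  have FI: "F \<subseteq> labels M I"
    using labels_touched[OF order_trans[OF F(1) implied_labels], of I] codim_touched[OF M U F(1,2)] I_def by simp
  \<comment> \<open>Passing to the space of the involved pieces keeps the number of independent
    labels: the size of \<open>G\<close> is squeezed between the codimension of \<open>U\<close> and
    the size of \<open>F\<close>.\<close>
  obtain G where G: "G \<subseteq> F" "solutions G = solutions F" "dim (configs_on I \<inter> solutions F) + card G = 2 * card I"
    using solutions_rank[OF FI F(4) I(2)] by blast
  have "codim q U \<le> card G"
    using G(2) F(2) order_trans[OF order_trans[OF G(1) F(1)] implied_labels]
    by (intro codim_le_card[OF M(1) _ _ U]) simp_all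
  moreover have "card G \<le> card F" using G(1) F(4) by (rule card_mono[rotated])
  ultimately have dimX: "dim ?X = 2 * card I - codim q U" using G(3) F by simp
  have subX: "subspace ?X"
  proof -
    have "?X = configs_on I \<inter> {z. \<forall>l\<in>?C. label_form l z = 0}"
      using label_form_eq_0[OF implied_labels[of M q U, THEN subsetD]] by (auto simp: solutions_def)
    also have "subspace \<dots>"
      using subspace_configs_on[of I] linear_label_form
      by (intro subspace_inter) (auto simp: subspace_def linear_0 linear_add linear_scale)
    finally show ?thesis .
  qed
  define f where "f = (\<lambda>(i, b) z. pos z i \<bullet> (b :: real \<times> real))"
  define S where "S = I \<times> {(1, 0), (0, 1) :: real \<times> real}"
  have finS: "finite S" using I(2) by (simp add: S_def)
  have lin: "linear (f k)" for k unfolding f_def by (cases k) (simp add: linear_pos)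
  \<comment> \<open>All coordinates together separate the points of \<open>?X\<close>, so
    \<open>dim ?X\<close> suitable ones already do.\<close>
  have "\<exists>J\<subseteq>S. {x \<in> ?X. \<forall>i\<in>J. f i x = 0} = {x \<in> ?X. \<forall>i\<in>S. f i x = 0} \<and>
      dim {x \<in> ?X. \<forall>i\<in>S. f i x = 0} + card J = dim ?X"
    by (rule dim_common_kernel[OF subX _ finite_unit_configs[OF I(2)] finS lin])
      (use configs_on_span[OF I(2)] in auto)
  then obtain J where J: "J \<subseteq> S" "{x \<in> ?X. \<forall>i\<in>J. f i x = 0} = {x \<in> ?X. \<forall>i\<in>S. f i x = 0}"
    "dim {x \<in> ?X. \<forall>i\<in>S. f i x = 0} + card J = dim ?X" by blast
  have triv: "{x \<in> ?X. \<forall>i\<in>S. f i x = 0} = {0}"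
  proof (intro equalityI subsetI)
    fix x assume x: "x \<in> {x \<in> ?X. \<forall>i\<in>S. f i x = 0}"
    have "pos x i = 0" for i
    proof (cases "i \<in> I")
      case True
      then have "f (i, (1, 0)) x = 0" "f (i, (0, 1)) x = 0" using x by (auto simp: S_def)
      then show ?thesis by (simp add: f_def inner_prod_def prod_eq_iff)
    qed (use x in \<open>simp add: configs_on_def\<close>)
    then show "x \<in> {0}" by (auto intro: poly_mapping_eqI)
  qed (use subX subspace_0 in \<open>auto simp: f_def\<close>)
  have "dim {0 :: config} = 0"
    using real_vector.dim_span[of "{} :: config set"] real_vector.dim_eq_card_independent[OF real_vector.independent_empty]
    by (simp add: real_vector.span_empty)
  then have cardJ: "card J = 2 * card I - codim q U" using J(3) triv dimX by simp
  have finJ: "finite J" using J(1) finS by (rule finite_subset)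
  obtain R where R: "R > 0" "\<And>n p. p \<in> board_points B n \<Longrightarrow> \<bar>fst p\<bar> \<le> R * real (n + 1) \<and> \<bar>snd p\<bar> \<le> R * real (n + 1)"
    using board_points_bound[OF B] by metis
  have "real (subspace_count M B q U n) \<le> (2 * R + 1) ^ card J * (real n + 1) ^ card J" for n
  proof -
    let ?G = "grid_configs I ?C (board_points B n)"
    let ?h = "\<lambda>z. restrict (\<lambda>k. f k z) J"
    let ?D = "int_range (R * real (n + 1))"
    have "inj_on ?h ?G"
    proof (rule inj_onI)
      fix z z' assume z: "z \<in> ?G" "z' \<in> ?G" and eq: "?h z = ?h z'"
      have "z - z' \<in> ?X" using z by (intro subspace_diff[OF subX]) (auto simp: grid_configs_def)
      moreover have "f k (z - z') = 0" if "k \<in> J" for k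
        using fun_cong[OF eq, of k] that by (simp add: linear_diff[OF lin])
      ultimately have "z - z' \<in> {0}" using J(2) triv by blast
      then show "z = z'" by simp
    qed
    moreover have "?h ` ?G \<subseteq> J \<rightarrow>\<^sub>E ?D"
    proof (rule image_subsetI)
      fix z assume z: "z \<in> ?G"
      have "f k z \<in> ?D" if kJ: "k \<in> J" for k
      proof -
        have "k \<in> S" using kJ J(1) by blast
        then obtain i b where k: "k = (i, b)" "i \<in> I" "b = (1, 0) \<or> b = (0, 1)" by (auto simp: S_def)
        then have "pos z i \<in> board_points B n" using z by (simp add: grid_configs_def)
        then show ?thesis
          using R(2)[of "pos z i" n] board_points_Ints[of "pos z i" B n] k
          by (auto simp: int_range_def f_def inner_prod_def)
      qed
      then show "?h z \<in> J \<rightarrow>\<^sub>E ?D" by auto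
    qed
    ultimately have "card ?G \<le> card (J \<rightarrow>\<^sub>E ?D)"
      using finJ int_range(1) by (intro card_inj_on_le[of ?h]) (auto intro: finite_PiE)
    also have "\<dots> = card ?D ^ card J" using finJ by (simp add: card_funcsetE)
    finally have "real (card ?G) \<le> real (card ?D) ^ card J" by (simp flip: of_nat_power)
    also have "\<dots> \<le> ((2 * R + 1) * (real n + 1)) ^ card J"
    proof (rule power_mono)
      have "real (card ?D) \<le> 2 * (R * real (n + 1)) + 1" using R(1) by (intro int_range) auto
      also have "\<dots> \<le> (2 * R + 1) * (real n + 1)" by (simp add: algebra_simps)
      finally show "real (card ?D) \<le> (2 * R + 1) * (real n + 1)" .
    qed simp
    finally show ?thesis by (simp add: subspace_count_eq[OF U] power_mult_distrib flip: I(1))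
  qed
  then show ?thesis unfolding cardJ I_def by blast
qed

text \<open>
  Cauchy-Schwarz: each pair \<open>(x, x')\<close> of placements of the first and of the second pieces of all
  labels that has the same values of the linear forms is a solution, and there are at most
  \<open>card Y ^ card F\<close> tuples of values.
\<close>

lemma matching_count_ge:
  assumes F: "F \<subseteq> labels M A" "finite F" "matching F"
    and G: "finite G" and Y: "finite Y" "\<And>p l. p \<in> G \<Longrightarrow> l \<in> F \<Longrightarrow> p \<bullet> perp (fst l) \<in> Y"
  shows "real (card G) ^ (2 * card F) \<le> real (card Y) ^ card F * real (card (grid_configs (touched F) F G))"
proof -
  define X where "X = F \<rightarrow>\<^sub>E G"
  define h where "h = (\<lambda>x. restrict (\<lambda>l. (x l :: real \<times> real) \<bullet> perp (fst l)) F)"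
  define Z where "Z = (F \<rightarrow>\<^sub>E Y :: (label \<Rightarrow> real) set)"
  have finX: "finite X" unfolding X_def using F(2) G by (intro finite_PiE) auto
  have finZ: "finite Z" unfolding Z_def using F(2) Y(1) by (intro finite_PiE) auto
  have hZ: "h ` X \<subseteq> Z"
  proof (rule image_subsetI)
    fix x assume "x \<in> X"
    then have "x l \<bullet> perp (fst l) \<in> Y" if "l \<in> F" for l
      using that by (intro Y(2)) (auto simp: X_def simp del: split_paired_All)
    then show "h x \<in> Z" unfolding h_def Z_def restrict_PiE_iff by blast
  qed
  \<comment> \<open>The sizes of the fibres of \<open>h\<close>: their sum counts all
    \<open>x\<close>, and the sum of their squares counts the pairs with equal values.\<close>
  define c where "c y = card {x \<in> X. h x = y}" for y
  let ?P = "{(x, x'). x \<in> X \<and> x' \<in> X \<and> h x = h x'}"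
  have "(\<Sum>y\<in>Z. real (c y)) = real (card X)"
  proof -
    have "(\<Sum>y\<in>Z. c y) = (\<Sum>y\<in>Z. \<Sum>x | x \<in> X \<and> h x = y. 1)" by (simp add: c_def)
    also have "\<dots> = (\<Sum>x\<in>X. 1)" by (rule sum.group[OF finX finZ hZ])
    finally show ?thesis by (simp flip: of_nat_sum)
  qed
  moreover have "(\<Sum>y\<in>Z. real (c y)) ^ 2 \<le> (\<Sum>y\<in>Z. (real (c y))\<^sup>2) * real (card Z)"
    by (rule sum_squared_le_sum_of_squares)
  moreover have "(\<Sum>y\<in>Z. (real (c y))\<^sup>2) = real (card ?P)"
  proof -
    have "?P = (\<Union>y\<in>Z. {x \<in> X. h x = y} \<times> {x \<in> X. h x = y})" using hZ by auto
    also have "card \<dots> = (\<Sum>y\<in>Z. card ({x \<in> X. h x = y} \<times> {x \<in> X. h x = y}))"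
      using finX finZ by (intro card_UN_disjoint) auto
    finally show ?thesis by (simp add: c_def card_cartesian_product power2_eq_square)
  qed
  moreover have "card ?P \<le> card (grid_configs (touched F) F G)"
  proof -
    \<comment> \<open>In a matching each touched piece belongs to exactly one label.\<close>
    define lab where "lab i = (THE l. l \<in> F \<and> i \<in> snd l)" for i
    have lab: "lab i = l" if "l \<in> F" "i \<in> snd l" for i l
      unfolding lab_def using that F(3) by (intro the_equality) (auto simp: matching_def)
    have two: "\<exists>i j. snd l = {i, j} \<and> i < j \<and> Min (snd l) = i" if l: "l \<in> F" for l
    proof -
      have "card (snd l) = 2" using l F(1) by (auto simp: labels_def)
      then obtain i j where "snd l = {i, j}" "i < j"
        by (auto simp: card_2_iff) (metis insert_commute linorder_neqE_nat)
      then show ?thesis by (intro exI[of _ i] exI[of _ j]) simp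
    qed
    let ?T = "touched F"
    have finT: "finite ?T" by (rule finite_touched[OF F(1,2)])
    \<comment> \<open>The smaller piece of a label is placed by \<open>x\<close>, the other one by
      \<open>x'\<close>; equality of \<open>h x\<close> and \<open>h x'\<close> then says that the
      label is satisfied.\<close>
    define g where "g = (\<lambda>(x, x'). config_of ?T (\<lambda>i. if i = Min (snd (lab i)) then x (lab i) else x' (lab i) :: real \<times> real))"
    have inT: "i \<in> ?T" if "l \<in> F" "i \<in> snd l" for i l using that by (auto simp: touched_def)
    have vals: "pos (g (x, x')) (Min (snd l)) = x l \<and> (\<forall>j\<in>snd l. j \<noteq> Min (snd l) \<longrightarrow> pos (g (x, x')) j = x' l)"
      if l: "l \<in> F" for x x' l
    proof -
      obtain i j where ij: "snd l = {i, j}" "i < j" "Min (snd l) = i" using two[OF l] by blast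
      then have "lab i = l" "lab j = l" "i \<in> ?T" "j \<in> ?T" using lab[OF l] inT[OF l] by blast+
      then show ?thesis using ij finT by (auto simp: g_def pos_config_of)
    qed
    have "inj_on g ?P"
    proof (rule inj_onI)
      fix a b assume "a \<in> ?P" "b \<in> ?P" and eq: "g a = g b"
      then obtain x x' y y' where ab: "a = (x, x')" "b = (y, y')" "x \<in> X" "x' \<in> X" "y \<in> X" "y' \<in> X" by auto
      have "x l = y l \<and> x' l = y' l" if l: "l \<in> F" for l
      proof -
        obtain i j where ij: "snd l = {i, j}" "i < j" "Min (snd l) = i" using two[OF l] by blast
        then have "j \<in> snd l" "j \<noteq> Min (snd l)" by auto
        then show ?thesis using vals[OF l, of x x'] vals[OF l, of y y'] eq ab(1,2) by metis
      qed
      then show "a = b" using ab PiE_ext unfolding X_def by (metis (no_types, lifting))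
    qed
    moreover have "g ` ?P \<subseteq> grid_configs ?T F G"
    proof (rule image_subsetI)
      fix a assume "a \<in> ?P"
      then obtain x x' where a: "a = (x, x')" "x \<in> X" "x' \<in> X" "h x = h x'" by auto
      have sat: "sat (g a) l" if l: "l \<in> F" for l
      proof -
        obtain i j where ij: "snd l = {i, j}" "i < j" "Min (snd l) = i" using two[OF l] by blast
        then have "pos (g a) i = x l" "pos (g a) j = x' l" using vals[OF l, of x x'] a(1) by auto
        moreover have "x l \<bullet> perp (fst l) = x' l \<bullet> perp (fst l)"
          using fun_cong[OF a(4), of l] l by (simp add: h_def)
        ultimately show ?thesis using ij(1) sat_doubleton[of "g a" "fst l" i j]
          by (metis inner_diff_left prod.collapse right_minus_eq)
      qed
      have "pos (g a) i \<in> G" if i: "i \<in> ?T" for i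
      proof -
        obtain l where l: "l \<in> F" "i \<in> snd l" using i unfolding touched_def by blast
        then have "x l \<in> G" "x' l \<in> G" using a(2,3) by (auto simp: X_def simp del: split_paired_All)
        moreover have "pos (g a) i = (if i = Min (snd l) then x l else x' l)"
          unfolding a(1) g_def prod.case pos_config_of[OF finT] lab[OF l] using i by simp
        ultimately show ?thesis by simp
      qed
      then show "g a \<in> grid_configs ?T F G"
        using sat finT by (auto simp: grid_configs_def solutions_def a(1) g_def)
    qed
    ultimately show ?thesis
      using finite_grid_configs[OF finT G] by (intro card_inj_on_le[of g]) auto
  qed
  moreover have "real (card X) ^ 2 = real (card G) ^ (2 * card F)" "card Z = card Y ^ card F"
    unfolding X_def Z_def using F(2) by (simp_all add: card_funcsetE power_mult[symmetric] mult.commute)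
  ultimately have "real (card G) ^ (2 * card F) \<le> real (card ?P) * real (card Y) ^ card F"
    by simp
  also have "\<dots> \<le> real (card (grid_configs (touched F) F G)) * real (card Y) ^ card F"
    using \<open>card ?P \<le> _\<close> by (intro mult_right_mono) auto
  finally show ?thesis by (simp add: mult.commute)
qed

lemma perp_bound:
  assumes "\<bar>fst p\<bar> \<le> a" "\<bar>snd p\<bar> \<le> a"
  shows "\<bar>p \<bullet> perp m\<bar> \<le> a * real_of_int (\<bar>fst m\<bar> + \<bar>snd m\<bar>)"
proof -
  have "\<bar>p \<bullet> perp m\<bar> \<le> \<bar>fst p\<bar> * \<bar>real_of_int (snd m)\<bar> + \<bar>snd p\<bar> * \<bar>real_of_int (fst m)\<bar>"
    unfolding perp_def inner_prod_def by (simp add: abs_mult[symmetric] abs_triangle_ineq4)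
  also have "\<dots> \<le> a * \<bar>real_of_int (snd m)\<bar> + a * \<bar>real_of_int (fst m)\<bar>"
    using assms by (intro add_mono mult_right_mono) auto
  finally show ?thesis by (simp add: algebra_simps)
qed

text \<open>With \<open>k = card F\<close>, the power \<open>N^(2 k)\<close> has order
  \<open>n^(4 k)\<close>, while each linear form takes \<open>O(n)\<close> values on the board.
  Dividing in \<open>matching_count_ge\<close> leaves the order \<open>n^(4 k - k)\<close>.\<close>

lemma matching_count_lower:
  assumes M: "finite M" and B: "rational_polygon B"
    and F: "F \<subseteq> labels M A" "finite F" "matching F"
  shows "\<exists>a>0. \<forall>\<^sub>F n in sequentially.
    real (card (grid_configs (touched F) F (board_points B n))) \<ge> a * real n ^ (3 * card F)"
proof -
  let ?k = "card F"
  obtain R where R: "R > 0" "\<And>n p. p \<in> board_points B n \<Longrightarrow> \<bar>fst p\<bar> \<le> R * real (n + 1) \<and> \<bar>snd p\<bar> \<le> R * real (n + 1)"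
    using board_points_bound[OF B] by metis
  define s where "s = (\<Sum>m\<in>M. real_of_int (\<bar>fst m\<bar> + \<bar>snd m\<bar>))"
  have s: "real_of_int (\<bar>fst m\<bar> + \<bar>snd m\<bar>) \<le> s" if "m \<in> M" for m
    unfolding s_def using M that by (intro member_le_sum) auto
  have "s \<ge> 0" unfolding s_def by (intro sum_nonneg) auto
  \<comment> \<open>With \<open>t = n + 1 \<ge> 1\<close>, a form takes at most
    \<open>2 * R * t * s + 1\<close> values, and this is at most \<open>K * t\<close>.\<close>
  define K where "K = 2 * R * s + 1"
  have K: "K > 0" using R(1) \<open>s \<ge> 0\<close> by (simp add: K_def add_nonneg_pos)
  have *: "num_points B n ^ (2 * ?k) \<le> (K * real (n + 1)) ^ ?k * real (card (grid_configs (touched F) F (board_points B n)))" for n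
  proof -
    let ?Y = "int_range (R * real (n + 1) * s)"
    have "real (card (board_points B n)) ^ (2 * ?k)
        \<le> real (card ?Y) ^ ?k * real (card (grid_configs (touched F) F (board_points B n)))"
    proof (rule matching_count_ge[OF F finite_board_points[OF B] int_range(1)])
      fix p l assume p: "p \<in> board_points B n" and l: "l \<in> F"
      have m: "fst l \<in> M" using l F(1) by (auto simp: labels_def)
      have "\<bar>p \<bullet> perp (fst l)\<bar> \<le> R * real (n + 1) * real_of_int (\<bar>fst (fst l)\<bar> + \<bar>snd (fst l)\<bar>)"
        using R(2)[OF p] by (intro perp_bound) auto
      also have "\<dots> \<le> R * real (n + 1) * s"
        using R(1) s[OF m] by (intro mult_left_mono) auto
      finally have "\<bar>p \<bullet> perp (fst l)\<bar> \<le> R * real (n + 1) * s" .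
      moreover have "p \<bullet> perp (fst l) \<in> \<int>"
        using board_points_Ints[OF p] by (auto simp: perp_def inner_prod_def)
      ultimately show "p \<bullet> perp (fst l) \<in> ?Y" by (simp add: int_range_def)
    qed
    also have "\<dots> \<le> (K * real (n + 1)) ^ ?k * real (card (grid_configs (touched F) F (board_points B n)))"
    proof (intro mult_right_mono power_mono)
      have "real (card ?Y) \<le> 2 * (R * real (n + 1) * s) + 1"
        using R(1) \<open>s \<ge> 0\<close> by (intro int_range) auto
      also have "\<dots> \<le> K * real (n + 1)" by (simp add: K_def algebra_simps)
      finally show "real (card ?Y) \<le> K * real (n + 1)" .
    qed auto
    finally show ?thesis by (simp add: num_points_def)
  qed
  define v where "v = vol B / 2"
  have v: "v > 0" using vol_pos[OF B] by (simp add: v_def)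
  have "\<forall>\<^sub>F n in sequentially. num_points B n / real (n + 1) ^ 2 > v"
    using order_tendstoD(1)[OF num_points_tendsto[OF B], of v] vol_pos[OF B] by (simp add: v_def)
  then have "\<forall>\<^sub>F n in sequentially.
    real (card (grid_configs (touched F) F (board_points B n))) \<ge> (v ^ (2 * ?k) / K ^ ?k) * real n ^ (3 * ?k)"
  proof eventually_elim
    case (elim n)
    let ?t = "real (n + 1)" and ?c = "real (card (grid_configs (touched F) F (board_points B n)))"
    have "v * ?t ^ 2 \<le> num_points B n" using elim by (simp add: field_simps)
    then have "(v * ?t ^ 2) ^ (2 * ?k) \<le> num_points B n ^ (2 * ?k)"
      using v by (intro power_mono) auto
    then have "(v * ?t ^ 2) ^ (2 * ?k) \<le> (K * ?t) ^ ?k * ?c" using *[of n] by linarith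
    moreover have "(v * ?t ^ 2) ^ (2 * ?k) = v ^ (2 * ?k) * ?t ^ (3 * ?k) * ?t ^ ?k"
    proof -
      have "(?t ^ 2) ^ (2 * ?k) = ?t ^ (3 * ?k + ?k)" by (simp flip: power_mult)
      then show ?thesis by (simp only: power_mult_distrib power_add mult.assoc)
    qed
    moreover have "(K * ?t) ^ ?k * ?c = K ^ ?k * ?c * ?t ^ ?k" by (simp add: power_mult_distrib)
    ultimately have "v ^ (2 * ?k) * ?t ^ (3 * ?k) * ?t ^ ?k \<le> K ^ ?k * ?c * ?t ^ ?k" by (simp only:)
    then have "v ^ (2 * ?k) * ?t ^ (3 * ?k) \<le> K ^ ?k * ?c" by (rule mult_right_le_imp_le) simp
    moreover have "v ^ (2 * ?k) * real n ^ (3 * ?k) \<le> v ^ (2 * ?k) * ?t ^ (3 * ?k)"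
      using v by (intro mult_left_mono power_mono) auto
    ultimately have "v ^ (2 * ?k) * real n ^ (3 * ?k) \<le> K ^ ?k * ?c" by linarith
    then show ?case using K by (simp add: field_simps)
  qed
  moreover have "v ^ (2 * ?k) / K ^ ?k > 0" using v K by simp
  ultimately show ?thesis by blast
qed

section \<open>Pairs of pieces on a common line of a move\<close>

text \<open>Two positions on a line in direction \<open>m\<close>, parametrised by the first point
  and the multiple of \<open>m\<close> that leads to the second. These coordinates turn the
  solutions into integer points of dilations of an open convex body of full dimension 3.\<close>

definition pair_body :: "(real \<times> real) set \<Rightarrow> int \<times> int \<Rightarrow> ((real \<times> real) \<times> real) set" where
  "pair_body B m = {(x, s). x \<in> interior B \<and> x + s *\<^sub>R (of_int (fst m), of_int (snd m)) \<in> interior B}"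

lemma pair_body:
  assumes B: "rational_polygon B" and m: "m \<noteq> (0, 0)"
  shows "open (pair_body B m)" "convex (pair_body B m)" "bounded (pair_body B m)"
proof -
  let ?w = "(of_int (fst m), of_int (snd m)) :: real \<times> real"
  let ?f = "\<lambda>y :: (real \<times> real) \<times> real. fst y + snd y *\<^sub>R ?w"
  have eq: "pair_body B m = fst -` interior B \<inter> ?f -` interior B"
    by (auto simp: pair_body_def)
  have f: "linear ?f" by (rule linearI) (auto simp: algebra_simps)
  show "open (pair_body B m)"
    unfolding eq by (intro open_Int open_vimage_fst open_vimage open_interior continuous_intros)
  show "convex (pair_body B m)"
    unfolding eq using f polygonD(4)[OF B] linear_fst
    by (intro convex_Int convex_linear_vimage) auto
  have w: "norm ?w > 0" using m by (cases m) (auto simp: zero_prod_def)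
  obtain a where a: "\<And>x. x \<in> interior B \<Longrightarrow> norm x \<le> a"
    using polygonD(5)[OF B] by (auto simp: bounded_iff)
  have "norm y \<le> a + 2 * a / norm ?w" if "y \<in> pair_body B m" for y
  proof -
    obtain x s where y: "y = (x, s)" by (cases y)
    have mem: "x \<in> interior B" "x + s *\<^sub>R ?w \<in> interior B" using that by (auto simp: y pair_body_def)
    have "norm (s *\<^sub>R ?w) \<le> norm (x + s *\<^sub>R ?w) + norm x"
      using norm_triangle_ineq4[of "x + s *\<^sub>R ?w" x] by simp
    also have "\<dots> \<le> 2 * a" using a[OF mem(1)] a[OF mem(2)] by simp
    finally have "\<bar>s\<bar> * norm ?w \<le> 2 * a" by (simp only: norm_scaleR)
    then have "\<bar>s\<bar> \<le> 2 * a / norm ?w" using w by (simp only: pos_le_divide_eq)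
    moreover have "norm y \<le> norm x + \<bar>s\<bar>" unfolding y using norm_Pair_le[of x s] by simp
    ultimately show ?thesis using a[OF mem(1)] by linarith
  qed
  then show "bounded (pair_body B m)" unfolding bounded_iff by blast
qed

lemma scaled_image_iff:
  fixes y :: "'a::real_vector"
  assumes "t > 0"
  shows "y \<in> (*\<^sub>R) t ` S \<longleftrightarrow> y /\<^sub>R t \<in> S"
proof
  assume "y /\<^sub>R t \<in> S"
  moreover have "y = t *\<^sub>R (y /\<^sub>R t)" using assms by simp
  ultimately show "y \<in> (*\<^sub>R) t ` S" by (rule image_eqI[rotated])
qed (use assms in auto)

lemma coprime_parallel:
  fixes a b p q :: int
  assumes "coprime p q" "a * q = b * p"
  obtains k where "a = k * p" "b = k * q"
proof (cases "p = 0")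
  case True
  then have "is_unit q" using assms(1) by simp
  then have "q \<noteq> 0" by auto
  then have "a = 0" using assms(2) True by simp
  moreover have "q * q = 1" using \<open>is_unit q\<close> by (auto simp: zdvd1_eq abs_if split: if_splits)
  ultimately show ?thesis using True by (intro that[of "b * q"]) (simp_all add: mult.assoc)
next
  case False
  have "p dvd a * q" using assms(2) by simp
  then have "p dvd a" using assms(1) by (simp add: coprime_dvd_mult_left_iff)
  then obtain k where k: "a = p * k" by auto
  then have "p * (k * q) = p * b" using assms(2) by (simp add: mult_ac)
  then have "b = k * q" using False by simp
  then show ?thesis using k by (intro that[of k]) (simp_all add: mult.commute)
qed

text \<open>As \<open>m\<close> is primitive, two lattice points on a line in direction
  \<open>m\<close> differ by an integer multiple of \<open>m\<close>; so the parameter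
  \<open>s\<close> is an integer.\<close>

lemma pair_count_eq:
  assumes M: "basic_moves M" "m \<in> M" and ij: "i \<noteq> j"
  shows "card (grid_configs {i, j} {(m, {i, j})} (board_points B n))
    = card (lattice_points ((*\<^sub>R) (real (n + 1)) ` pair_body B m))"
proof (rule bij_betw_same_card[symmetric])
  let ?t = "real (n + 1)"
  define w where "w = (real_of_int (fst m), real_of_int (snd m))"
  have gcd: "gcd (fst m) (snd m) = 1" and m0: "m \<noteq> (0, 0)" using M by (auto simp: basic_moves_def)
  have wp: "w \<bullet> perp m = 0" by (simp add: w_def perp_def inner_prod_def)
  have w0: "w \<noteq> 0" using m0 by (cases m) (auto simp: w_def zero_prod_def)
  have tB: "y \<in> (*\<^sub>R) ?t ` interior B \<longleftrightarrow> y /\<^sub>R ?t \<in> interior B" for y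
    by (rule scaled_image_iff) simp
  have tP: "(x, s) \<in> (*\<^sub>R) ?t ` pair_body B m \<longleftrightarrow>
      x \<in> (*\<^sub>R) ?t ` interior B \<and> x + s *\<^sub>R w \<in> (*\<^sub>R) ?t ` interior B" for x s
  proof -
    have "(x, s) \<in> (*\<^sub>R) ?t ` pair_body B m \<longleftrightarrow> (x, s) /\<^sub>R ?t \<in> pair_body B m"
      by (rule scaled_image_iff) simp
    then show ?thesis unfolding tB by (simp add: pair_body_def w_def scaleR_add_right mult.assoc)
  qed
  have board: "p \<in> board_points B n \<longleftrightarrow> p \<in> (*\<^sub>R) ?t ` interior B \<and> integral_point p" for p
    by (auto simp: board_points_def)
  have memP: "(x, s) \<in> lattice_points ((*\<^sub>R) ?t ` pair_body B m) \<longleftrightarrow>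
      x \<in> board_points B n \<and> x + s *\<^sub>R w \<in> board_points B n \<and> s \<in> \<int>" for x s
  proof -
    have "(\<forall>b\<in>Basis. (x, s) \<bullet> b \<in> \<int>) \<longleftrightarrow> integral_point x \<and> s \<in> \<int>"
      by (auto simp: Basis_prod_def inner_prod_def integral_point_def)
    moreover have "integral_point (x + s *\<^sub>R w)" if "integral_point x" "s \<in> \<int>"
      using that by (auto simp: integral_point_def w_def)
    ultimately show ?thesis unfolding lattice_points_def mem_Collect_eq tP board by blast
  qed
  define g where "g = (\<lambda>(x, s). config_of {i, j} (\<lambda>k. if k = i then x else x + s *\<^sub>R w :: real \<times> real))"
  have pg: "pos (g (x, s)) i = x" "pos (g (x, s)) j = x + s *\<^sub>R w" for x s
    using ij by (simp_all add: g_def pos_config_of)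
  show "bij_betw g (lattice_points ((*\<^sub>R) ?t ` pair_body B m)) (grid_configs {i, j} {(m, {i, j})} (board_points B n))"
  proof (rule bij_betw_imageI, goal_cases inj surj)
    case inj
    show "inj_on g (lattice_points ((*\<^sub>R) ?t ` pair_body B m))"
    proof (rule inj_onI)
      fix a b assume "g a = g b"
      obtain x s y r where ab: "a = (x, s)" "b = (y, r)" by (cases a, cases b)
      have "x = y" using pg(1)[of x s] pg(1)[of y r] \<open>g a = g b\<close> ab by simp
      moreover have "x + s *\<^sub>R w = y + r *\<^sub>R w" using pg(2)[of x s] pg(2)[of y r] \<open>g a = g b\<close> ab by simp
      ultimately show "a = b" using w0 ab by simp
    qed
  next
    case surj
    show ?case
    proof (intro equalityI subsetI)
      fix z assume "z \<in> g ` lattice_points ((*\<^sub>R) ?t ` pair_body B m)"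
      then obtain x s where xs: "(x, s) \<in> lattice_points ((*\<^sub>R) ?t ` pair_body B m)" "z = g (x, s)" by auto
      have "sat z (m, {i, j})" unfolding xs(2) sat_doubleton pg using wp by simp
      moreover have "z \<in> configs_on {i, j}" by (simp add: xs(2) g_def)
      ultimately show "z \<in> grid_configs {i, j} {(m, {i, j})} (board_points B n)"
        using xs pg[of x s] memP[of x s] by (auto simp: grid_configs_def solutions_def)
    next
      fix z assume z: "z \<in> grid_configs {i, j} {(m, {i, j})} (board_points B n)"
      then have zi: "pos z i \<in> board_points B n" and zj: "pos z j \<in> board_points B n"
        and sat: "sat z (m, {i, j})" and sp: "z \<in> configs_on {i, j}"
        by (auto simp: grid_configs_def solutions_def)
      obtain a b where ab: "pos z j - pos z i = (of_int a, of_int b)"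
        using board_points_Ints[OF zi] board_points_Ints[OF zj]
        by (metis Ints_cases Ints_diff fst_diff prod.collapse snd_diff)
      have "a * snd m = b * fst m"
        using sat ab unfolding sat_doubleton by (simp add: perp_def inner_prod_def flip: of_int_mult)
      have "coprime (fst m) (snd m)" using gcd by (simp add: coprime_iff_gcd_eq_1)
      then obtain k where k: "a = k * fst m" "b = k * snd m"
        using \<open>a * snd m = b * fst m\<close> by (rule coprime_parallel)
      then have diff: "pos z j = pos z i + of_int k *\<^sub>R w" using ab by (simp add: w_def algebra_simps)
      have "z = g (pos z i, of_int k)"
        using sp diff by (intro poly_mapping_eqI) (auto simp: g_def pos_config_of configs_on_def)
      moreover have "(pos z i, of_int k) \<in> lattice_points ((*\<^sub>R) ?t ` pair_body B m)"
        using zi zj diff memP by auto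
      ultimately show "z \<in> g ` lattice_points ((*\<^sub>R) ?t ` pair_body B m)" by blast
    qed
  qed
qed

lemma pair_count_tendsto:
  assumes M: "basic_moves M" "m \<in> M" and ij: "i \<noteq> j" and B: "rational_polygon B"
  shows "\<exists>L. (\<lambda>n. real (card (grid_configs {i, j} {(m, {i, j})} (board_points B n))) / real n ^ 3) \<longlonglongrightarrow> L"
proof -
  have "m \<noteq> (0, 0)" using M by (auto simp: basic_moves_def)
  note body = pair_body[OF B this]
  have "(\<lambda>n. real (card (grid_configs {i, j} {(m, {i, j})} (board_points B n))) / real (n + 1) ^ 3)
      \<longlonglongrightarrow> measure lebesgue (pair_body B m)"
    using lattice_points_tendsto[OF body] unfolding pair_count_eq[OF M ij] by (simp add: numeral_3_eq_3)
  from tendsto_shift_power[OF this] show ?thesis by blast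
qed

subsection \<open>Second coefficient for lattice polygons\<close>

lemma tendsto_Min:
  fixes f :: "'i \<Rightarrow> nat \<Rightarrow> real"
  assumes "finite I" "I \<noteq> {}" "\<And>i. i \<in> I \<Longrightarrow> f i \<longlonglongrightarrow> l i"
  shows "(\<lambda>t. Min ((\<lambda>i. f i t) ` I)) \<longlonglongrightarrow> Min (l ` I)"
  using assms
proof (induction I rule: finite_ne_induct)
  case (insert i I)
  then have "(\<lambda>t. min (f i t) (Min ((\<lambda>i. f i t) ` I))) \<longlonglongrightarrow> min (l i) (Min (l ` I))"
    by (intro tendsto_min) auto
  with insert show ?case by simp
qed simp

lemma card_int_interval:
  fixes L U :: real
  shows "\<bar>real (card {s :: int. L \<le> of_int s \<and> of_int s \<le> U}) - max 0 (U - L)\<bar> \<le> 1"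
proof -
  have "{s :: int. L \<le> of_int s \<and> of_int s \<le> U} = {\<lceil>L\<rceil>..\<lfloor>U\<rfloor>}"
    by (auto simp: ceiling_le_iff le_floor_iff)
  then have "card {s :: int. L \<le> of_int s \<and> of_int s \<le> U} = nat (\<lfloor>U\<rfloor> + 1 - \<lceil>L\<rceil>)"
    by (simp only: card_atLeastAtMost_int)
  moreover have "real (nat k) = max 0 (of_int k)" for k by (cases "k \<ge> 0") auto
  ultimately have card: "real (card {s :: int. L \<le> of_int s \<and> of_int s \<le> U}) = max 0 (of_int (\<lfloor>U\<rfloor> + 1 - \<lceil>L\<rceil>))"
    by simp
  have "of_int \<lfloor>U\<rfloor> \<le> U" "U < of_int \<lfloor>U\<rfloor> + 1" "of_int \<lceil>L\<rceil> \<ge> L" "of_int \<lceil>L\<rceil> < L + 1"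
    by linarith+
  then show ?thesis unfolding card max_def by (auto split: if_splits) linarith+
qed

text \<open>Positive \<open>c i\<close> bound \<open>s\<close> from above and negative ones from
  below, so the set consists of the integers in \<open>[L t, U t]\<close>. The ends divided by
  \<open>t\<close> converge, and the count differs from the positive part of the length by at most
  1.\<close>

lemma interval_count_tendsto:
  fixes c :: "'i \<Rightarrow> int" and \<beta> :: "'i \<Rightarrow> nat \<Rightarrow> int" and D :: "'i \<Rightarrow> real"
  assumes J: "finite J" "\<And>i. i \<in> J \<Longrightarrow> c i \<noteq> 0" "\<exists>i\<in>J. c i > 0" "\<exists>i\<in>J. c i < 0"
    and \<beta>: "\<And>i. i \<in> J \<Longrightarrow> (\<lambda>t. of_int (\<beta> i t) / real t) \<longlonglongrightarrow> D i"
  shows "\<exists>C. (\<lambda>t. real (card {s. \<forall>i\<in>J. c i * s \<le> \<beta> i t}) / real t) \<longlonglongrightarrow> C"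
proof -
  define P where "P = {i \<in> J. c i > 0}"
  define Q where "Q = {i \<in> J. c i < 0}"
  have PQ: "finite P" "P \<noteq> {}" "finite Q" "Q \<noteq> {}" using J by (auto simp: P_def Q_def)
  define U where "U = (\<lambda>t. Min ((\<lambda>i. of_int (\<beta> i t) / of_int (c i) :: real) ` P))"
  define L where "L = (\<lambda>t. - Min ((\<lambda>i. of_int (\<beta> i t) / of_int (- c i) :: real) ` Q))"
  have set_eq: "{s. \<forall>i\<in>J. c i * s \<le> \<beta> i t} = {s. L t \<le> of_int s \<and> of_int s \<le> U t}" for t
  proof -
    have "(\<forall>i\<in>J. c i * s \<le> \<beta> i t) \<longleftrightarrow> L t \<le> of_int s \<and> of_int s \<le> U t" for s
    proof -
      have 1: "of_int s \<le> U t \<longleftrightarrow> (\<forall>i\<in>P. c i * s \<le> \<beta> i t)"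
      proof -
        have "of_int s \<le> U t \<longleftrightarrow> (\<forall>i\<in>P. of_int s \<le> of_int (\<beta> i t) / (of_int (c i) :: real))"
          unfolding U_def using PQ by simp
        also have "\<dots> \<longleftrightarrow> (\<forall>i\<in>P. c i * s \<le> \<beta> i t)"
        proof (intro ball_cong refl)
          fix i assume "i \<in> P"
          then have "of_int (c i) > (0 :: real)" by (simp add: P_def)
          then have "of_int s \<le> of_int (\<beta> i t) / (of_int (c i) :: real) \<longleftrightarrow> of_int (c i * s) \<le> (of_int (\<beta> i t) :: real)"
            by (simp add: pos_le_divide_eq mult.commute)
          then show "of_int s \<le> of_int (\<beta> i t) / (of_int (c i) :: real) \<longleftrightarrow> c i * s \<le> \<beta> i t"
            by (simp only: of_int_le_iff)
        qed
        finally show ?thesis .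
      qed
      have 2: "L t \<le> of_int s \<longleftrightarrow> (\<forall>i\<in>Q. c i * s \<le> \<beta> i t)"
      proof -
        have "L t \<le> of_int s \<longleftrightarrow> (\<forall>i\<in>Q. - of_int s \<le> of_int (\<beta> i t) / (of_int (- c i) :: real))"
          unfolding L_def minus_le_iff[of "Min _"]
          using PQ by (simp only: Min_ge_iff finite_imageI image_is_empty ball_simps simp_thms)
        also have "\<dots> \<longleftrightarrow> (\<forall>i\<in>Q. c i * s \<le> \<beta> i t)"
        proof (intro ball_cong refl)
          fix i assume "i \<in> Q"
          then have "of_int (- c i) > (0 :: real)" by (simp add: Q_def)
          then have "- of_int s \<le> of_int (\<beta> i t) / (of_int (- c i) :: real) \<longleftrightarrow> of_int (c i * s) \<le> (of_int (\<beta> i t) :: real)"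
            by (simp only: pos_le_divide_eq) (simp add: mult.commute)
          then show "- of_int s \<le> of_int (\<beta> i t) / (of_int (- c i) :: real) \<longleftrightarrow> c i * s \<le> \<beta> i t"
            by (simp only: of_int_le_iff)
        qed
        finally show ?thesis .
      qed
      have "J = P \<union> Q" using J(2) by (force simp: P_def Q_def)
      then show ?thesis unfolding 1 2 by blast
    qed
    then show ?thesis by blast
  qed
  have U: "(\<lambda>t. U t / real t) \<longlonglongrightarrow> Min ((\<lambda>i. D i / of_int (c i)) ` P)"
  proof -
    have "(\<lambda>t. Min ((\<lambda>i. of_int (\<beta> i t) / real t / of_int (c i)) ` P)) \<longlonglongrightarrow> Min ((\<lambda>i. D i / of_int (c i)) ` P)"
      using PQ J(2) by (intro tendsto_Min tendsto_divide \<beta> tendsto_const) (auto simp: P_def)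
    moreover have "\<forall>\<^sub>F t in sequentially. Min ((\<lambda>i. of_int (\<beta> i t) / real t / of_int (c i)) ` P) = U t / real t"
      using eventually_gt_at_top[of 0]
    proof eventually_elim
      case (elim t)
      have "mono (\<lambda>x. x / real t)" using elim by (auto intro!: monoI divide_right_mono)
      then have "U t / real t = Min ((\<lambda>x. x / real t) ` (\<lambda>i. of_int (\<beta> i t) / of_int (c i)) ` P)"
        unfolding U_def using PQ by (intro mono_Min_commute) auto
      then show ?case by (simp add: image_image mult.commute)
    qed
    ultimately show ?thesis by (simp add: filterlim_cong)
  qed
  have L: "(\<lambda>t. L t / real t) \<longlonglongrightarrow> - Min ((\<lambda>i. D i / of_int (- c i)) ` Q)"
  proof -
    have "(\<lambda>t. - Min ((\<lambda>i. of_int (\<beta> i t) / real t / of_int (- c i)) ` Q)) \<longlonglongrightarrow> - Min ((\<lambda>i. D i / of_int (- c i)) ` Q)"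
      using PQ J(2) by (intro tendsto_minus tendsto_Min tendsto_divide \<beta> tendsto_const) (auto simp: Q_def)
    moreover have "\<forall>\<^sub>F t in sequentially. - Min ((\<lambda>i. of_int (\<beta> i t) / real t / of_int (- c i)) ` Q) = L t / real t"
      using eventually_gt_at_top[of 0]
    proof eventually_elim
      case (elim t)
      have "mono (\<lambda>x. x / real t)" using elim by (auto intro!: monoI divide_right_mono)
      then have "Min ((\<lambda>i. of_int (\<beta> i t) / of_int (- c i) :: real) ` Q) / real t
          = Min ((\<lambda>x. x / real t) ` (\<lambda>i. of_int (\<beta> i t) / of_int (- c i)) ` Q)"
        using PQ by (intro mono_Min_commute) auto
      then show ?case unfolding L_def by (simp add: image_image mult.commute)
    qed
    ultimately show ?thesis by (simp add: filterlim_cong)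
  qed
  have lim: "(\<lambda>t. max 0 (U t / real t - L t / real t)) \<longlonglongrightarrow>
      max 0 (Min ((\<lambda>i. D i / of_int (c i)) ` P) - - Min ((\<lambda>i. D i / of_int (- c i)) ` Q))"
    by (intro tendsto_max tendsto_diff U L tendsto_const)
  have "(\<lambda>t. real (card {s. \<forall>i\<in>J. c i * s \<le> \<beta> i t}) / real t - max 0 (U t / real t - L t / real t)) \<longlonglongrightarrow> 0"
  proof (rule Lim_null_comparison[OF _ lim_1_over_n])
    show "\<forall>\<^sub>F t in sequentially. norm (real (card {s. \<forall>i\<in>J. c i * s \<le> \<beta> i t}) / real t
        - max 0 (U t / real t - L t / real t)) \<le> 1 / real t"
      using eventually_gt_at_top[of 0]
    proof eventually_elim
      case (elim t)
      have "max 0 (U t / real t - L t / real t) = max 0 (U t - L t) / real t"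
        using elim by (auto simp: max_def diff_divide_distrib[symmetric] divide_simps)
      then have "real (card {s. \<forall>i\<in>J. c i * s \<le> \<beta> i t}) / real t - max 0 (U t / real t - L t / real t)
        = (real (card {s. \<forall>i\<in>J. c i * s \<le> \<beta> i t}) - max 0 (U t - L t)) / real t"
        by (simp add: diff_divide_distrib)
      then show ?case
        using card_int_interval[of "L t" "U t"] elim unfolding set_eq by (simp add: divide_right_mono)
    qed
  qed
  from Lim_transform[OF lim this] show ?thesis by (rule exI)
qed

text \<open>An edge \<open>(p, q, h)\<close> stands for the half-plane \<open>p x + q y < h\<close>.\<close>

type_synonym edge = "int \<times> int \<times> int"

definition edge_form :: "edge \<Rightarrow> 'a::comm_ring_1 \<times> 'a \<Rightarrow> 'a" where
  "edge_form e z = of_int (fst e) * fst z + of_int (fst (snd e)) * snd z"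

abbreviation height :: "edge \<Rightarrow> int" where "height e \<equiv> snd (snd e)"

definition polygon_points :: "edge set \<Rightarrow> (edge \<Rightarrow> int) \<Rightarrow> (int \<times> int) set" where
  "polygon_points H b = {z. \<forall>e\<in>H. edge_form e z \<le> b e}"

text \<open>Half-planes that describe the interior of a lattice polygon. Nonnegative heights make
  the dilated bounds grow with \<open>t\<close>, so passing from \<open>t\<close> to
  \<open>t + 1\<close> only adds points.\<close>

locale lattice_polygon =
  fixes H :: "edge set"
  assumes finite_edges: "finite H"
    and primitive: "e \<in> H \<Longrightarrow> coprime (fst e) (fst (snd e))"
    and height_nonneg: "e \<in> H \<Longrightarrow> height e \<ge> 0"
    and bounded_polygon: "bounded {x :: real \<times> real. \<forall>e\<in>H. edge_form e x < of_int (height e)}"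
    and interior_point: "\<exists>x :: real \<times> real. \<forall>e\<in>H. edge_form e x < of_int (height e)"
begin

text \<open>Otherwise the ray from an interior point in direction \<open>v\<close> would never leave
  the bounded polygon.\<close>

lemma edge_form_direction_pos:
  assumes v: "v \<noteq> (0, 0 :: int)"
  shows "\<exists>i\<in>H. edge_form i v > 0"
proof (rule ccontr)
  assume *: "\<not> (\<exists>i\<in>H. edge_form i v > 0)"
  obtain x :: "real \<times> real" where x: "\<forall>e\<in>H. edge_form e x < of_int (height e)" using interior_point by blast
  let ?w = "(of_int (fst v), of_int (snd v)) :: real \<times> real"
  obtain R where R: "\<And>y :: real \<times> real. \<forall>e\<in>H. edge_form e y < of_int (height e) \<Longrightarrow> norm y \<le> R"
    using bounded_polygon by (auto simp: bounded_iff)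
  have "norm (x + s *\<^sub>R ?w) \<le> R" if "s \<ge> 0" for s
  proof (rule R, intro ballI)
    fix e assume e: "e \<in> H"
    have "edge_form e (x + s *\<^sub>R ?w) = edge_form e x + s * of_int (edge_form e v)"
      by (simp add: edge_form_def algebra_simps)
    also have "\<dots> \<le> edge_form e x" using that * e by (auto simp: mult_nonneg_nonpos not_less)
    also have "\<dots> < of_int (height e)" using x e by simp
    finally show "edge_form e (x + s *\<^sub>R ?w) < of_int (height e)" .
  qed
  moreover have w: "norm ?w > 0" using v by (cases v) (auto simp: zero_prod_def)
  have "norm (((\<bar>R\<bar> + norm x + 1) / norm ?w) *\<^sub>R ?w) = \<bar>R\<bar> + norm x + 1"
    unfolding norm_scaleR using w by simp
  then have "norm (x + ((\<bar>R\<bar> + norm x + 1) / norm ?w) *\<^sub>R ?w) \<ge> \<bar>R\<bar> + 1"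
    using norm_diff_ineq[of "((\<bar>R\<bar> + norm x + 1) / norm ?w) *\<^sub>R ?w" x] by (simp add: add.commute)
  ultimately show False using w by (smt (verit) divide_nonneg_pos norm_ge_zero)
qed

text \<open>The lattice points on the line are parametrised by an integer \<open>s\<close>, and
  every other edge becomes an inequality \<open>c i * s \<le> \<beta> i t\<close>. Edges parallel to
  \<open>e\<close> do not involve \<open>s\<close>: for large \<open>t\<close> they hold always or
  never, according to the sign of the limit \<open>D i\<close>. The remaining ones are the setting
  of \<open>interval_count_tendsto\<close>.\<close>

lemma slice_count_tendsto:
  assumes e: "e \<in> H" and b: "\<And>i. i \<in> H \<Longrightarrow> (\<lambda>t. of_int (b i t) / real t) \<longlonglongrightarrow> of_int (height i)"
    and r: "(\<lambda>t. of_int (r t) / real t) \<longlonglongrightarrow> of_int (height e)"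
  shows "\<exists>C. (\<lambda>t. real (card {z. edge_form e z = r t \<and> (\<forall>i\<in>H - {e}. edge_form i z \<le> b i t)}) / real t) \<longlonglongrightarrow> C"
proof -
  obtain p q h where eq: "e = (p, q, h)" by (cases e)
  have cop: "coprime p q" using primitive[OF e] eq by simp
  \<comment> \<open>By Bezout, \<open>r t\<close> times \<open>(u1, u2)\<close> is a lattice point
    on the line; the others arise by adding multiples of \<open>(- q, p)\<close>.\<close>
  obtain u1 u2 where u: "p * u1 + q * u2 = 1" using cop bezout_int[of p q] by (metis coprime_iff_gcd_eq_1 mult.commute)
  let ?u = "(u1, u2)" and ?d = "(- q, p)"
  have d0: "?d \<noteq> (0, 0)" using u by auto
  define c where "c i = edge_form i ?d" for i
  define \<beta> where "\<beta> i t = b i t - r t * edge_form i ?u" for i t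
  define D where "D i = real_of_int (height i) - of_int (height e) * of_int (edge_form i ?u)" for i
  have \<beta>D: "(\<lambda>t. of_int (\<beta> i t) / real t) \<longlonglongrightarrow> D i" if "i \<in> H" for i
  proof -
    have "(\<lambda>t. of_int (b i t) / real t - of_int (r t) / real t * of_int (edge_form i ?u)) \<longlonglongrightarrow> D i"
      unfolding D_def by (intro tendsto_diff tendsto_mult b[OF that] r tendsto_const)
    then show ?thesis by (simp add: \<beta>_def diff_divide_distrib)
  qed
  let ?S = "\<lambda>t. {z. edge_form e z = r t \<and> (\<forall>i\<in>H - {e}. edge_form i z \<le> b i t)}"
  have slice: "card (?S t) = card {s. \<forall>i\<in>H - {e}. c i * s \<le> \<beta> i t}" for t
  proof (rule bij_betw_same_card[symmetric])
    let ?g = "\<lambda>s. (r t * u1 - s * q, r t * u2 + s * p)"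
    have form: "edge_form i (?g s) = r t * edge_form i ?u + c i * s" for i s
      by (simp add: edge_form_def c_def algebra_simps)
    have "edge_form e (?g s) = r t" for s
    proof -
      have "edge_form e (?g s) = r t * (p * u1 + q * u2)" by (simp add: edge_form_def eq algebra_simps)
      then show ?thesis by (simp add: u)
    qed
    then have mem: "?g s \<in> ?S t \<longleftrightarrow> s \<in> {s. \<forall>i\<in>H - {e}. c i * s \<le> \<beta> i t}" for s
      unfolding mem_Collect_eq form \<beta>_def by (simp add: algebra_simps)
    show "bij_betw ?g {s. \<forall>i\<in>H - {e}. c i * s \<le> \<beta> i t} (?S t)"
    proof (rule bij_betw_imageI)
      show "inj_on ?g {s. \<forall>i\<in>H - {e}. c i * s \<le> \<beta> i t}"
        using d0 by (auto simp: inj_on_def)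
      show "?g ` {s. \<forall>i\<in>H - {e}. c i * s \<le> \<beta> i t} = ?S t"
      proof (intro equalityI subsetI)
        fix z assume z: "z \<in> ?S t"
        obtain x y where xy: "z = (x, y)" by (cases z)
        have "p * x + q * y = r t" using z by (simp add: xy eq edge_form_def)
        then have "(y - r t * u2) * q = - ((x - r t * u1) * p) + r t - r t * (p * u1 + q * u2)"
          by (simp add: algebra_simps)
        then have "(y - r t * u2) * q = (r t * u1 - x) * p" by (simp add: u algebra_simps)
        moreover have "coprime p q" by (rule cop)
        ultimately obtain k where "y - r t * u2 = k * p" "r t * u1 - x = k * q"
          using coprime_parallel[of p q "y - r t * u2" "r t * u1 - x"] by blast
        then have "z = ?g k" by (simp add: xy algebra_simps)
        then show "z \<in> ?g ` {s. \<forall>i\<in>H - {e}. c i * s \<le> \<beta> i t}" using mem[of k] z by blast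
      qed (use mem in blast)
    qed
  qed
  define J where "J = {i \<in> H - {e}. c i \<noteq> 0}"
  define K where "K = {i \<in> H - {e}. c i = 0}"
  have ce: "c e = 0" by (simp add: c_def edge_form_def eq)
  have "finite J" "finite K" using finite_edges by (auto simp: J_def K_def)
  have pos: "\<exists>i\<in>J. c i > 0"
    using edge_form_direction_pos[OF d0] ce unfolding J_def c_def by force
  have neg: "\<exists>i\<in>J. c i < 0"
  proof -
    have "(q, - p) \<noteq> (0, 0)" using d0 by auto
    then obtain i where i: "i \<in> H" "edge_form i (q, - p) > 0" using edge_form_direction_pos by blast
    have "edge_form i (q, - p) = - c i" by (simp add: c_def edge_form_def)
    with i ce show ?thesis by (intro bexI[of _ i]) (auto simp: J_def)
  qed
  \<comment> \<open>A limit 0 would leave the sign of \<open>\<beta> i t\<close> open. A parallel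
    edge with the same normal has a different height; one with the opposite normal is kept apart by
    the interior point.\<close>
  have D0: "D i \<noteq> 0" if i: "i \<in> K" for i
  proof -
    obtain p' q' h' where ieq: "i = (p', q', h')" by (cases i)
    have iH: "i \<in> H" "i \<noteq> e" and "c i = 0" using i by (auto simp: K_def)
    have cop': "coprime p' q'" using primitive[OF iH(1)] ieq by simp
    have "p' * q = q' * p" using \<open>c i = 0\<close> by (simp add: c_def edge_form_def ieq mult.commute)
    then obtain k where k: "p' = k * p" "q' = k * q" using coprime_parallel[OF cop] by blast
    have "k dvd p'" "k dvd q'" using k by auto
    then have "is_unit k" using cop' by (meson coprime_common_divisor)
    then consider "k = 1" | "k = -1" by (auto simp: zdvd1_eq abs_if split: if_splits)
    then show ?thesis
    proof cases
      case 1
      then have "edge_form i ?u = 1" using k u by (simp add: edge_form_def ieq)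
      moreover have "h' \<noteq> h" using iH(2) ieq eq k 1 by auto
      ultimately show ?thesis by (simp add: D_def ieq eq)
    next
      case 2
      have "edge_form i ?u = - (p * u1 + q * u2)" using k 2 by (simp add: edge_form_def ieq)
      then have "edge_form i ?u = -1" using u by simp
      moreover obtain x :: "real \<times> real" where x: "\<forall>e\<in>H. edge_form e x < of_int (height e)" using interior_point by blast
      have "edge_form i x < of_int h'" "edge_form e x < of_int h" using x iH(1) e ieq eq by auto
      moreover have "edge_form i x = - edge_form e x" using k 2 by (simp add: edge_form_def ieq eq)
      ultimately show ?thesis by (simp add: D_def ieq eq)
    qed
  qed
  show ?thesis
  proof (cases "\<exists>i\<in>K. D i < 0")
    case True
    then obtain i where i: "i \<in> K" "D i < 0" by blast
    have "\<forall>\<^sub>F t in sequentially. of_int (\<beta> i t) / real t < 0"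
      using order_tendstoD(2)[OF \<beta>D i(2)] i(1) by (simp add: K_def)
    then have "\<forall>\<^sub>F t in sequentially. real (card (?S t)) / real t = 0"
      using eventually_gt_at_top[of 0]
    proof eventually_elim
      case (elim t)
      then have "\<beta> i t < 0" by (simp add: divide_less_0_iff)
      then have "{s. \<forall>i\<in>H - {e}. c i * s \<le> \<beta> i t} = {}" using i(1) by (force simp: K_def)
      then have "card {s. \<forall>i\<in>H - {e}. c i * s \<le> \<beta> i t} = 0" by (simp only: card.empty)
      then show ?case unfolding slice by simp
    qed
    then show ?thesis by (intro exI[of _ 0] tendsto_eventually)
  next
    case False
    have "\<exists>C. (\<lambda>t. real (card {s. \<forall>i\<in>J. c i * s \<le> \<beta> i t}) / real t) \<longlonglongrightarrow> C"
      by (rule interval_count_tendsto[OF \<open>finite J\<close> _ pos neg \<beta>D]) (simp_all add: J_def)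
    then obtain C where C: "(\<lambda>t. real (card {s. \<forall>i\<in>J. c i * s \<le> \<beta> i t}) / real t) \<longlonglongrightarrow> C" ..
    have "\<forall>\<^sub>F t in sequentially. of_int (\<beta> i t) / real t > 0" if "i \<in> K" for i
    proof -
      have "D i > 0" using False D0[OF that] that by (meson linorder_neqE_linordered_idom)
      then show ?thesis using order_tendstoD(1)[OF \<beta>D] that by (simp add: K_def)
    qed
    then have "\<forall>\<^sub>F t in sequentially. \<forall>i\<in>K. of_int (\<beta> i t) / real t > 0"
      using \<open>finite K\<close> by (simp add: eventually_ball_finite)
    then have "\<forall>\<^sub>F t in sequentially. real (card {s. \<forall>i\<in>J. c i * s \<le> \<beta> i t}) / real t = real (card (?S t)) / real t"
      using eventually_gt_at_top[of 0]
    proof eventually_elim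
      case (elim t)
      then have pos: "\<beta> i t > 0" if "i \<in> K" for i using that by (simp add: zero_less_divide_iff)
      have "c i * s \<le> \<beta> i t" if i: "i \<in> K" for i s
      proof -
        have "c i = 0" using i unfolding K_def by blast
        then show ?thesis using pos[OF i] by simp
      qed
      moreover have "H - {e} = J \<union> K" by (auto simp: J_def K_def)
      ultimately have "{s. \<forall>i\<in>H - {e}. c i * s \<le> \<beta> i t} = {s. \<forall>i\<in>J. c i * s \<le> \<beta> i t}" by blast
      then show ?case unfolding slice by simp
    qed
    from Lim_transform_eventually[OF C this] show ?thesis by (rule exI)
  qed
qed

text \<open>\<open>G\<close> holds the edges that already have the bound of the dilation by
  \<open>t + 1\<close>. The \<open>- 1\<close> turns a strict inequality between integers into a
  weak one.\<close>

definition mixed_bound :: "edge set \<Rightarrow> nat \<Rightarrow> edge \<Rightarrow> int" where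
  "mixed_bound G t e = (if e \<in> G then int (t + 1) * height e - 1 else int t * height e - 1)"

lemma linear_tendsto: "(\<lambda>t. of_int (int t * h + k) / real t) \<longlonglongrightarrow> of_int h"
proof -
  have "(\<lambda>t. of_int h + of_int k * (1 / real t)) \<longlonglongrightarrow> of_int h + of_int k * 0"
    by (intro tendsto_add tendsto_mult tendsto_const lim_1_over_n)
  moreover have "\<forall>\<^sub>F t in sequentially. of_int h + of_int k * (1 / real t) = of_int (int t * h + k) / real t"
    using eventually_gt_at_top[of 0] by eventually_elim (simp add: field_simps)
  ultimately show ?thesis by (simp add: filterlim_cong)
qed

lemma mixed_bound_tendsto: "(\<lambda>t. of_int (mixed_bound G t e) / real t) \<longlonglongrightarrow> of_int (height e)"
proof (cases "e \<in> G")
  case True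
  then have "mixed_bound G t e = int t * height e + (height e - 1)" for t
    by (simp add: mixed_bound_def algebra_simps)
  then show ?thesis using linear_tendsto[of "height e" "height e - 1"] by (simp only:)
next
  case False
  then have "mixed_bound G t e = int t * height e + (- 1)" for t
    by (simp add: mixed_bound_def)
  then show ?thesis using linear_tendsto[of "height e" "-1"] by (simp only:)
qed

text \<open>
  The right-hand sides \<open>t h - 1\<close> of the integer inequalities are raised to \<open>(t + 1) h - 1\<close> one edge
  at a time. Each unit adds the lattice points of a segment, whose number divided by \<open>t\<close> has a limit.
\<close>

lemma polygon_points_increment:
  assumes fin: "\<And>t. finite (polygon_points H (mixed_bound H t))" and G: "finite G" "G \<subseteq> H"
  shows "\<exists>C. (\<lambda>t. (real (card (polygon_points H (mixed_bound G t))) - real (card (polygon_points H (mixed_bound {} t)))) / real t)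
    \<longlonglongrightarrow> C"
  using G
proof (induction G rule: finite_induct)
  case empty
  show ?case by (intro exI[of _ 0]) simp
next
  case (insert e G)
  then obtain C where C: "(\<lambda>t. (real (card (polygon_points H (mixed_bound G t))) - real (card (polygon_points H (mixed_bound {} t)))) / real t) \<longlonglongrightarrow> C"
    by auto
  have e: "e \<in> H" "e \<notin> G" using insert by auto
  let ?S = "\<lambda>k t. {z. edge_form e z = int t * height e + k \<and> (\<forall>i\<in>H - {e}. edge_form i z \<le> mixed_bound G t i)}"
  have "\<forall>k. \<exists>C. (\<lambda>t. real (card (?S k t)) / real t) \<longlonglongrightarrow> C"
    by (intro allI slice_count_tendsto[OF e(1) mixed_bound_tendsto linear_tendsto])
  from choice[OF this] obtain C' where C': "\<And>k. (\<lambda>t. real (card (?S k t)) / real t) \<longlonglongrightarrow> C' k" by blast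
  have card: "card (polygon_points H (mixed_bound (insert e G) t))
      = card (polygon_points H (mixed_bound G t)) + (\<Sum>k\<in>{0..<height e}. card (?S k t))" for t
  proof -
    \<comment> \<open>Raising the bound of \<open>e\<close> from \<open>t h - 1\<close> to
      \<open>(t + 1) h - 1\<close> adds the lines with values \<open>t h + k\<close> for
      \<open>0 \<le> k < h\<close>, the same number of lines for every \<open>t\<close>.\<close>
    have bnd: "edge_form e z \<le> mixed_bound (insert e G) t e \<longleftrightarrow>
        edge_form e z \<le> mixed_bound G t e \<or> (\<exists>k\<in>{0..<height e}. edge_form e z = int t * height e + k)" for z
    proof -
      have "(\<exists>k\<in>{0..<height e}. edge_form e z = int t * height e + k) \<longleftrightarrow>
          int t * height e \<le> edge_form e z \<and> edge_form e z < int t * height e + height e"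
        by (auto intro!: bexI[of _ "edge_form e z - int t * height e"])
      then show ?thesis using e(2) height_nonneg[OF e(1)] by (auto simp: mixed_bound_def algebra_simps)
    qed
    have oth: "mixed_bound (insert e G) t i = mixed_bound G t i" if "i \<noteq> e" for i
      using that by (simp add: mixed_bound_def)
    have "polygon_points H b = {z. edge_form e z \<le> b e \<and> (\<forall>i\<in>H - {e}. edge_form i z \<le> b i)}" for b
      using e(1) by (auto simp: polygon_points_def)
    then have split: "polygon_points H (mixed_bound (insert e G) t)
        = polygon_points H (mixed_bound G t) \<union> (\<Union>k\<in>{0..<height e}. ?S k t)"
      using bnd oth by auto
    \<comment> \<open>The intermediate polygons lie in the one with all bounds raised, hence they
      are finite.\<close>
    have "polygon_points H (mixed_bound (insert e G) t) \<subseteq> polygon_points H (mixed_bound H t)"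
    proof -
      have "mixed_bound (insert e G) t i \<le> mixed_bound H t i" if "i \<in> H" for i
        using that height_nonneg[OF that] by (simp add: mixed_bound_def algebra_simps)
      then show ?thesis unfolding polygon_points_def by (auto intro: order_trans)
    qed
    then have finA: "finite (polygon_points H (mixed_bound (insert e G) t))" using fin finite_subset by blast
    have "card (polygon_points H (mixed_bound G t) \<union> (\<Union>k\<in>{0..<height e}. ?S k t))
      = card (polygon_points H (mixed_bound G t)) + card (\<Union>k\<in>{0..<height e}. ?S k t)"
      using finA e unfolding split
      by (intro card_Un_disjoint) (auto simp: polygon_points_def mixed_bound_def)
    also have "card (\<Union>k\<in>{0..<height e}. ?S k t) = (\<Sum>k\<in>{0..<height e}. card (?S k t))"
      using finA unfolding split by (intro card_UN_disjoint) auto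
    finally show ?thesis unfolding split .
  qed
  have "(\<lambda>t. (real (card (polygon_points H (mixed_bound G t))) - real (card (polygon_points H (mixed_bound {} t)))) / real t
      + (\<Sum>k\<in>{0..<height e}. real (card (?S k t)) / real t)) \<longlonglongrightarrow> C + (\<Sum>k\<in>{0..<height e}. C' k)"
    by (intro tendsto_add C tendsto_sum C')
  then have "(\<lambda>t. (real (card (polygon_points H (mixed_bound (insert e G) t))) - real (card (polygon_points H (mixed_bound {} t)))) / real t)
      \<longlonglongrightarrow> C + (\<Sum>k\<in>{0..<height e}. C' k)"
    unfolding card by (simp add: add_divide_distrib diff_divide_distrib sum_divide_distrib algebra_simps)
  then show ?case by blast
qed

end

section \<open>Integral half-planes for the edges of a lattice polygon\<close>

text \<open>The difference of the two lattice points, divided by its gcd, is a primitive direction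
  of the edge. Turned by a right angle it is the normal, and a lattice point on the edge makes the
  height an integer. A positive \<open>l\<close> keeps the direction of inequalities.\<close>

lemma normal_of_lattice_edge:
  fixes a v w :: "real \<times> real"
  assumes a: "a \<noteq> 0" and vw: "integral_point v" "integral_point w" "v \<noteq> w" "a \<bullet> v = b" "a \<bullet> w = b"
  shows "\<exists>e :: edge. coprime (fst e) (fst (snd e)) \<and> (\<exists>l>0. \<forall>x. a \<bullet> x - b = l * (edge_form e x - of_int (height e)))"
proof -
  obtain X Y where XY: "w - v = (of_int X, of_int Y)"
    using vw(1,2) unfolding integral_point_def
    by (metis Ints_cases Ints_diff fst_diff prod.collapse snd_diff)
  have "X \<noteq> 0 \<or> Y \<noteq> 0" using XY vw(3) by (auto simp: zero_prod_def[symmetric])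
  then obtain X' Y' where c: "X = X' * gcd X Y" "Y = Y' * gcd X Y" "coprime X' Y'"
    using gcd_coprime_exists[of X Y] by auto
  have g: "gcd X Y \<noteq> 0" using \<open>X \<noteq> 0 \<or> Y \<noteq> 0\<close> by simp
  obtain a1 a2 where aa: "a = (a1, a2)" by (cases a)
  have "a \<bullet> (w - v) = 0" using vw by (simp add: inner_diff_right)
  then have "a1 * of_int X + a2 * of_int Y = 0" unfolding XY aa by (simp add: inner_prod_def)
  then have "(a1 * of_int X' + a2 * of_int Y') * of_int (gcd X Y) = 0"
    by (subst (asm) c(1), subst (asm) c(2)) (simp add: algebra_simps)
  then have orth: "a1 * of_int X' + a2 * of_int Y' = 0" using \<open>X \<noteq> 0 \<or> Y \<noteq> 0\<close> by auto
  obtain r s where rs: "r * X' + s * Y' = 1" using c(3) bezout_int[of X' Y'] by (metis coprime_iff_gcd_eq_1)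
  then have rs': "of_int r * of_int X' + of_int s * of_int Y' = (1 :: real)"
    by (metis of_int_1 of_int_add of_int_mult)
  \<comment> \<open>\<open>a\<close> is a multiple of \<open>(- Y', X')\<close>, and the Bezout
    coefficients recover the factor.\<close>
  define l where "l = a2 * of_int r - a1 * of_int s"
  have l2: "a2 = l * of_int X'"
  proof -
    have "l * of_int X' = a2 * (of_int r * of_int X') - of_int s * (a1 * of_int X')" by (simp add: l_def algebra_simps)
    also have "a1 * of_int X' = - (a2 * of_int Y')" using orth by linarith
    finally have "l * of_int X' = a2 * (of_int r * of_int X' + of_int s * of_int Y')" by (simp add: algebra_simps)
    then show ?thesis using rs' by simp
  qed
  have l1: "a1 = - (l * of_int Y')"
  proof -
    have "l * of_int Y' = of_int r * (a2 * of_int Y') - a1 * (of_int s * of_int Y')" by (simp add: l_def algebra_simps)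
    also have "a2 * of_int Y' = - (a1 * of_int X')" using orth by linarith
    finally have "l * of_int Y' = - (a1 * (of_int r * of_int X' + of_int s * of_int Y'))" by (simp add: algebra_simps)
    then show ?thesis using rs' by simp
  qed
  have "l \<noteq> 0" using a l1 l2 aa by (auto simp: zero_prod_def)
  \<comment> \<open>The primitive normal is reversed if \<open>l\<close> is negative.\<close>
  define \<sigma> :: int where "\<sigma> = (if l > 0 then 1 else - 1)"
  have \<sigma>: "of_int \<sigma> * \<bar>l\<bar> = l" "\<bar>l\<bar> > 0" using \<open>l \<noteq> 0\<close> by (auto simp: \<sigma>_def)
  obtain v1 v2 where v: "v = (of_int v1, of_int v2)"
    using vw(1) unfolding integral_point_def by (metis Ints_cases prod.collapse)
  define e :: edge where "e = (- (\<sigma> * Y'), \<sigma> * X', - (\<sigma> * Y') * v1 + \<sigma> * X' * v2)"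
  have "coprime (fst e) (fst (snd e))"
    using c(3) by (auto simp: e_def \<sigma>_def coprime_commute)
  moreover have "a \<bullet> x - b = \<bar>l\<bar> * (edge_form e x - of_int (height e))" for x
  proof -
    have "a \<bullet> x - b = l * (of_int X' * (snd x - of_int v2) - of_int Y' * (fst x - of_int v1))"
      unfolding vw(4)[symmetric] aa v by (simp add: inner_prod_def l1 l2 algebra_simps)
    also have "\<dots> = \<bar>l\<bar> * (of_int \<sigma> * (of_int X' * (snd x - of_int v2) - of_int Y' * (fst x - of_int v1)))"
      using \<sigma>(1) by (metis mult.assoc mult.commute)
    also have "\<dots> = \<bar>l\<bar> * (edge_form e x - of_int (height e))"
      by (simp add: e_def edge_form_def algebra_simps)
    finally show ?thesis .
  qed
  ultimately show ?thesis using \<sigma>(2) by blast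
qed

text \<open>In a minimal description by half-planes each of them cuts out a facet, here of dimension
  1. A facet is the hull of its extreme points, so it has at least two; they are vertices of
  \<open>B\<close> and hence integral.\<close>

lemma lattice_polygon_edges:
  assumes B: "rational_polygon B" and int: "\<And>v. v extreme_point_of B \<Longrightarrow> integral_point v"
  obtains H :: "edge set" where "finite H" "\<And>e. e \<in> H \<Longrightarrow> coprime (fst e) (fst (snd e))"
    "interior B = {x. \<forall>e\<in>H. edge_form e x < of_int (height e)}"
    "\<And>e x. e \<in> H \<Longrightarrow> x \<in> B \<Longrightarrow> edge_form e x \<le> of_int (height e)"
proof -
  have poly: "polyhedron B" "polytope B" using B polytope_imp_polyhedron by (auto simp: rational_polygon_def)
  have ne: "interior B \<noteq> {}" using polygonD[OF B] by simp
  have aff: "affine hull B = UNIV" by (rule affine_hull_nonempty_interior[OF ne])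
  have dim: "aff_dim B = 2" using aff_dim_nonempty_interior[OF ne] by simp
  obtain F where F: "finite F" "B = affine hull B \<inter> \<Inter>F"
    "\<forall>h\<in>F. \<exists>a b. a \<noteq> 0 \<and> h = {x. a \<bullet> x \<le> b} \<and> (\<forall>x\<in>affine hull B. x + a \<in> affine hull B)"
    "\<forall>F'. F' \<subset> F \<longrightarrow> B \<subset> affine hull B \<inter> \<Inter>F'"
    using polyhedron_Int_affine_parallel_minimal[of B] poly(1) by blast
  have "\<forall>h\<in>F. \<exists>ab. fst ab \<noteq> 0 \<and> h = {x. fst ab \<bullet> x \<le> snd ab}" using F(3) by force
  from bchoice[OF this] obtain ab where ab: "\<And>h. h \<in> F \<Longrightarrow> fst (ab h) \<noteq> 0 \<and> h = {x. fst (ab h) \<bullet> x \<le> snd (ab h)}"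
    by blast
  have ri: "rel_interior B = {x \<in> B. \<forall>h\<in>F. fst (ab h) \<bullet> x < snd (ab h)}"
    by (rule rel_interior_polyhedron_explicit[OF F(1,2) ab]) (use F(4) in auto)
  have memB: "x \<in> B \<longleftrightarrow> (\<forall>h\<in>F. fst (ab h) \<bullet> x \<le> snd (ab h))" for x
  proof -
    have "x \<in> B \<longleftrightarrow> (\<forall>h\<in>F. x \<in> h)" using F(2) aff by blast
    also have "\<dots> \<longleftrightarrow> (\<forall>h\<in>F. fst (ab h) \<bullet> x \<le> snd (ab h))" using ab by blast
    finally show ?thesis .
  qed
  have intB: "interior B = {x. \<forall>h\<in>F. fst (ab h) \<bullet> x < snd (ab h)}"
    using ri rel_interior_nonempty_interior[OF ne] memB by (auto intro: less_imp_le)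
  have "\<exists>e. coprime (fst e) (fst (snd e)) \<and> (\<exists>l>0. \<forall>x. fst (ab h) \<bullet> x - snd (ab h) = l * (edge_form e x - of_int (height e)))"
    if h: "h \<in> F" for h
  proof -
    let ?a = "fst (ab h)" and ?b = "snd (ab h)"
    let ?C = "B \<inter> {x. ?a \<bullet> x = ?b}"
    have "?C facet_of B"
      by (subst facet_of_polyhedron_explicit[OF F(1,2) ab]) (use F(4) h in auto)
    then have C: "?C face_of B" "aff_dim ?C = 1" using dim by (auto simp: facet_of_def)
    have hull: "?C = convex hull {x. x extreme_point_of ?C}"
    proof (rule Krein_Milman_Minkowski)
      show "compact ?C" using face_of_imp_compact[OF polytope_imp_convex polytope_imp_compact C(1)] poly(2) by blast
      show "convex ?C" using face_of_imp_convex[OF C(1)] .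
    qed
    have "\<exists>v w. v extreme_point_of ?C \<and> w extreme_point_of ?C \<and> v \<noteq> w"
    proof (rule ccontr)
      assume "\<not> ?thesis"
      then obtain v where "{x. x extreme_point_of ?C} \<subseteq> {v}" by blast
      then have "?C \<subseteq> convex hull {v}" using hull hull_mono by metis
      then have "aff_dim ?C \<le> aff_dim {v}" by (intro aff_dim_subset) simp
      then show False using C(2) by simp
    qed
    then obtain v w where vw: "v extreme_point_of ?C" "w extreme_point_of ?C" "v \<noteq> w" by blast
    then have "v extreme_point_of B" "w extreme_point_of B" "v \<in> ?C" "w \<in> ?C"
      using extreme_point_of_face[OF C(1)] by blast+
    then show ?thesis
      using normal_of_lattice_edge[of ?a v w ?b] ab[OF h] int vw(3) by auto
  qed
  then obtain g where g: "\<And>h. h \<in> F \<Longrightarrow> coprime (fst (g h)) (fst (snd (g h)))"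
    "\<And>h. h \<in> F \<Longrightarrow> \<exists>l>0. \<forall>x. fst (ab h) \<bullet> x - snd (ab h) = l * (edge_form (g h) x - of_int (height (g h)))"
    by metis
  have less: "fst (ab h) \<bullet> x < snd (ab h) \<longleftrightarrow> edge_form (g h) x < of_int (height (g h))"
    and le: "fst (ab h) \<bullet> x \<le> snd (ab h) \<longleftrightarrow> edge_form (g h) x \<le> of_int (height (g h))" if h: "h \<in> F" for h x
  proof -
    obtain l where l: "l > 0" "fst (ab h) \<bullet> x - snd (ab h) = l * (edge_form (g h) x - of_int (height (g h)))"
      using g(2)[OF h] by blast
    have "fst (ab h) \<bullet> x - snd (ab h) < 0 \<longleftrightarrow> edge_form (g h) x - of_int (height (g h)) < 0"
      "fst (ab h) \<bullet> x - snd (ab h) \<le> 0 \<longleftrightarrow> edge_form (g h) x - of_int (height (g h)) \<le> 0"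
      unfolding l(2) using l(1) by (simp_all add: mult_less_0_iff mult_le_0_iff)
    then show "fst (ab h) \<bullet> x < snd (ab h) \<longleftrightarrow> edge_form (g h) x < of_int (height (g h))"
      "fst (ab h) \<bullet> x \<le> snd (ab h) \<longleftrightarrow> edge_form (g h) x \<le> of_int (height (g h))" by linarith+
  qed
  show ?thesis
  proof (rule that[of "g ` F"])
    show "finite (g ` F)" using F(1) by simp
    show "coprime (fst e) (fst (snd e))" if "e \<in> g ` F" for e using that g(1) by blast
    show "interior B = {x. \<forall>e\<in>g ` F. edge_form e x < of_int (height e)}"
      unfolding intB using less by blast
    show "edge_form e x \<le> of_int (height e)" if "e \<in> g ` F" "x \<in> B" for e x
      using that memB le by blast
  qed
qed

text \<open>Translating \<open>B\<close> by a vertex translates its dilation by \<open>t\<close>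
  through a lattice vector, so the counts stay the same. The board for \<open>n\<close> belongs to
  \<open>t = n + 1\<close>, and raising all bounds produces the next board.\<close>

lemma num_points_increment_tendsto:
  assumes B: "rational_polygon B" and int: "\<And>v. v extreme_point_of B \<Longrightarrow> integral_point v"
  shows "\<exists>C. (\<lambda>n. (num_points B (n + 1) - num_points B n) / real (n + 1)) \<longlonglongrightarrow> C"
proof -
  obtain H :: "edge set" where H: "finite H" "\<And>e. e \<in> H \<Longrightarrow> coprime (fst e) (fst (snd e))"
    "interior B = {x. \<forall>e\<in>H. edge_form e x < of_int (height e)}"
    "\<And>e x. e \<in> H \<Longrightarrow> x \<in> B \<Longrightarrow> edge_form e x \<le> of_int (height e)"
    using lattice_polygon_edges[OF B int] by blast
  have "compact B" "convex B" "B \<noteq> {}"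
    using B polytope_imp_compact polytope_imp_convex interior_subset by (auto simp: rational_polygon_def)
  then obtain v where v: "v extreme_point_of B" using extreme_point_exists_convex by blast
  obtain v1 v2 where vv: "v = (of_int v1, of_int v2)"
    using int[OF v] unfolding integral_point_def by (metis Ints_cases prod.collapse)
  have vB: "v \<in> B" using v by (simp add: extreme_point_of_def)
  \<comment> \<open>moving the vertex \<open>v\<close> to the origin makes all heights nonnegative\<close>
  define sh :: "edge \<Rightarrow> edge" where
    "sh = (\<lambda>e. (fst e, fst (snd e), height e - edge_form e (v1, v2)))"
  have sh: "edge_form (sh e) z = edge_form e z" for e and z :: "'c::comm_ring_1 \<times> 'c" by (simp add: sh_def edge_form_def)
  have sv: "edge_form e v = of_int (edge_form e (v1, v2))" for e by (simp add: edge_form_def vv)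
  have iff: "edge_form (sh e) x < of_int (height (sh e)) \<longleftrightarrow> edge_form e (x + v) < of_int (height e)"
    for e and x :: "real \<times> real"
  proof -
    have "edge_form e (x + v) = edge_form e x + (edge_form e v :: real)" by (simp add: edge_form_def algebra_simps)
    then show ?thesis unfolding sh sv by (simp add: sh_def) linarith
  qed
  have shift: "{x. \<forall>e\<in>sh ` H. edge_form e x < of_int (height e)} = (\<lambda>x. x - v) ` interior B"
  proof (intro equalityI subsetI)
    fix x :: "real \<times> real" assume "x \<in> {x. \<forall>e\<in>sh ` H. edge_form e x < of_int (height e)}"
    then have "x + v \<in> interior B" unfolding H(3) using iff by auto
    then show "x \<in> (\<lambda>x. x - v) ` interior B" by (rule image_eqI[rotated]) simp
  next
    fix x assume "x \<in> (\<lambda>x. x - v) ` interior B"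
    then have "x + v \<in> interior B" by auto
    then show "x \<in> {x. \<forall>e\<in>sh ` H. edge_form e x < of_int (height e)}" unfolding H(3) using iff by auto
  qed
  interpret lattice_polygon "sh ` H"
  proof
    show "finite (sh ` H)" using H(1) by simp
    show "coprime (fst e) (fst (snd e))" if "e \<in> sh ` H" for e using that H(2) by (auto simp: sh_def)
    show "height e \<ge> 0" if "e \<in> sh ` H" for e
    proof -
      from that obtain e' where e': "e' \<in> H" "e = sh e'" by blast
      have "real_of_int (edge_form e' (v1, v2)) \<le> of_int (height e')" using H(4)[OF e'(1) vB] sv by simp
      then show ?thesis by (simp add: e'(2) sh_def)
    qed
    show "bounded {x :: real \<times> real. \<forall>e\<in>sh ` H. edge_form e x < of_int (height e)}"
      unfolding shift using bounded_translation_minus[OF polygonD(5)[OF B]] .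
    show "\<exists>x :: real \<times> real. \<forall>e\<in>sh ` H. edge_form e x < of_int (height e)"
      using shift polygonD(6)[OF B] by blast
  qed
  have bij: "\<exists>g. bij_betw g (polygon_points (sh ` H) (mixed_bound {} (n + 1))) (board_points B n)" for n
  proof (rule exI)
    let ?t = "real (n + 1)"
    let ?g = "\<lambda>z. (of_int (fst z) + ?t * of_int v1, of_int (snd z) + ?t * of_int v2) :: real \<times> real"
    have mem: "?g z \<in> board_points B n \<longleftrightarrow> z \<in> polygon_points (sh ` H) (mixed_bound {} (n + 1))" for z
    proof -
      have "integral_point (?g z)" by (simp add: integral_point_def)
      then have "?g z \<in> board_points B n \<longleftrightarrow> ?g z \<in> (*\<^sub>R) ?t ` interior B" by (auto simp: board_points_def)
      also have "\<dots> \<longleftrightarrow> ?g z /\<^sub>R ?t \<in> interior B" by (rule scaled_image_iff) simp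
      also have "\<dots> \<longleftrightarrow> (\<forall>e\<in>H. edge_form e (?g z /\<^sub>R ?t) < of_int (height e))" unfolding H(3) by simp
      also have "\<dots> \<longleftrightarrow> (\<forall>e\<in>H. edge_form (sh e) z \<le> mixed_bound {} (n + 1) (sh e))"
      proof (intro ball_cong refl)
        fix e
        have "edge_form e (?g z /\<^sub>R ?t) = (of_int (edge_form e z) + ?t * of_int (edge_form e (v1, v2))) / ?t"
          by (simp add: edge_form_def divide_inverse algebra_simps)
        then have "edge_form e (?g z /\<^sub>R ?t) < of_int (height e) \<longleftrightarrow>
            of_int (edge_form e z) + ?t * of_int (edge_form e (v1, v2)) < ?t * of_int (height e)"
          by (simp add: pos_divide_less_eq mult.commute)
        also have "\<dots> \<longleftrightarrow> of_int (edge_form e z) < (of_int (int (n + 1) * (height e - edge_form e (v1, v2))) :: real)"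
          by (simp add: algebra_simps)
        also have "\<dots> \<longleftrightarrow> edge_form e z < int (n + 1) * (height e - edge_form e (v1, v2))"
          by (simp only: of_int_less_iff)
        also have "\<dots> \<longleftrightarrow> edge_form (sh e) z \<le> mixed_bound {} (n + 1) (sh e)"
          unfolding sh by (simp add: mixed_bound_def sh_def)
        finally show "edge_form e (?g z /\<^sub>R ?t) < of_int (height e) \<longleftrightarrow> edge_form (sh e) z \<le> mixed_bound {} (n + 1) (sh e)" .
      qed
      finally show ?thesis by (simp add: polygon_points_def)
    qed
    show "bij_betw ?g (polygon_points (sh ` H) (mixed_bound {} (n + 1))) (board_points B n)"
    proof (rule bij_betw_imageI)
      show "inj_on ?g (polygon_points (sh ` H) (mixed_bound {} (n + 1)))" by (auto simp: inj_on_def prod_eq_iff)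
      show "?g ` polygon_points (sh ` H) (mixed_bound {} (n + 1)) = board_points B n"
      proof (intro equalityI subsetI)
        fix p assume p: "p \<in> board_points B n"
        obtain a b where ab: "p = (of_int a, of_int b)"
          using board_points_Ints[OF p] by (metis Ints_cases prod.collapse)
        have "p = ?g (a - int (n + 1) * v1, b - int (n + 1) * v2)" by (simp add: ab algebra_simps)
        then show "p \<in> ?g ` polygon_points (sh ` H) (mixed_bound {} (n + 1))" using mem p by blast
      qed (use mem in blast)
    qed
  qed
  have card: "card (polygon_points (sh ` H) (mixed_bound {} (n + 1))) = card (board_points B n)" for n
    using bij[of n] bij_betw_same_card by blast
  have mH: "polygon_points (sh ` H) (mixed_bound (sh ` H) t) = polygon_points (sh ` H) (mixed_bound {} (t + 1))" for t
    by (auto simp: polygon_points_def mixed_bound_def)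
  have fin: "finite (polygon_points (sh ` H) (mixed_bound (sh ` H) t))" for t
    unfolding mH using bij[of t] finite_board_points[OF B, of t] bij_betw_finite by blast
  obtain C where C: "(\<lambda>t. (real (card (polygon_points (sh ` H) (mixed_bound (sh ` H) t)))
      - real (card (polygon_points (sh ` H) (mixed_bound {} t)))) / real t) \<longlonglongrightarrow> C"
    using polygon_points_increment[OF fin finite_edges order_refl] by blast
  have "(\<lambda>n. (num_points B (n + 1) - num_points B n) / real (n + 1)) \<longlonglongrightarrow> C"
    using LIMSEQ_Suc[OF C] unfolding mH num_points_def card[symmetric] by simp
  then show ?thesis by blast
qed

subsection \<open>The coefficient formula\<close>

locale counting_problem =
  fixes M :: "(int \<times> int) set" and B :: "(real \<times> real) set"
    and \<gamma> :: "nat \<Rightarrow> nat \<Rightarrow> nat \<Rightarrow> real"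
    and \<Gamma> :: "nat \<Rightarrow> config set \<Rightarrow> nat \<Rightarrow> nat \<Rightarrow> real"
  assumes moves: "basic_moves M"
    and polygon: "rational_polygon B"
    and coefficients: "count_coefficients M B \<gamma>"
    and expansions: "count_expansions M B \<Gamma>"
begin

lemma finite_moves: "finite M" and zero_not_move: "(0, 0) \<notin> M" and moves_nonempty: "M \<noteq> {}"
  using moves by (auto simp: basic_moves_def)

abbreviation N :: "nat \<Rightarrow> real" where "N \<equiv> num_points B"

abbreviation \<kappa> :: "nat \<Rightarrow> config set \<Rightarrow> nat" where "\<kappa> q U \<equiv> card (involved M q U)"

abbreviation \<alpha> :: "nat \<Rightarrow> config set \<Rightarrow> nat \<Rightarrow> real" where
  "\<alpha> q U n \<equiv> real (subspace_count M B q U n)"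

abbreviation \<alpha>_poly :: "nat \<Rightarrow> config set \<Rightarrow> nat \<Rightarrow> real poly" where
  "\<alpha>_poly q U \<equiv> constituents (\<alpha> q U)"

lemma labelled_count_constituents:
  assumes "q \<ge> 1"
  shows "has_constituents (\<lambda>n. real (labelled_count M B q n))
    (\<lambda>n. \<Sum>i=0..2 * q. monom (fact q * \<gamma> q i n) (2 * q - i))"
proof -
  have per: "periodic (\<gamma> q i)" for i
    using coefficients assms by (simp add: count_coefficients_def)
  have sum: "unlabelled_count M B q n = (\<Sum>i=0..2 * q. \<gamma> q i n * real n ^ (2 * q - i))" for n
    using coefficients assms by (simp add: count_coefficients_def)
  have "real (labelled_count M B q n) = fact q * unlabelled_count M B q n" for n
    by (simp add: unlabelled_count_def)
  then have "real (labelled_count M B q n) = (\<Sum>i=0..2 * q. (fact q * \<gamma> q i n) * real n ^ (2 * q - i))" for n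
    by (simp add: sum sum_distrib_left mult.assoc)
  moreover have "has_constituents (\<lambda>n. \<Sum>i=0..2 * q. (fact q * \<gamma> q i n) * real n ^ (2 * q - i))
      (\<lambda>n. \<Sum>i=0..2 * q. monom (fact q * \<gamma> q i n) (2 * q - i))"
    by (intro has_constituents_sum has_constituents_monom periodic_map[where g = "\<lambda>x. fact q * x"] per) simp
  ultimately show ?thesis by simp
qed

lemma labelled_count_Coeff:
  assumes "q \<ge> 1"
  shows "Coeff (2 * int q - int i) (\<lambda>n. real (labelled_count M B q n)) n = fact q * \<gamma> q i n"
proof (cases "i \<le> 2 * q")
  case True
  then have "nat (2 * int q - int i) = 2 * q - i" by simp
  moreover have "coeff (\<Sum>j=0..2 * q. monom (fact q * \<gamma> q j n) (2 * q - j)) (2 * q - i)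
      = (\<Sum>j=0..2 * q. if j = i then fact q * \<gamma> q i n else 0)"
    unfolding coeff_sum using True by (intro sum.cong refl) auto
  ultimately show ?thesis
    using True unfolding Coeff_eq[OF labelled_count_constituents[OF assms]] by simp
next
  case False
  then have "\<gamma> q i n = 0" using coefficients assms by (simp add: count_coefficients_def)
  with False show ?thesis unfolding Coeff_eq[OF labelled_count_constituents[OF assms]] by simp
qed

lemma labelled_count_1: "real (labelled_count M B 1 n) = N n"
proof -
  have "{z \<in> config_space 1. (\<forall>i\<in>{1..1}. pos z i \<in> board_points B n) \<and> nonattacking M 1 z}
      = grid_configs {1} {} (board_points B n)"
    by (auto simp: grid_configs_def config_space_eq nonattacking_def solutions_def)
  then show ?thesis unfolding labelled_count_def num_points_def by (simp add: card_grid_points)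
qed

lemma N_constituents: "has_constituents N (\<lambda>n. [:\<gamma> 1 2 n, \<gamma> 1 1 n, \<gamma> 1 0 n:])"
proof -
  have "(\<Sum>i=0..2 * 1. monom (fact 1 * \<gamma> 1 i n) (2 * 1 - i)) = [:\<gamma> 1 2 n, \<gamma> 1 1 n, \<gamma> 1 0 n:]" for n
    by (simp add: numeral_2_eq_2 monom_Suc monom_0)
  then show ?thesis using labelled_count_constituents[of 1, OF order_refl] unfolding labelled_count_1 by (simp only:)
qed

lemma leading_N: "\<gamma> 1 0 n = vol B"
proof -
  have "coeff [:\<gamma> 1 2 n, \<gamma> 1 1 n, \<gamma> 1 0 n:] 2 = vol B"
  proof (rule constituents_coeff_eq_limit[OF N_constituents])
    show "(\<lambda>n. N n / real n ^ 2) \<longlonglongrightarrow> vol B"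
      by (rule tendsto_shift_power[OF num_points_tendsto[OF polygon]])
  qed simp
  then show ?thesis by (simp add: numeral_2_eq_2)
qed

lemma N_poly: "has_constituents N (\<lambda>n. [:\<gamma> 1 2 n, \<gamma> 1 1 n, vol B:])"
  using N_constituents unfolding leading_N .

lemma N_quasi: "quasipolynomial N"
  by (rule quasipolynomialI[OF N_poly])

lemma \<alpha>_expansion:
  assumes "(q, U) \<in> move_subspaces M"
  shows "\<alpha> q U n = (\<Sum>j = 0..\<kappa> q U - half_up (codim q U). \<Gamma> q U j n * N n ^ (\<kappa> q U - half_up (codim q U) - j))"
    and "linear_quasipolynomial (\<Gamma> q U j)"
  using expansions assms unfolding count_expansions_def Let_def by blast+

lemma \<alpha>_quasi:
  assumes "(q, U) \<in> move_subspaces M"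
  shows "quasipolynomial (\<alpha> q U)"
  unfolding \<alpha>_expansion(1)[OF assms]
  by (intro quasipolynomial_sum quasipolynomial_mult quasipolynomial_power N_quasi
      linear_quasipolynomial_imp \<alpha>_expansion(2)[OF assms]) simp

lemma codim_le_2\<kappa>:
  assumes U: "U \<in> intersection_lattice M q"
  shows "codim q U \<le> 2 * \<kappa> q U"
proof (cases "involved M q U = {}")
  case True
  then have "U = configs_on {1..q}" using involved_empty_iff[OF zero_not_move U] by simp
  then show ?thesis by (simp add: codim_def dim_configs_on)
next
  case False
  then show ?thesis using codim_le_involved[OF finite_moves U] by linarith
qed

lemma \<alpha>_degree:
  assumes U: "(q, U) \<in> move_subspaces M"
  shows "degree (\<alpha>_poly q U n) \<le> 2 * \<kappa> q U - codim q U"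
proof -
  have UL: "U \<in> intersection_lattice M q" using U by (simp add: move_subspaces_def)
  obtain K where K: "\<And>n. \<alpha> q U n \<le> K * (real n + 1) ^ (2 * \<kappa> q U - codim q U)"
    using subspace_count_bound[OF finite_moves zero_not_move UL polygon] by blast
  show ?thesis
    by (rule constituents_degree_le[OF has_constituents_constituents[OF \<alpha>_quasi[OF U]], of K]) (use K in simp)
qed

text \<open>\<open>s\<close> is the drop below degree \<open>2 \<kappa>\<close> taken from
  \<open>\<alpha>\<close>, and \<open>i - s\<close> is the drop below degree
  \<open>2 (q - \<kappa>)\<close> taken from the power of \<open>N\<close>. In this form
  \<open>q\<close> enters only through the exponent of the power.\<close>

lemma Coeff_\<alpha>:
  assumes U: "(q', U) \<in> move_subspaces M" and q: "\<kappa> q' U \<le> q"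
  shows "Coeff (2 * int q - int i) (\<lambda>n. \<alpha> q' U n * N n ^ (q - \<kappa> q' U)) n =
    (\<Sum>s\<le>i. (if s \<le> 2 * \<kappa> q' U then coeff (\<alpha>_poly q' U n) (2 * \<kappa> q' U - s) else 0) *
      coeff ([:vol B, \<gamma> 1 1 n, \<gamma> 1 2 n:] ^ (q - \<kappa> q' U)) (i - s))"
proof -
  let ?k = "\<kappa> q' U"
  let ?P = "\<alpha>_poly q' U n * [:\<gamma> 1 2 n, \<gamma> 1 1 n, vol B:] ^ (q - ?k)"
  have c: "has_constituents (\<lambda>n. \<alpha> q' U n * N n ^ (q - ?k))
      (\<lambda>n. \<alpha>_poly q' U n * [:\<gamma> 1 2 n, \<gamma> 1 1 n, vol B:] ^ (q - ?k))"
    by (intro has_constituents_mult has_constituents_power N_poly has_constituents_constituents \<alpha>_quasi U)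
  have deg: "degree (\<alpha>_poly q' U n) \<le> 2 * ?k" using \<alpha>_degree[OF U, of n] by simp
  have e: "2 * ?k + 2 * (q - ?k) = 2 * q" using q by simp
  have "Coeff (2 * int q - int i) (\<lambda>n. \<alpha> q' U n * N n ^ (q - ?k)) n
      = (if i \<le> 2 * ?k + 2 * (q - ?k) then coeff ?P (2 * ?k + 2 * (q - ?k) - i) else 0)"
  proof -
    have "nat (2 * int q - int i) = 2 * q - i" by simp
    then show ?thesis unfolding Coeff_eq[OF c] e by simp
  qed
  also have "\<dots> = (\<Sum>s\<le>i. (if s \<le> 2 * ?k then coeff (\<alpha>_poly q' U n) (2 * ?k - s) else 0) *
      coeff ([:vol B, \<gamma> 1 1 n, \<gamma> 1 2 n:] ^ (q - ?k)) (i - s))"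
    by (rule coeff_mult_quadratic_power[OF deg])
  finally show ?thesis .
qed

lemma \<alpha>_coeff_eq_0:
  assumes U: "(q', U) \<in> move_subspaces M" and s: "s < codim q' U"
  shows "coeff (\<alpha>_poly q' U n) (2 * \<kappa> q' U - s) = 0"
proof (rule coeff_eq_0)
  have "codim q' U \<le> 2 * \<kappa> q' U" using codim_le_2\<kappa> U by (simp add: move_subspaces_def)
  then show "degree (\<alpha>_poly q' U n) < 2 * \<kappa> q' U - s" using \<alpha>_degree[OF U, of n] s by linarith
qed

lemma Coeff_\<alpha>_eq_0:
  assumes U: "(q', U) \<in> move_subspaces M" and q: "\<kappa> q' U \<le> q" and i: "i < codim q' U"
  shows "Coeff (2 * int q - int i) (\<lambda>n. \<alpha> q' U n * N n ^ (q - \<kappa> q' U)) n = 0"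
  unfolding Coeff_\<alpha>[OF U q] using \<alpha>_coeff_eq_0[OF U] i by (intro sum.neutral) auto

lemma \<kappa>_le: "\<kappa> q U \<le> q"
proof -
  have "\<kappa> q U \<le> card {1..q}" by (intro card_mono) (auto simp: involved_def)
  then show ?thesis by simp
qed

lemma move_subspacesI: "1 \<le> q \<Longrightarrow> U \<in> intersection_lattice M q \<Longrightarrow> (q, U) \<in> move_subspaces M"
  by (simp add: move_subspaces_def)

abbreviation contribution :: "nat \<Rightarrow> nat \<Rightarrow> nat \<Rightarrow> config set \<Rightarrow> real" where
  "contribution q i n U \<equiv> real_of_int (mu0 M q U) *
     Coeff (2 * int q - int i) (\<lambda>n. \<alpha> q U n * N n ^ (q - \<kappa> q U)) n"

lemma \<gamma>_eq_sum_contribution: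
  assumes q: "q \<ge> 1"
  shows "fact q * \<gamma> q i n = (\<Sum>U\<in>intersection_lattice M q. contribution q i n U)"
proof -
  let ?L = "intersection_lattice M q"
  have quasi: "quasipolynomial (\<lambda>n. \<alpha> q U n * N n ^ (q - \<kappa> q U))" if "U \<in> ?L" for U
    by (intro quasipolynomial_mult quasipolynomial_power N_quasi \<alpha>_quasi move_subspacesI q that)
  have "real (labelled_count M B q n) = (\<Sum>U\<in>?L. real_of_int (mu0 M q U) * (\<alpha> q U n * N n ^ (q - \<kappa> q U)))" for n
  proof -
    have "real (labelled_count M B q n) = real_of_int (int (labelled_count M B q n))" by simp
    also have "\<dots> = (\<Sum>U\<in>?L. real_of_int (mu0 M q U) * (\<alpha> q U n * N n ^ (q - \<kappa> q U)))"
      unfolding labelled_count_eq[OF finite_moves zero_not_move finite_board_points[OF polygon]]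
      by (simp add: num_points_def)
    finally show ?thesis .
  qed
  then have "fact q * \<gamma> q i n = Coeff (2 * int q - int i)
      (\<lambda>n. \<Sum>U\<in>?L. real_of_int (mu0 M q U) * (\<alpha> q U n * N n ^ (q - \<kappa> q U))) n"
    by (simp flip: labelled_count_Coeff[OF q])
  also have "\<dots> = (\<Sum>U\<in>?L. Coeff (2 * int q - int i)
      (\<lambda>n. real_of_int (mu0 M q U) * (\<alpha> q U n * N n ^ (q - \<kappa> q U))) n)"
    by (intro Coeff_sum finite_intersection_lattice finite_moves quasipolynomial_cmult quasi)
  also have "\<dots> = (\<Sum>U\<in>?L. contribution q i n U)"
    by (intro sum.cong refl Coeff_cmult quasi)
  finally show ?thesis .
qed

lemma space_in_lattice: "configs_on {1..q} \<in> intersection_lattice M q"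
  unfolding intersection_lattice_eq by (rule image_eqI[of _ _ "{}"]) (auto simp: solutions_def)

lemma contribution_space:
  "contribution q i n (configs_on {1..q}) = Coeff (2 * int q - int i) (\<lambda>n. N n ^ q) n"
proof -
  have "involved M q (configs_on {1..q}) = {}"
    using involved_empty_iff[OF zero_not_move space_in_lattice] by simp
  moreover have "subspace_count M B q (configs_on {1..q}) n = 1" for n
    using subspace_count_eq[OF space_in_lattice, of B q n] implied_empty_iff[OF zero_not_move space_in_lattice, of q]
    by (simp add: touched_def card_grid_points)
  moreover have "mu0 M q (configs_on {1..q}) = 1"
    by (simp add: mu0_def config_space_eq moebius.simps)
  ultimately show ?thesis by simp
qed

lemma lattice_elt_bounds:
  assumes U: "U \<in> intersection_lattice M q" "U \<noteq> configs_on {1..q}"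
  shows "2 \<le> \<kappa> q U" "\<kappa> q U \<le> 2 * codim q U" "codim q U \<le> 2 * \<kappa> q U - 2"
proof -
  show "2 \<le> \<kappa> q U" by (rule card_involved_ge_2[OF zero_not_move U])
  then show "codim q U \<le> 2 * \<kappa> q U - 2" by (intro codim_le_involved[OF finite_moves U(1)]) auto
  show "\<kappa> q U \<le> 2 * codim q U" by (rule involved_le_codim[OF finite_moves zero_not_move U(1)])
qed

lemma half_up_le_iff: "half_up k \<le> m \<longleftrightarrow> k \<le> 2 * m"
  by (simp add: nat_le_iff ceiling_le_iff divide_le_eq) linarith

abbreviation stratum :: "nat \<Rightarrow> nat \<Rightarrow> nat \<Rightarrow> config set set" where
  "stratum q k \<nu> \<equiv> {U \<in> intersection_lattice M q. \<kappa> q U = k \<and> codim q U = \<nu>}"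

text \<open>Codimensions above \<open>i\<close> contribute nothing, and
  \<open>lattice_elt_bounds\<close> puts the rest into the given ranges. The lower limit is variable
  so that one proof covers both versions of the formula.\<close>

lemma sum_contribution_strata:
  assumes q: "q \<ge> 1" and \<kappa>\<^sub>0: "\<kappa>\<^sub>0 \<ge> 2"
    and small: "\<forall>U\<in>intersection_lattice M q. \<kappa> q U < \<kappa>\<^sub>0 \<longrightarrow> U \<noteq> configs_on {1..q} \<longrightarrow> contribution q i n U = 0"
  shows "fact q * \<gamma> q i n = Coeff (2 * int q - int i) (\<lambda>n. N n ^ q) n +
    (\<Sum>k=\<kappa>\<^sub>0..2 * i. \<Sum>\<nu>=half_up k..min i (2 * k - 2). \<Sum>U\<in>stratum q k \<nu>. contribution q i n U)"
proof -
  let ?L = "intersection_lattice M q" and ?X = "configs_on {1..q}"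
  let ?T = "Sigma {\<kappa>\<^sub>0..2 * i} (\<lambda>k. {half_up k..min i (2 * k - 2)})"
  let ?S = "{U \<in> ?L. (\<kappa> q U, codim q U) \<in> ?T}"
  have fin: "finite ?L" by (rule finite_intersection_lattice[OF finite_moves])
  have zero: "contribution q i n U = 0" if U: "U \<in> ?L" "U \<noteq> ?X" "U \<notin> ?S" for U
  proof (cases "codim q U \<le> i \<and> \<kappa>\<^sub>0 \<le> \<kappa> q U")
    case True
    have "(\<kappa> q U, codim q U) \<in> ?T"
      using lattice_elt_bounds[OF U(1,2)] True by (auto simp del: nat_ceiling_le_eq simp: half_up_le_iff)
    then show ?thesis using U by simp
  next
    case False
    then show ?thesis
      using small U Coeff_\<alpha>_eq_0[OF move_subspacesI[OF q U(1)] \<kappa>_le, of i n] by fastforce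
  qed
  have XS: "?X \<notin> ?S" using involved_empty_iff[OF zero_not_move space_in_lattice, of q] \<kappa>\<^sub>0 by simp
  have "(\<Sum>U\<in>?L. contribution q i n U) = contribution q i n ?X + (\<Sum>U\<in>?L - {?X}. contribution q i n U)"
    by (rule sum.remove[OF fin space_in_lattice])
  also have "(\<Sum>U\<in>?L - {?X}. contribution q i n U) = (\<Sum>U\<in>?S. contribution q i n U)"
    by (rule sum.mono_neutral_right) (use fin zero XS in auto)
  also have "\<dots> = (\<Sum>p\<in>?T. \<Sum>U | U \<in> ?S \<and> (\<kappa> q U, codim q U) = p. contribution q i n U)"
    by (rule sum.group[symmetric]) (use fin in auto)
  also have "\<dots> = (\<Sum>(k, \<nu>)\<in>?T. \<Sum>U\<in>stratum q k \<nu>. contribution q i n U)"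
    by (intro sum.cong refl) (auto intro!: sum.cong)
  also have "\<dots> = (\<Sum>k=\<kappa>\<^sub>0..2 * i. \<Sum>\<nu>=half_up k..min i (2 * k - 2). \<Sum>U\<in>stratum q k \<nu>. contribution q i n U)"
    by (rule sum.Sigma[symmetric]) auto
  finally show ?thesis unfolding \<gamma>_eq_sum_contribution[OF q] contribution_space .
qed

lemma type_invariants:
  assumes "((q, U), (q', U')) \<in> same_type M"
  shows "mu0 M q U = mu0 M q' U'" "\<kappa> q U = \<kappa> q' U'" "codim q U = codim q' U'" "\<alpha> q U n = \<alpha> q' U' n"
proof -
  have UL: "U \<in> intersection_lattice M q" "U' \<in> intersection_lattice M q'"
    using assms by (auto simp: same_type_def move_subspaces_def)
  obtain \<sigma> where \<sigma>: "inj_on \<sigma> (touched (implied M q U))" "relabel \<sigma> ` implied M q U = implied M q' U'"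
    using assms by (auto simp: same_type_iff)
  have fin: "finite (touched (implied M q U))"
    by (rule finite_touched[OF implied_labels finite_implied[OF finite_moves]])
  show "mu0 M q U = mu0 M q' U'"
    unfolding mu0_eq_whitney[OF finite_moves zero_not_move UL(1)] mu0_eq_whitney[OF finite_moves zero_not_move UL(2)]
    using whitney_relabel[OF fin \<sigma>(1)] \<sigma>(2) by simp
  show "\<alpha> q U n = \<alpha> q' U' n"
    unfolding subspace_count_eq[OF UL(1)] subspace_count_eq[OF UL(2)] \<sigma>(2)[symmetric] touched_relabel
    using card_grid_configs_relabel[OF fin order_refl \<sigma>(1)] by simp
  show "\<kappa> q U = \<kappa> q' U'" by (rule involved_same_type[OF assms])
  show "codim q U = codim q' U'" by (rule codim_same_type[OF finite_moves assms])
qed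

lemma subspace_typesD:
  assumes T: "T \<in> subspace_types M k \<nu>" and x: "(q, U) \<in> T"
  shows "(q, U) \<in> move_subspaces M" "\<kappa> q U = k" "codim q U = \<nu>" "T = same_type M `` {(q, U)}"
proof -
  obtain q0 U0 where 0: "(q0, U0) \<in> move_subspaces M" "\<kappa> q0 U0 = k" "codim q0 U0 = \<nu>" "T = same_type M `` {(q0, U0)}"
    using T unfolding subspace_types_def by (auto elim!: quotientE)
  have st: "((q0, U0), (q, U)) \<in> same_type M" using x 0(4) by blast
  then show "(q, U) \<in> move_subspaces M" by (auto simp: same_type_def)
  show "\<kappa> q U = k" "codim q U = \<nu>" using type_invariants(2,3)[OF st] 0 by auto
  show "T = same_type M `` {(q, U)}" unfolding 0(4) by (rule equiv_class_eq[OF equiv_same_type st])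
qed

text \<open>The expansion of \<open>\<alpha>\<close> is multiplied by the power of \<open>N\<close>
  for the free pieces. With \<open>k = j + half_up (codim q' U)\<close> the exponents add up to
  \<open>q - k\<close>, so the inner sum of the formula is the term of inclusion-exclusion.\<close>

lemma \<Gamma>_sum_eq:
  assumes U: "(q', U) \<in> move_subspaces M" and q: "\<kappa> q' U \<le> q"
  shows "(\<Sum>k = half_up (codim q' U)..\<kappa> q' U. \<Gamma> q' U (k - half_up (codim q' U)) n * N n ^ (q - k))
    = \<alpha> q' U n * N n ^ (q - \<kappa> q' U)"
proof -
  define h where "h = half_up (codim q' U)"
  let ?h = h and ?k = "\<kappa> q' U"
  have h: "?h \<le> ?k"
    using codim_le_2\<kappa> U unfolding h_def half_up_le_iff by (simp add: move_subspaces_def)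
  have "(\<Sum>k = ?h..?k. \<Gamma> q' U (k - ?h) n * N n ^ (q - k))
      = (\<Sum>j = 0..?k - ?h. \<Gamma> q' U j n * N n ^ (q - (j + ?h)))"
    by (rule sum.reindex_bij_witness[of _ "\<lambda>j. j + ?h" "\<lambda>k. k - ?h"]) (use h in auto)
  also have "\<dots> = (\<Sum>j = 0..?k - ?h. \<Gamma> q' U j n * N n ^ (?k - ?h - j) * N n ^ (q - ?k))"
  proof (rule sum.cong[OF refl])
    fix j assume "j \<in> {0..?k - ?h}"
    then have "q - (j + ?h) = (?k - ?h - j) + (q - ?k)" using h q by auto
    then show "\<Gamma> q' U j n * N n ^ (q - (j + ?h)) = \<Gamma> q' U j n * N n ^ (?k - ?h - j) * N n ^ (q - ?k)"
      by (simp only: power_add mult.assoc)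
  qed
  finally show ?thesis by (simp only: \<alpha>_expansion(1)[OF U] sum_distrib_right h_def)
qed

lemma card_automorphisms_pos: "card (automorphisms M q U) > 0"
proof -
  have "Poly_Mapping.map_key id ` U = U"
    by (simp add: map_key_id[unfolded id_def[symmetric]])
  then have "id \<in> automorphisms M q U" by (simp add: automorphisms_def permutes_id)
  moreover have "finite (automorphisms M q U)"
    by (rule finite_subset[OF _ finite_permutations[OF finite_involved]]) (auto simp: automorphisms_def)
  ultimately show ?thesis by (auto simp: card_gt_0_iff)
qed

text \<open>For \<open>q \<ge> k\<close> a type with \<open>k\<close> pieces has a member among
  \<open>q\<close> pieces, because the falling factorial in \<open>card_type_members\<close> is not
  0. So the types are represented inside one finite lattice.\<close>

lemma finite_subspace_types:
  assumes "k \<le> q" "1 \<le> q"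
  shows "subspace_types M k \<nu> = (\<lambda>U. same_type M `` {(q, U)}) ` stratum q k \<nu>" "finite (subspace_types M k \<nu>)"
proof -
  have "subspace_types M k \<nu> \<subseteq> (\<lambda>U. same_type M `` {(q, U)}) ` stratum q k \<nu>"
  proof
    fix T assume T: "T \<in> subspace_types M k \<nu>"
    then obtain x0 where x0: "x0 \<in> move_subspaces M" "T = same_type M `` {x0}"
      unfolding subspace_types_def by (auto elim!: quotientE)
    then have "x0 \<in> T" using equiv_class_self[OF equiv_same_type] by simp
    then obtain q' U' where x: "(q', U') \<in> T" by (cases x0) simp
    note D = subspace_typesD[OF T x]
    have "(\<Prod>l<k. real q - real l) \<noteq> 0" using assms(1) by auto
    then have "real (card {V \<in> intersection_lattice M q. ((q', U'), (q, V)) \<in> same_type M}) *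
        real (card (automorphisms M q' U')) \<noteq> 0"
      unfolding card_type_members[OF finite_moves zero_not_move D(1) assms(2)] D(2) .
    then have "card {V \<in> intersection_lattice M q. ((q', U'), (q, V)) \<in> same_type M} \<noteq> 0"
      by (metis mult_zero_left of_nat_0)
    then obtain V where V: "V \<in> intersection_lattice M q" "((q', U'), (q, V)) \<in> same_type M"
      by (metis (mono_tags, lifting) card.empty empty_Collect_eq)
    then have "V \<in> stratum q k \<nu>" using type_invariants(2,3)[OF V(2)] D by simp
    moreover have "T = same_type M `` {(q, V)}"
      using equiv_class_eq[OF equiv_same_type V(2)] D(4) by simp
    ultimately show "T \<in> (\<lambda>U. same_type M `` {(q, U)}) ` stratum q k \<nu>" by blast
  qed
  moreover have "(\<lambda>U. same_type M `` {(q, U)}) ` stratum q k \<nu> \<subseteq> subspace_types M k \<nu>"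
    unfolding subspace_types_def using assms(2) by (auto intro!: quotientI simp: move_subspaces_def)
  ultimately show eq: "subspace_types M k \<nu> = (\<lambda>U. same_type M `` {(q, U)}) ` stratum q k \<nu>" by blast
  show "finite (subspace_types M k \<nu>)"
    unfolding eq using finite_intersection_lattice[OF finite_moves, of q] by simp
qed

text \<open>All members of a type contribute equally, and \<open>card_type_members\<close> gives
  their number.\<close>

lemma sum_stratum:
  assumes q: "q \<ge> 1" and rep: "\<forall>k \<nu>. \<forall>T\<in>subspace_types M k \<nu>. rep T \<in> T"
  shows "(\<Sum>U\<in>stratum q k \<nu>. contribution q i n U) = (\<Prod>l<k. real q - real l) *
    (\<Sum>T\<in>subspace_types M k \<nu>. case rep T of (q', U) \<Rightarrow>
       real_of_int (mu0 M q' U) * (1 / real (card (automorphisms M q' U))) *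
       Coeff (2 * int q - int i)
         (\<lambda>n. \<Sum>j = half_up \<nu>..k. \<Gamma> q' U (j - half_up \<nu>) n * N n ^ (q - j)) n)"
proof (cases "k \<le> q")
  \<comment> \<open>No subspace for \<open>q\<close> pieces involves more than \<open>q\<close> of
    them, and the falling factorial vanishes as well.\<close>
  case False
  then have empty: "stratum q k \<nu> = {}" using \<kappa>_le by fastforce
  show ?thesis unfolding empty using falling_eq_0[of q k] False by simp
next
  case True
  let ?cl = "\<lambda>U. same_type M `` {(q, U)}"
  note types = finite_subspace_types[OF True q, of \<nu>]
  have "(\<Sum>U\<in>stratum q k \<nu>. contribution q i n U)
      = (\<Sum>T\<in>subspace_types M k \<nu>. \<Sum>U | U \<in> stratum q k \<nu> \<and> ?cl U = T. contribution q i n U)"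
    by (rule sum.group[symmetric])
      (use types finite_intersection_lattice[OF finite_moves, of q] in auto)
  also have "\<dots> = (\<Sum>T\<in>subspace_types M k \<nu>. (\<Prod>l<k. real q - real l) * (case rep T of (q', U) \<Rightarrow>
       real_of_int (mu0 M q' U) * (1 / real (card (automorphisms M q' U))) *
       Coeff (2 * int q - int i)
         (\<lambda>n. \<Sum>j = half_up \<nu>..k. \<Gamma> q' U (j - half_up \<nu>) n * N n ^ (q - j)) n))"
  proof (rule sum.cong[OF refl])
    fix T assume T: "T \<in> subspace_types M k \<nu>"
    obtain q' U' where x: "rep T = (q', U')" by (cases "rep T")
    then have "(q', U') \<in> T" using rep T by metis
    note D = subspace_typesD[OF T this]
    let ?X = "{V \<in> intersection_lattice M q. ((q', U'), (q, V)) \<in> same_type M}"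
    have cl: "?cl V = T \<longleftrightarrow> ((q', U'), (q, V)) \<in> same_type M" if "V \<in> intersection_lattice M q" for V
      unfolding D(4) using eq_equiv_class_iff[OF equiv_same_type move_subspacesI[OF q that] D(1)]
        equiv_same_type[of M] by (metis equivE symE)
    have eq: "{U. U \<in> stratum q k \<nu> \<and> ?cl U = T} = ?X"
      using cl type_invariants(2,3) D(2,3) by auto
    define C where "C = Coeff (2 * int q - int i) (\<lambda>n. \<alpha> q' U' n * N n ^ (q - k)) n"
    have contr: "contribution q i n V = real_of_int (mu0 M q' U') * C" if "V \<in> ?X" for V
    proof -
      have st: "((q', U'), (q, V)) \<in> same_type M" using that by simp
      show ?thesis unfolding C_def type_invariants(1,4)[OF st] type_invariants(2)[OF st, symmetric] D(2) ..
    qed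
    have "(\<Sum>U | U \<in> stratum q k \<nu> \<and> ?cl U = T. contribution q i n U) = (\<Sum>V\<in>?X. real_of_int (mu0 M q' U') * C)"
      unfolding eq by (rule sum.cong[OF refl contr])
    also have "\<dots> = real (card ?X) * (real_of_int (mu0 M q' U') * C)" by simp
    also have "real (card ?X) = (\<Prod>l<k. real q - real l) / real (card (automorphisms M q' U'))"
      using card_type_members[OF finite_moves zero_not_move D(1) q] D(2) card_automorphisms_pos[of q' U']
      by (simp add: field_simps)
    also have "C = Coeff (2 * int q - int i) (\<lambda>n. \<Sum>j = half_up \<nu>..k. \<Gamma> q' U' (j - half_up \<nu>) n * N n ^ (q - j)) n"
      unfolding C_def using \<Gamma>_sum_eq[OF D(1)] D(2,3) True by (simp only:)
    finally show "(\<Sum>U | U \<in> stratum q k \<nu> \<and> ?cl U = T. contribution q i n U) = (\<Prod>l<k. real q - real l) * (case rep T of (q', U) \<Rightarrow>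
       real_of_int (mu0 M q' U) * (1 / real (card (automorphisms M q' U))) *
       Coeff (2 * int q - int i)
         (\<lambda>n. \<Sum>j = half_up \<nu>..k. \<Gamma> q' U (j - half_up \<nu>) n * N n ^ (q - j)) n)"
      by (simp add: x)
  qed
  finally show ?thesis by (simp only: sum_distrib_left)
qed

theorem coefficient_formula_general:
  assumes q: "q \<ge> 1" and rep: "\<forall>k \<nu>. \<forall>T\<in>subspace_types M k \<nu>. rep T \<in> T" and \<kappa>\<^sub>0: "\<kappa>\<^sub>0 \<ge> 2"
    and small: "\<forall>U\<in>intersection_lattice M q. \<kappa> q U < \<kappa>\<^sub>0 \<longrightarrow> U \<noteq> configs_on {1..q} \<longrightarrow> contribution q i n U = 0"
  shows "fact q * \<gamma> q i n = coefficient_formula M B \<Gamma> rep \<kappa>\<^sub>0 q i n"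
  unfolding sum_contribution_strata[OF q \<kappa>\<^sub>0 small] sum_stratum[OF q rep] coefficient_formula_def
  by (intro arg_cong2[where f = "(+)"] sum.cong refl sum_distrib_left[symmetric])

text \<open>\<open>\<alpha>\<close> can lower the degree by at most \<open>2 \<kappa>\<close>, so
  the power of \<open>N\<close> would have to supply the rest of \<open>i\<close>. A pure monomial
  has no lower terms to do so.\<close>

lemma small_contribution:
  assumes N: "\<forall>n. N n = vol B * real n ^ 2" and q: "q \<ge> 1"
  shows "\<forall>U\<in>intersection_lattice M q. \<kappa> q U < max 2 (half_up i) \<longrightarrow> U \<noteq> configs_on {1..q} \<longrightarrow> contribution q i n U = 0"
proof (intro ballI impI)
  fix U assume U: "U \<in> intersection_lattice M q" "\<kappa> q U < max 2 (half_up i)" "U \<noteq> configs_on {1..q}"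
  then have "\<not> half_up i \<le> \<kappa> q U" using lattice_elt_bounds(1)[OF U(1,3)] by linarith
  then have i: "2 * \<kappa> q U < i" by (simp only: half_up_le_iff not_le)
  have "has_constituents N (\<lambda>n. [:0, 0, vol B:])"
    using N by (simp add: has_constituents_def power2_eq_square mult_ac)
  from has_constituents_unique[OF N_poly this]
  have c: "\<gamma> 1 2 n = 0" "\<gamma> 1 1 n = 0" by (auto dest: fun_cong[of _ _ n])
  have "coeff ([:vol B, \<gamma> 1 1 n, \<gamma> 1 2 n:] ^ (q - \<kappa> q U)) (i - s) = 0" if "s \<le> 2 * \<kappa> q U" for s
  proof -
    have "[:vol B, \<gamma> 1 1 n, \<gamma> 1 2 n:] ^ (q - \<kappa> q U) = [:vol B ^ (q - \<kappa> q U):]"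
      unfolding c by (simp add: poly_const_pow)
    then show ?thesis using that i by (simp add: coeff_pCons split: nat.split)
  qed
  then show "contribution q i n U = 0"
    unfolding Coeff_\<alpha>[OF move_subspacesI[OF q U(1)] \<kappa>_le] by (simp add: sum.neutral)
qed

section \<open>Dependence of the coefficients on the number of pieces\<close>

lemma quadratic_power_coeff:
  "coeff ([:vol B, \<gamma> 1 1 n, \<gamma> 1 2 n:] ^ r) j
    = vol B ^ r * poly (trinomial_poly (\<gamma> 1 1 n / vol B) (\<gamma> 1 2 n / vol B) j) (real r)"
proof -
  have "vol B \<noteq> 0" using vol_pos[OF polygon] by simp
  then have "[:vol B, \<gamma> 1 1 n, \<gamma> 1 2 n:] = [:vol B, vol B * (\<gamma> 1 1 n / vol B), vol B * (\<gamma> 1 2 n / vol B):]"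
    by simp
  then show ?thesis by (simp only: coeff_trinomial_power)
qed

lemma Coeff_N_power:
  "Coeff (2 * int q - int i) (\<lambda>n. N n ^ q) n = coeff ([:vol B, \<gamma> 1 1 n, \<gamma> 1 2 n:] ^ q) i"
proof (cases "i \<le> 2 * q")
  case True
  then have "nat (2 * int q - int i) = 2 * q - i" by simp
  then show ?thesis
    unfolding Coeff_eq[OF has_constituents_power[OF N_poly]]
    using True coeff_quadratic_power[of "\<gamma> 1 2 n" "\<gamma> 1 1 n" "vol B" q "2 * q - i"] by simp
next
  case False
  then show ?thesis
    unfolding Coeff_eq[OF has_constituents_power[OF N_poly]] by (simp add: coeff_quadratic_power_eq_0)
qed

lemma \<gamma>_0:
  assumes q: "q \<ge> 1"
  shows "\<gamma> q 0 n = vol B ^ q / fact q"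
proof -
  have "fact q * \<gamma> q 0 n = Coeff (2 * int q - int 0) (\<lambda>n. N n ^ q) n"
  proof -
    have "\<forall>U\<in>intersection_lattice M q. \<kappa> q U < 2 \<longrightarrow> U \<noteq> configs_on {1..q} \<longrightarrow> contribution q 0 n U = 0"
      using lattice_elt_bounds(1)[of _ q] by fastforce
    \<comment> \<open>For \<open>i = 0\<close> the range \<open>2..2 * i\<close> is empty, so only
      the whole space remains.\<close>
    from sum_contribution_strata[OF q order_refl this] show ?thesis by simp
  qed
  also have "\<dots> = vol B ^ q"
    unfolding Coeff_N_power by (simp add: coeff_0_power)
  finally show ?thesis by (simp add: field_simps)
qed

text \<open>
  Only the subspaces with \<open>\<kappa> = 2 \<nu>\<close> contribute to the term of degree \<open>2 i\<close> in \<open>q\<close>, and their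
  contributions all have the sign \<open>(-1)\<^sup>i\<close>.
\<close>

lemma extremal_matching:
  assumes U: "U \<in> intersection_lattice M q" and eq: "\<kappa> q U = 2 * codim q U"
  shows "matching (implied M q U)" "card (implied M q U) = codim q U"
proof -
  obtain F where F: "F \<subseteq> implied M q U" "solutions F = solutions (implied M q U)"
    "card F = codim q U" "finite F" by (rule codim_basis[OF finite_moves U])
  have lab: "F \<subseteq> labels M {1..q}" using F(1) implied_labels by (rule order_trans)
  have "matching F"
    using matching_of_card[OF lab F(4)] codim_touched[OF finite_moves zero_not_move U F(1,2)] eq F(3) by simp
  then have "implied M q U = F"
    using matching_unique[OF moves lab F(4) _ implied_labels] F(2) by simp
  then show "matching (implied M q U)" "card (implied M q U) = codim q U"
    using \<open>matching F\<close> F(3) by simp_all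
qed

text \<open>The flat is its own only generating subset, so Whitney's sum has one term.\<close>

lemma mu0_extremal:
  assumes U: "U \<in> intersection_lattice M q" and eq: "\<kappa> q U = 2 * codim q U"
  shows "mu0 M q U = (-1) ^ codim q U"
proof -
  let ?C = "implied M q U"
  have "{F. F \<subseteq> ?C \<and> solutions F = solutions ?C} = {?C}"
    using matching_unique[OF moves implied_labels finite_implied[OF finite_moves] extremal_matching(1)[OF U eq]]
      implied_labels[of M q U] by (auto dest: order_trans)
  then show ?thesis
    unfolding mu0_eq_whitney[OF finite_moves zero_not_move U] whitney_def
    using extremal_matching(2)[OF U eq] by simp
qed

text \<open>For \<open>\<kappa> = 2 \<nu>\<close> the largest possible degree
  \<open>2 \<kappa> - \<nu>\<close> is \<open>3 \<nu>\<close>, and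
  \<open>matching_count_lower\<close> shows that it is attained.\<close>

lemma \<alpha>_leading_pos:
  assumes U: "(q, U) \<in> move_subspaces M" and eq: "\<kappa> q U = 2 * codim q U"
  shows "coeff (\<alpha>_poly q U n) (3 * codim q U) > 0"
proof -
  let ?C = "implied M q U"
  have UL: "U \<in> intersection_lattice M q" using U by (simp add: move_subspaces_def)
  obtain a where a: "a > 0" "\<forall>\<^sub>F n in sequentially.
      real (card (grid_configs (touched ?C) ?C (board_points B n))) \<ge> a * real n ^ (3 * card ?C)"
    using matching_count_lower[OF finite_moves polygon implied_labels finite_implied[OF finite_moves]
        extremal_matching(1)[OF UL eq]] by blast
  show ?thesis
  proof (rule constituents_coeff_pos[OF has_constituents_constituents[OF \<alpha>_quasi[OF U]] _ a(1)])
    show "degree (\<alpha>_poly q U n) \<le> 3 * codim q U" using \<alpha>_degree[OF U, of n] eq by simp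
    show "\<forall>\<^sub>F n in sequentially. a * real n ^ (3 * codim q U) \<le> \<alpha> q U n"
      using a(2) unfolding extremal_matching(2)[OF UL eq] subspace_count_eq[OF UL] .
  qed
qed

text \<open>Provides a type that carries the top coefficient in \<open>q\<close>. One move joins the
  pieces 1 and 2, then 3 and 4, and so on; the codimension is at most the number \<open>i\<close> of
  labels and at least half the number of pieces.\<close>

lemma extremal_exists: "subspace_types M (2 * i) i \<noteq> {}"
proof -
  obtain m where m: "m \<in> M" using moves_nonempty by blast
  \<comment> \<open>\<open>max\<close> because \<open>move_subspaces\<close> asks for at least one
    piece, even for \<open>i = 0\<close>.\<close>
  define q where "q = max 1 (2 * i)"
  define F where "F = (\<lambda>k. (m, {2 * k + 1, 2 * k + 2 :: nat})) ` {..<i}"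
  let ?U = "configs_on {1..q} \<inter> solutions F"
  have lab: "F \<subseteq> labels M {1..q}" using m by (auto simp: F_def labels_def q_def)
  have inj: "inj_on (\<lambda>k. (m, {2 * k + 1, 2 * k + 2 :: nat})) {..<i}"
    by (auto simp: inj_on_def doubleton_eq_iff)
  have fin: "finite F" "card F = i" using card_image[OF inj] by (simp_all add: F_def)
  have match: "matching F"
    unfolding matching_def F_def by (auto simp: doubleton_eq_iff)
  have UL: "?U \<in> intersection_lattice M q" unfolding intersection_lattice_eq using lab by blast
  have imp: "implied M q ?U = F"
  proof (rule matching_unique[OF moves lab fin(1) match implied_labels])
    have "F \<subseteq> implied M q ?U" using lab by (auto simp: implied_def solutions_def)
    then have "solutions (implied M q ?U) \<subseteq> solutions F" by (rule solutions_mono)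
    moreover have "solutions F \<subseteq> solutions (implied M q ?U)"
      unfolding implied_eq[OF lab] by (auto simp: solutions_def)
    ultimately show "solutions (implied M q ?U) = solutions F" by simp
  qed
  have "touched F = {1..2 * i}"
  proof (intro equalityI subsetI)
    fix x assume "x \<in> {1..2 * i}"
    then have "(x - 1) div 2 < i" "x \<in> {2 * ((x - 1) div 2) + 1, 2 * ((x - 1) div 2) + 2}"
      by auto
    then show "x \<in> touched F" unfolding touched_def F_def by auto
  qed (auto simp: touched_def F_def)
  then have kap: "\<kappa> q ?U = 2 * i"
    unfolding involved_eq[OF lattice_subset_space[OF UL]] imp by simp
  have "codim q ?U \<le> i"
    using codim_le_card[OF finite_moves lab _ UL] imp fin(2) by simp
  moreover have "2 * i \<le> 2 * codim q ?U"
    using involved_le_codim[OF finite_moves zero_not_move UL] kap by simp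
  ultimately have "codim q ?U = i" by simp
  then have "same_type M `` {(q, ?U)} \<in> subspace_types M (2 * i) i"
    unfolding subspace_types_def using kap UL by (auto intro!: quotientI simp: move_subspaces_def q_def)
  then show ?thesis by blast
qed

text \<open>The coefficient contributed by \<open>\<alpha>\<close> and the power of
  \<open>N\<close>, divided by \<open>vol B ^ q\<close>, as a polynomial in \<open>q\<close>.
  \<open>pcompose\<close> substitutes \<open>q - \<kappa>\<close> for the exponent of
  \<open>N\<close>, and the division by \<open>vol B ^ \<kappa>\<close> accounts for the missing
  factors of the volume.\<close>

definition type_poly :: "nat \<Rightarrow> nat \<Rightarrow> nat \<Rightarrow> config set \<Rightarrow> real poly" where
  "type_poly i n q' U = (\<Sum>s\<le>i. smult ((if s \<le> 2 * \<kappa> q' U then coeff (\<alpha>_poly q' U n) (2 * \<kappa> q' U - s) else 0)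
      / vol B ^ \<kappa> q' U)
     (pcompose (trinomial_poly (\<gamma> 1 1 n / vol B) (\<gamma> 1 2 n / vol B) (i - s)) [:- real (\<kappa> q' U), 1:]))"

lemma poly_type_poly:
  assumes U: "(q', U) \<in> move_subspaces M" and q: "\<kappa> q' U \<le> q"
  shows "Coeff (2 * int q - int i) (\<lambda>n. \<alpha> q' U n * N n ^ (q - \<kappa> q' U)) n = vol B ^ q * poly (type_poly i n q' U) (real q)"
proof -
  have "vol B \<noteq> 0" using vol_pos[OF polygon] by simp
  then have v: "vol B ^ (q - \<kappa> q' U) = vol B ^ q / vol B ^ \<kappa> q' U" by (rule power_diff[OF _ q])
  show ?thesis
    unfolding Coeff_\<alpha>[OF U q] quadratic_power_coeff type_poly_def poly_sum sum_distrib_left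
  proof (rule sum.cong[OF refl])
    fix s assume "s \<in> {..i}"
    show "(if s \<le> 2 * \<kappa> q' U then coeff (\<alpha>_poly q' U n) (2 * \<kappa> q' U - s) else 0) *
        (vol B ^ (q - \<kappa> q' U) * poly (trinomial_poly (\<gamma> 1 1 n / vol B) (\<gamma> 1 2 n / vol B) (i - s)) (real (q - \<kappa> q' U)))
      = vol B ^ q * poly (smult ((if s \<le> 2 * \<kappa> q' U then coeff (\<alpha>_poly q' U n) (2 * \<kappa> q' U - s) else 0) / vol B ^ \<kappa> q' U)
        (pcompose (trinomial_poly (\<gamma> 1 1 n / vol B) (\<gamma> 1 2 n / vol B) (i - s)) [:- real (\<kappa> q' U), 1:])) (real q)"
      unfolding v using q by (simp add: poly_pcompose of_nat_diff)
  qed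
qed

text \<open>Terms with \<open>s < \<nu>\<close> vanish because \<open>\<alpha>\<close> has degree at
  most \<open>2 \<kappa> - \<nu>\<close>; the others have degree at most
  \<open>i - s\<close>.\<close>

lemma degree_type_poly:
  assumes U: "(q', U) \<in> move_subspaces M"
  shows "degree (type_poly i n q' U) \<le> i - codim q' U"
  unfolding type_poly_def
proof (rule degree_sum_le)
  fix s assume s: "s \<in> {..i}"
  let ?c = "(if s \<le> 2 * \<kappa> q' U then coeff (\<alpha>_poly q' U n) (2 * \<kappa> q' U - s) else 0) / vol B ^ \<kappa> q' U"
  let ?P = "pcompose (trinomial_poly (\<gamma> 1 1 n / vol B) (\<gamma> 1 2 n / vol B) (i - s)) [:- real (\<kappa> q' U), 1:]"
  show "degree (smult ?c ?P) \<le> i - codim q' U"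
  proof (cases "s < codim q' U")
    case True
    then show ?thesis using \<alpha>_coeff_eq_0[OF U True, of n] by simp
  next
    case False
    have "degree (smult ?c ?P) \<le> degree ?P" by (rule degree_smult_le)
    also have "\<dots> \<le> i - s" using degree_trinomial_poly by (simp add: degree_pcompose)
    also have "\<dots> \<le> i - codim q' U" using False by simp
    finally show ?thesis .
  qed
qed simp

text \<open>Only \<open>s = i\<close> survives, and then the power of \<open>N\<close> contributes
  nothing but its leading coefficient.\<close>

lemma type_poly_extremal:
  assumes U: "(q', U) \<in> move_subspaces M" and eq: "\<kappa> q' U = 2 * i" "codim q' U = i"
  shows "coeff (type_poly i n q' U) 0 > 0"
proof -
  have "type_poly i n q' U = (\<Sum>s\<in>{i}. smult ((if s \<le> 2 * \<kappa> q' U then coeff (\<alpha>_poly q' U n) (2 * \<kappa> q' U - s) else 0)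
      / vol B ^ \<kappa> q' U)
     (pcompose (trinomial_poly (\<gamma> 1 1 n / vol B) (\<gamma> 1 2 n / vol B) (i - s)) [:- real (\<kappa> q' U), 1:]))"
    unfolding type_poly_def
    by (rule sum.mono_neutral_right) (use \<alpha>_coeff_eq_0[OF U, of _ n] eq in auto)
  also have "\<dots> = [:coeff (\<alpha>_poly q' U n) (3 * i) / vol B ^ (2 * i):]"
    using eq by (simp add: trinomial_poly_0 pcompose_1)
  finally show ?thesis
    using \<alpha>_leading_pos[OF U, of n] eq vol_pos[OF polygon] by simp
qed

text \<open>\<open>p\<close> is built from types, which do not depend on \<open>q\<close>. The same
  \<open>p\<close> therefore serves all \<open>q\<close>; for small \<open>q\<close> the falling
  factorials remove the types with too many pieces.\<close>

lemma coefficient_polynomial: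
  assumes rep: "\<forall>k \<nu>. \<forall>T\<in>subspace_types M k \<nu>. rep T \<in> T"
  shows "\<exists>p :: real poly. degree p = 2 * i \<and> (\<forall>q\<ge>1. fact q * \<gamma> q i n = vol B ^ q * poly p (real q))"
proof -
  define w where "w = (\<lambda>(q', U). real_of_int (mu0 M q' U) * (1 / real (card (automorphisms M q' U))))"
  define P where "P = (\<lambda>(q', U). type_poly i n q' U)"
  define Q where "Q k \<nu> = falling_poly k * (\<Sum>T\<in>subspace_types M k \<nu>. smult (w (rep T)) (P (rep T)))" for k \<nu>
  define p where "p = trinomial_poly (\<gamma> 1 1 n / vol B) (\<gamma> 1 2 n / vol B) i
    + (\<Sum>k=2..2 * i. \<Sum>\<nu>=half_up k..min i (2 * k - 2). Q k \<nu>)"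
  have stratum: "(\<Sum>U\<in>stratum q k \<nu>. contribution q i n U) = vol B ^ q * poly (Q k \<nu>) (real q)"
    if q: "q \<ge> 1" for q k \<nu>
  proof (cases "k \<le> q")
    case False
    then have "stratum q k \<nu> = {}" using \<kappa>_le by fastforce
    moreover have "poly (falling_poly k) (real q) = 0"
      unfolding poly_falling_poly using False by (intro falling_eq_0) simp
    ultimately show ?thesis by (simp only: Q_def poly_mult) simp
  next
    case True
    have "(case rep T of (q', U) \<Rightarrow>
       real_of_int (mu0 M q' U) * (1 / real (card (automorphisms M q' U))) *
       Coeff (2 * int q - int i)
         (\<lambda>n. \<Sum>j = half_up \<nu>..k. \<Gamma> q' U (j - half_up \<nu>) n * N n ^ (q - j)) n)
      = vol B ^ q * poly (smult (w (rep T)) (P (rep T))) (real q)" if T: "T \<in> subspace_types M k \<nu>" for T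
    proof -
      obtain q' U' where x: "rep T = (q', U')" by (cases "rep T")
      then have "(q', U') \<in> T" using rep T by metis
      note D = subspace_typesD[OF T this]
      have k: "\<kappa> q' U' \<le> q" using D(2) True by simp
      have "(\<lambda>n. \<Sum>j = half_up \<nu>..k. \<Gamma> q' U' (j - half_up \<nu>) n * N n ^ (q - j)) = (\<lambda>n. \<alpha> q' U' n * N n ^ (q - \<kappa> q' U'))"
        using \<Gamma>_sum_eq[OF D(1) k] D(2,3) by (simp only:)
      then show ?thesis using poly_type_poly[OF D(1) k, of i n] by (simp add: x w_def P_def)
    qed
    then show ?thesis
      unfolding sum_stratum[OF q rep] Q_def poly_mult poly_falling_poly poly_sum
      by (simp only: sum_distrib_left mult.left_commute cong: sum.cong)
  qed
  have eval_p: "fact q * \<gamma> q i n = vol B ^ q * poly p (real q)" if q: "q \<ge> 1" for q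
  proof -
    have "\<forall>U\<in>intersection_lattice M q. \<kappa> q U < 2 \<longrightarrow> U \<noteq> configs_on {1..q} \<longrightarrow> contribution q i n U = 0"
      using lattice_elt_bounds(1)[of _ q] by fastforce
    from sum_contribution_strata[OF q order_refl this]
    have "fact q * \<gamma> q i n = coeff ([:vol B, \<gamma> 1 1 n, \<gamma> 1 2 n:] ^ q) i
        + (\<Sum>k=2..2 * i. \<Sum>\<nu>=half_up k..min i (2 * k - 2). vol B ^ q * poly (Q k \<nu>) (real q))"
      by (simp only: stratum[OF q] Coeff_N_power)
    then show ?thesis
      by (simp only: p_def quadratic_power_coeff poly_add poly_sum sum_distrib_left distrib_left)
  qed
  have degQ: "degree (Q k \<nu>) \<le> k + (i - \<nu>)" if "\<nu> \<le> i" for k \<nu>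
  proof -
    have "degree (\<Sum>T\<in>subspace_types M k \<nu>. smult (w (rep T)) (P (rep T))) \<le> i - \<nu>"
    proof (cases "finite (subspace_types M k \<nu>)")
      case True
      then show ?thesis
      proof (rule degree_sum_le)
        fix T assume T: "T \<in> subspace_types M k \<nu>"
        obtain q' U' where x: "rep T = (q', U')" by (cases "rep T")
        then have "(q', U') \<in> T" using rep T by metis
        note D = subspace_typesD[OF T this]
        have "degree (smult (w (rep T)) (P (rep T))) \<le> degree (P (rep T))" by (rule degree_smult_le)
        also have "\<dots> \<le> i - \<nu>" using degree_type_poly[OF D(1), of i n] D(3) by (simp add: P_def x)
        finally show "degree (smult (w (rep T)) (P (rep T))) \<le> i - \<nu>" .
      qed
    qed simp
    then show ?thesis
      unfolding Q_def using degree_mult_le[of "falling_poly k"] monic_falling_poly(1)[of k]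
      by (metis (no_types, lifting) add_le_cancel_left order_trans)
  qed
  have small: "degree (Q k \<nu>) < 2 * i" if "k \<in> {2..2 * i}" "\<nu> \<in> {half_up k..min i (2 * k - 2)}" "(k, \<nu>) \<noteq> (2 * i, i)" for k \<nu>
  proof -
    have "half_up k \<le> \<nu>" "\<nu> \<le> i" using that(2) by auto
    then have "k \<le> 2 * \<nu>" by (simp only: half_up_le_iff)
    moreover have "degree (Q k \<nu>) \<le> k + (i - \<nu>)" by (rule degQ[OF \<open>\<nu> \<le> i\<close>])
    ultimately show ?thesis using that(3) \<open>\<nu> \<le> i\<close> by (cases "\<nu> = i"; cases "k = 2 * i") auto
  qed
  have "degree p = 2 * i"
  proof (cases "i = 0")
    \<comment> \<open>The sums over \<open>k\<close> and \<open>\<nu>\<close> are empty and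
      \<open>p = 1\<close>.\<close>
    case True
    then show ?thesis by (simp add: p_def trinomial_poly_0)
  next
    case False
    let ?R = "\<Sum>k=2..2 * i. \<Sum>\<nu>=half_up k..min i (2 * k - 2). Q k \<nu>"
    have "degree ?R \<le> 2 * i"
    proof (intro degree_sum_le)
      fix k \<nu> assume "k \<in> {2..2 * i}" "\<nu> \<in> {half_up k..min i (2 * k - 2)}"
      then show "degree (Q k \<nu>) \<le> 2 * i"
        using small[of k \<nu>] degQ[of i "2 * i"] by (cases "(k, \<nu>) = (2 * i, i)") auto
    qed auto
    \<comment> \<open>The whole space contributes only degree \<open>i\<close>, which is below
      \<open>2 * i\<close> here.\<close>
    moreover have tri: "degree (trinomial_poly (\<gamma> 1 1 n / vol B) (\<gamma> 1 2 n / vol B) i) < 2 * i"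
      using degree_trinomial_poly[of "\<gamma> 1 1 n / vol B" "\<gamma> 1 2 n / vol B" i] False by linarith
    ultimately have le: "degree p \<le> 2 * i" unfolding p_def by (intro degree_add_le) auto
    have mem: "2 * i \<in> {2..2 * i}" "i \<in> {half_up (2 * i)..min i (2 * (2 * i) - 2)}"
      using False half_up_le_iff[of "2 * i" i] by auto
    have "coeff p (2 * i) = (\<Sum>k=2..2 * i. \<Sum>\<nu>=half_up k..min i (2 * k - 2). coeff (Q k \<nu>) (2 * i))"
      unfolding p_def using tri by (simp add: coeff_sum coeff_eq_0)
    also have "\<dots> = (\<Sum>k=2..2 * i. \<Sum>\<nu>=half_up k..min i (2 * k - 2). if k = 2 * i \<and> \<nu> = i then coeff (Q (2 * i) i) (2 * i) else 0)"
      using small by (intro sum.cong refl) (auto simp: coeff_eq_0)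
    also have "\<dots> = (\<Sum>k=2..2 * i. if k = 2 * i then coeff (Q (2 * i) i) (2 * i) else 0)"
    proof (rule sum.cong[OF refl])
      fix k assume "k \<in> {2..2 * i}"
      show "(\<Sum>\<nu>=half_up k..min i (2 * k - 2). if k = 2 * i \<and> \<nu> = i then coeff (Q (2 * i) i) (2 * i) else 0)
        = (if k = 2 * i then coeff (Q (2 * i) i) (2 * i) else 0)"
        using mem(2) by (cases "k = 2 * i") (simp_all only: simp_thms if_False if_True sum.neutral_const sum.delta' sum.delta finite_atLeastAtMost)
    qed
    also have "\<dots> = coeff (Q (2 * i) i) (2 * i)" using mem(1) by simp
    finally have cp: "coeff p (2 * i) = coeff (Q (2 * i) i) (2 * i)" .
    let ?S = "\<Sum>T\<in>subspace_types M (2 * i) i. smult (w (rep T)) (P (rep T))"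
    have fin: "finite (subspace_types M (2 * i) i)"
      using finite_subspace_types(2)[of "2 * i" "2 * i" i] False by simp
    have degS: "degree ?S \<le> 0"
    proof (rule degree_sum_le[OF fin])
      fix T assume T: "T \<in> subspace_types M (2 * i) i"
      obtain q' U' where x: "rep T = (q', U')" by (cases "rep T")
      then have "(q', U') \<in> T" using rep T by metis
      note D = subspace_typesD[OF T this]
      have "degree (smult (w (rep T)) (P (rep T))) \<le> degree (P (rep T))" by (rule degree_smult_le)
      also have "\<dots> \<le> 0" using degree_type_poly[OF D(1), of i n] D(3) by (simp add: P_def x)
      finally show "degree (smult (w (rep T)) (P (rep T))) \<le> 0" .
    qed
    \<comment> \<open>The extremal types contribute constants, and \<open>falling_poly\<close> is
      monic, so their sum is the top coefficient.\<close>
    then obtain s where s: "?S = [:s:]" by (meson degree_eq_zeroE le_zero_eq)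
    have "coeff (Q (2 * i) i) (2 * i) = s"
      unfolding Q_def s using monic_falling_poly[of "2 * i"] by (simp add: mult.commute)
    also have "s = (\<Sum>T\<in>subspace_types M (2 * i) i. w (rep T) * coeff (P (rep T)) 0)"
      using arg_cong[OF s, of "\<lambda>p. coeff p 0"] by (simp add: coeff_sum)
    also have "\<dots> = (\<Sum>T\<in>subspace_types M (2 * i) i. (-1) ^ i * (\<bar>w (rep T)\<bar> * coeff (P (rep T)) 0))"
    proof (rule sum.cong[OF refl])
      fix T assume T: "T \<in> subspace_types M (2 * i) i"
      obtain q' U' where x: "rep T = (q', U')" by (cases "rep T")
      then have "(q', U') \<in> T" using rep T by metis
      note D = subspace_typesD[OF T this]
      have "U' \<in> intersection_lattice M q'" using D(1) by (simp add: move_subspaces_def)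
      then have "mu0 M q' U' = (-1) ^ i" using mu0_extremal D(2,3) by simp
      then have "w (rep T) = (-1) ^ i * \<bar>w (rep T)\<bar>"
        by (simp add: w_def x abs_mult power_abs)
      then show "w (rep T) * coeff (P (rep T)) 0 = (-1) ^ i * (\<bar>w (rep T)\<bar> * coeff (P (rep T)) 0)"
        by (metis mult.assoc)
    qed
    also have "\<dots> = (-1) ^ i * (\<Sum>T\<in>subspace_types M (2 * i) i. \<bar>w (rep T)\<bar> * coeff (P (rep T)) 0)"
      by (simp add: sum_distrib_left)
    finally have lead: "coeff (Q (2 * i) i) (2 * i) = (-1) ^ i * (\<Sum>T\<in>subspace_types M (2 * i) i. \<bar>w (rep T)\<bar> * coeff (P (rep T)) 0)" .
    have "(\<Sum>T\<in>subspace_types M (2 * i) i. \<bar>w (rep T)\<bar> * coeff (P (rep T)) 0) > 0"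
    proof (rule sum_pos[OF fin extremal_exists])
      fix T assume T: "T \<in> subspace_types M (2 * i) i"
      obtain q' U' where x: "rep T = (q', U')" by (cases "rep T")
      then have "(q', U') \<in> T" using rep T by metis
      note D = subspace_typesD[OF T this]
      have "U' \<in> intersection_lattice M q'" using D(1) by (simp add: move_subspaces_def)
      then have "mu0 M q' U' = (-1) ^ i" using mu0_extremal D(2,3) by simp
      then have "\<bar>w (rep T)\<bar> > 0" using card_automorphisms_pos[of q' U'] by (simp add: w_def x)
      then show "\<bar>w (rep T)\<bar> * coeff (P (rep T)) 0 > 0"
        using type_poly_extremal[OF D(1-3), of n] by (simp add: P_def x)
    qed
    then have "coeff p (2 * i) \<noteq> 0" unfolding cp lead by simp
    then show ?thesis using le le_degree by (metis antisym)
  qed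
  with eval_p show ?thesis by blast
qed

section \<open>Constancy of the second coefficient\<close>

text \<open>
  The limit of the increments divided by \<open>n\<close> makes \<open>\<gamma> 1 1 (n + 1) - \<gamma> 1 1 n\<close> independent of \<open>n\<close>, and
  then periodicity makes it vanish.
\<close>

lemma second_coefficient_const:
  assumes int: "\<And>v. v extreme_point_of B \<Longrightarrow> integral_point v"
  shows "\<gamma> 1 1 n = \<gamma> 1 1 0"
proof -
  obtain C where C: "(\<lambda>n. (N (n + 1) - N n) / real (n + 1)) \<longlonglongrightarrow> C"
    using num_points_increment_tendsto[OF polygon int] by blast
  have per: "periodic (\<gamma> 1 1)" "periodic (\<gamma> 1 2)"
    using coefficients by (auto simp: count_coefficients_def)
  have "\<exists>p>0. \<forall>n k. (\<gamma> 1 1 (n + k * p), \<gamma> 1 2 (n + k * p)) = (\<gamma> 1 1 n, \<gamma> 1 2 n)"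
    by (rule periodic_multiple[OF periodic_map2[OF per, of Pair]])
  then obtain p where p: "p > 0" "\<And>n k. \<gamma> 1 1 (n + k * p) = \<gamma> 1 1 n" "\<And>n k. \<gamma> 1 2 (n + k * p) = \<gamma> 1 2 n"
    by auto
  have N: "N n = vol B * real n ^ 2 + \<gamma> 1 1 n * real n + \<gamma> 1 2 n" for n
    using N_poly by (simp add: has_constituents_def power2_eq_square algebra_simps)
  have step: "\<gamma> 1 1 (n + 1) = \<gamma> 1 1 n + (C - 2 * vol B)" for n
  proof -
    \<comment> \<open>What is left of the increment of \<open>N\<close> after the part proportional
      to the larger argument \<open>n + k * p + 1\<close>.\<close>
    define D where "D = \<gamma> 1 1 n + \<gamma> 1 2 (n + 1) - \<gamma> 1 2 n - vol B"
    have lim: "(\<lambda>k. (N (n + k * p + 1) - N (n + k * p)) / real (n + k * p + 1)) \<longlonglongrightarrow> C"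
      using filterlim_compose[OF C filterlim_progression[OF p(1), of n]] .
    have eq: "(N (n + k * p + 1) - N (n + k * p)) / real (n + k * p + 1)
        = (2 * vol B + \<gamma> 1 1 (n + 1) - \<gamma> 1 1 n) + D * inverse (real (n + k * p + 1))" for k
    proof -
      let ?x = "real (n + k * p + 1)"
      have 1: "N (n + k * p + 1) = vol B * ?x ^ 2 + \<gamma> 1 1 (n + 1) * ?x + \<gamma> 1 2 (n + 1)"
        unfolding N using p(2)[of "n + 1" k] p(3)[of "n + 1" k] by (simp add: ac_simps)
      have 2: "N (n + k * p) = vol B * (?x - 1) ^ 2 + \<gamma> 1 1 n * (?x - 1) + \<gamma> 1 2 n"
        unfolding N p(2,3) by simp
      have "N (n + k * p + 1) - N (n + k * p) = (2 * vol B + \<gamma> 1 1 (n + 1) - \<gamma> 1 1 n) * ?x + D"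
        unfolding 1 2 D_def by (simp add: power2_eq_square algebra_simps)
      moreover have "?x \<noteq> 0" by (simp only: of_nat_eq_0_iff)
      moreover have "(A * x + D) / x = A + D * inverse x" if "x \<noteq> 0" for A x :: real
        using that by (simp add: field_simps)
      ultimately show ?thesis by (simp only:)
    qed
    have "(\<lambda>k. inverse (real (n + k * p + 1))) \<longlonglongrightarrow> 0"
      using filterlim_compose[OF LIMSEQ_inverse_real_of_nat filterlim_progression[OF p(1), of n]] by simp
    then have "(\<lambda>k. (2 * vol B + \<gamma> 1 1 (n + 1) - \<gamma> 1 1 n) + D * inverse (real (n + k * p + 1)))
        \<longlonglongrightarrow> (2 * vol B + \<gamma> 1 1 (n + 1) - \<gamma> 1 1 n) + D * 0"
      by (intro tendsto_add tendsto_mult tendsto_const)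
    then have "C = 2 * vol B + \<gamma> 1 1 (n + 1) - \<gamma> 1 1 n"
      using lim unfolding eq by (simp add: LIMSEQ_unique)
    then show ?thesis by simp
  qed
  have lin: "\<gamma> 1 1 n = \<gamma> 1 1 0 + real n * (C - 2 * vol B)" for n
  proof (induction n)
    case (Suc n)
    then show ?case using step[of n] by (simp add: algebra_simps)
  qed simp
  have "real p * (C - 2 * vol B) = 0" using lin[of p] p(2)[of 0 1] by simp
  then have "C - 2 * vol B = 0" using p(1) by simp
  then show ?thesis using lin[of n] by (simp only: mult_zero_right add_0_right)
qed

text \<open>Codimension 1 forces \<open>\<kappa> = 2\<close>, so the flat is a single label. Its
  leading coefficient, at degree 3, is a limit over all \<open>n\<close> and hence the same on all
  residue classes.\<close>

lemma contribution_1_const: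
  assumes int: "\<And>v. v extreme_point_of B \<Longrightarrow> integral_point v"
    and q: "q \<ge> 1" and U: "U \<in> intersection_lattice M q"
  shows "\<exists>c. \<forall>n. contribution q 1 n U = c"
proof (cases "U = configs_on {1..q}")
  case True
  have "contribution q 1 n U = vol B ^ q * (\<gamma> 1 1 0 / vol B * real q)" for n
  proof -
    have "\<gamma> 1 1 n = \<gamma> 1 1 0" by (rule second_coefficient_const) (rule int)
    then show ?thesis
      unfolding True contribution_space Coeff_N_power quadratic_power_coeff
      by (simp add: trinomial_poly_def falling_poly_def)
  qed
  then show ?thesis by blast
next
  case False
  note bounds = lattice_elt_bounds[OF U False]
  show ?thesis
  proof (cases "codim q U = 1")
    case False
    then have "contribution q 1 n U = 0" for n
      using Coeff_\<alpha>_eq_0[OF move_subspacesI[OF q U] \<kappa>_le, of 1 n] bounds by simp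
    then show ?thesis by blast
  next
    case True
    note mem = move_subspacesI[OF q U]
    have k: "\<kappa> q U = 2" using bounds True by simp
    then have eq: "\<kappa> q U = 2 * codim q U" using True by simp
    have "card (implied M q U) = 1" using extremal_matching(2)[OF U eq] True by simp
    then obtain l where l: "implied M q U = {l}" by (auto simp: card_1_singleton_iff)
    then have "l \<in> labels M {1..q}" using implied_labels by blast
    then obtain m i j where lm: "l = (m, {i, j})" "i \<noteq> j" "m \<in> M"
      by (auto simp: labels_def card_2_iff)
    obtain L where L: "(\<lambda>n. real (card (grid_configs {i, j} {(m, {i, j})} (board_points B n))) / real n ^ 3) \<longlonglongrightarrow> L"
      using pair_count_tendsto[OF moves lm(3,2) polygon] by blast
    have "\<alpha> q U n = real (card (grid_configs {i, j} {(m, {i, j})} (board_points B n)))" for n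
      unfolding subspace_count_eq[OF U] l lm(1) by (simp add: touched_def)
    then have L': "(\<lambda>n. \<alpha> q U n / real n ^ 3) \<longlonglongrightarrow> L" using L by simp
    have coef: "coeff (\<alpha>_poly q U n) 3 = L" for n
      by (rule constituents_coeff_eq_limit[OF has_constituents_constituents[OF \<alpha>_quasi[OF mem]] _ L'])
        (use \<alpha>_degree[OF mem, of n] k True in simp)
    have "contribution q 1 n U = real_of_int (mu0 M q U) * (L * vol B ^ (q - 2))" for n
    proof -
      \<comment> \<open>The coefficient at degree \<open>2 \<kappa> = 4\<close> vanishes, so only
        \<open>s = 1\<close> remains in the sum of \<open>Coeff_\<alpha>\<close>.\<close>
      have "coeff (\<alpha>_poly q U n) 4 = 0" using \<alpha>_coeff_eq_0[OF mem, of 0 n] k True by simp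
      then show ?thesis
        using coef[of n] Coeff_\<alpha>[OF mem \<kappa>_le, of 1 n] by (simp add: k coeff_0_power)
    qed
    then show ?thesis by blast
  qed
qed

lemma \<gamma>_1_const:
  assumes int: "\<And>v. v extreme_point_of B \<Longrightarrow> integral_point v" and q: "q \<ge> 1"
  shows "\<exists>c. \<forall>n. \<gamma> q 1 n = c"
proof -
  have "\<forall>U\<in>intersection_lattice M q. \<exists>c. \<forall>n. contribution q 1 n U = c"
    using contribution_1_const[OF int q] by blast
  from bchoice[OF this] obtain c where c: "\<forall>U\<in>intersection_lattice M q. \<forall>n. contribution q 1 n U = c U" ..
  have "\<gamma> q 1 n = (\<Sum>U\<in>intersection_lattice M q. c U) / fact q" for n
  proof -
    have "fact q * \<gamma> q 1 n = (\<Sum>U\<in>intersection_lattice M q. c U)"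
      unfolding \<gamma>_eq_sum_contribution[OF q] using c by (intro sum.cong) auto
    then show ?thesis by (simp add: field_simps)
  qed
  then show ?thesis by blast
qed

end

text \<open>The formula appears with two lower limits: 2 in general, and
  \<open>max 2 (half_up i)\<close> when \<open>N\<close> is a pure square term, as for the unit
  square, where it is \<open>n^2\<close>. The factor \<open>vol B ^ q\<close> stands outside the
  polynomial because it is exponential in \<open>q\<close> unless the area is 1. Fixing
  \<open>n\<close> selects a constituent.\<close>

theorem theorem4p2:
  fixes M :: "(int \<times> int) set" and B :: "(real \<times> real) set"
    and \<gamma> :: "nat \<Rightarrow> nat \<Rightarrow> nat \<Rightarrow> real"
    and \<Gamma> :: "nat \<Rightarrow> config set \<Rightarrow> nat \<Rightarrow> nat \<Rightarrow> real"
    and rep :: "(nat \<times> config set) set \<Rightarrow> nat \<times> config set"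
  assumes "basic_moves M"
    and "rational_polygon B"
    and "count_coefficients M B \<gamma>"
    and "count_expansions M B \<Gamma>"
    and "\<And>\<kappa> \<nu> T. T \<in> subspace_types M \<kappa> \<nu> \<Longrightarrow> rep T \<in> T"
  shows "(\<forall>q\<ge>1. \<forall>i n. fact q * \<gamma> q i n = coefficient_formula M B \<Gamma> rep 2 q i n) \<and>
    ((\<forall>n. num_points B n = vol B * real n ^ 2) \<longrightarrow>
       (\<forall>q\<ge>1. \<forall>i n. fact q * \<gamma> q i n =
          coefficient_formula M B \<Gamma> rep (max 2 (half_up i)) q i n)) \<and>
    (\<forall>i n. \<exists>p :: real poly. degree p = 2 * i \<and>
       (\<forall>q\<ge>1. fact q * \<gamma> q i n = vol B ^ q * poly p (real q))) \<and>
    (\<forall>q\<ge>1. \<forall>n. \<gamma> q 0 n = vol B ^ q / fact q) \<and>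
    ((\<forall>v. v extreme_point_of B \<longrightarrow> integral_point v) \<longrightarrow>
       (\<forall>q\<ge>1. \<exists>c. \<forall>n. \<gamma> q 1 n = c))"
proof -
  interpret counting_problem M B \<gamma> \<Gamma>
    using assms(1-4) by unfold_locales
  have rep: "\<forall>k \<nu>. \<forall>T\<in>subspace_types M k \<nu>. rep T \<in> T" using assms(5) by blast
  show ?thesis
  proof (intro conjI allI impI)
    fix q i n :: nat assume q: "q \<ge> 1"
    have "\<forall>U\<in>intersection_lattice M q. card (involved M q U) < 2 \<longrightarrow> U \<noteq> configs_on {1..q} \<longrightarrow> contribution q i n U = 0"
      using lattice_elt_bounds(1)[of _ q] by fastforce
    then show "fact q * \<gamma> q i n = coefficient_formula M B \<Gamma> rep 2 q i n"
      by (rule coefficient_formula_general[OF q rep order_refl])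
  next
    fix q i n :: nat assume N: "\<forall>n. num_points B n = vol B * real n ^ 2" and q: "q \<ge> 1"
    show "fact q * \<gamma> q i n = coefficient_formula M B \<Gamma> rep (max 2 (half_up i)) q i n"
      by (rule coefficient_formula_general[OF q rep _ small_contribution[OF N q]]) simp
  next
    fix i n
    show "\<exists>p :: real poly. degree p = 2 * i \<and> (\<forall>q\<ge>1. fact q * \<gamma> q i n = vol B ^ q * poly p (real q))"
      by (rule coefficient_polynomial[OF rep])
  next
    fix q n :: nat assume "q \<ge> 1"
    then show "\<gamma> q 0 n = vol B ^ q / fact q" by (rule \<gamma>_0)
  next
    fix q :: nat assume "\<forall>v. v extreme_point_of B \<longrightarrow> integral_point v" "q \<ge> 1"
    then show "\<exists>c. \<forall>n. \<gamma> q 1 n = c" using \<gamma>_1_const by blast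
  qed
qed

end
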